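(* Let $R$ be a commutative $\mathbb{Q}$-algebra and let $\delta \geqslant 1$ be an integer. Let $\mathfrak{g}$ be a $\delta$-weight-graded dg Lie algebra over $R$ and let $\varphi \in \mathrm{MC}(\mathcal{F}^{\delta}\mathfrak{g})$ be a Maurer--Cartan element. (1) The Kaledin class $K_{\varphi}$ is zero if and only if there exists $\lambda \in \mathfrak{g}_0$ such that $\lambda \cdot \varphi = \varphi^{(\delta)}$. (2) Let $\psi \in \mathrm{MC}(\mathfrak{g})$ be a Maurer--Cartan element concentrated in weight $\delta$. If $H_{-1}(\mathfrak{g}^{\psi}) = 0$, then $\psi$ is rigid, i.e. every Maurer--Cartan element $\varphi \in \mathrm{MC}(\mathcal{F}^{\delta}\mathfrak{g})$ such that $\varphi^{(\delta)} = \psi$ is gauge equivalent to $\psi$. (3) Let $S$ be a faithfully flat commutative $R$-algebra. The element $\varphi$ is gauge equivalent to $\varphi^{(\delta)}$ in $\mathfrak{g}$ if and only if $\varphi \otimes 1$ is gauge equivalent to $\varphi^{(\delta)} \otimes 1$ in $\mathfrak{g} \otimes S$.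
   Context: A dg Lie algebra $(\mathfrak{g},[-,-],d)$ over $R$ is homologically graded, with bracket of degree $0$ and $d$ a square-zero derivation of degree $-1$; $\mathfrak g_i$ is its degree $i$ part. $\mathrm{MC}(\mathfrak g)$ is the set of $\varphi\in\mathfrak g_{-1}$ with $d\varphi+\tfrac12[\varphi,\varphi]=0$. For $\varphi\in\mathrm{MC}(\mathfrak g)$, the twisted dg Lie algebra $\mathfrak g^{\varphi}$ is $\mathfrak g$ with the same bracket and differential $d^{\varphi}=d+[\varphi,-]$. A $\delta$-weight-graded dg Lie algebra is a dg Lie algebra with an additional weight grading such that $\mathfrak g\cong\prod_{k\geqslant1}\mathfrak g^{(k)}$, $d(\mathfrak g^{(k)})\subset\mathfrak g^{(k+\delta)}$ and $[\mathfrak g^{(k)},\mathfrak g^{(l)}]\subset\mathfrak g^{(k+l)}$. It is complete for the filtration $\mathcal F^n\mathfrak g=\prod_{k\geqslant n}\mathfrak g^{(k)}$. An element is written $\varphi=\varphi^{(1)}+\varphi^{(2)}+\cdots$ with $\varphi^{(k)}\in\mathfrak g^{(k)}$. Gauge action of $\lambda\in\mathfrak g_0$ on $\varphi\in\mathrm{MC}(\mathfrak g)$: $\lambda\cdot\varphi=e^{\mathrm{ad}_\lambda}(\varphi)-\frac{e^{\mathrm{ad}_\lambda}-\mathrm{id}}{\mathrm{ad}_\lambda}(d\lambda)$, where $\mathrm{ad}_\lambda=[\lambda,-]$. Two Maurer--Cartan elements are gauge equivalent if one is $\lambda\cdot$ the other for some $\lambda\in\mathfrak g_0$. $\mathfrak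 g[\![\hbar]\!]$ is the dg Lie algebra of formal power series $\sum_{i\geqslant0}x_i\hbar^i$, $x_i\in\mathfrak g$, with $\hbar$-linearly extended structure, and $\partial_\hbar(\sum_i x_i\hbar^i)=\sum_{i\geqslant1}i x_i\hbar^{i-1}$. For $\varphi\in\mathrm{MC}(\mathcal F^\delta\mathfrak g)$, its prismatic decomposition is $\mathfrak D(\varphi)=\varphi^{(\delta)}+\varphi^{(\delta+1)}\hbar+\varphi^{(\delta+2)}\hbar^2+\cdots$, which is a Maurer--Cartan element of $\mathfrak g[\![\hbar]\!]$; $\partial_\hbar\mathfrak D(\varphi)$ is a cycle of $\mathfrak g[\![\hbar]\!]^{\mathfrak D(\varphi)}$. The Kaledin class of $\varphi$ is $K_\varphi=[\partial_\hbar\mathfrak D(\varphi)]\in H_{-1}(\mathfrak g[\![\hbar]\!]^{\mathfrak D(\varphi)})$. In (3), $\mathfrak g\otimes S$ denotes the base change as a $\delta$-weight-graded dg Lie algebra over $S$, i.e. $\prod_{k\geqslant1}\mathfrak g^{(k)}\otimes_R S$. *)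

theory Defs
  imports
    "HOL-Algebra.Module"
    "HOL-Algebra.RingHom"
    "HOL-Algebra.Generated_Groups"
    "HOL-Algebra.Elementary_Groups"
    "HOL-Algebra.Free_Abelian_Groups"
begin

section \<open>Linear algebra over a commutative ring\<close>

definition rat_ring :: "rat ring" where
  "rat_ring = \<lparr>carrier = UNIV, monoid.mult = (*), one = 1, ring.zero = 0, add = (+)\<rparr>"

text \<open>The structure map \<open>\<rat> \<rightarrow> R\<close> is unique when it exists, so it need not be part of the data.\<close>

locale comm_Q_algebra = cring R for R :: "'r ring" +
  assumes rat_structure_map: "\<exists>\<iota>. \<iota> \<in> ring_hom rat_ring R"

definition inv_nat :: "'r ring \<Rightarrow> nat \<Rightarrow> 'r" where
  "inv_nat R n = inv\<^bsub>R\<^esub> ([n] \<cdot>\<^bsub>R\<^esub> \<one>\<^bsub>R\<^esub>)"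

definition lin_maps :: "'r ring \<Rightarrow> ('r, 'm) module \<Rightarrow> ('r, 'n) module \<Rightarrow> ('m \<Rightarrow> 'n) set" where
  "lin_maps R M N = {f \<in> carrier M \<rightarrow> carrier N.
     (\<forall>x\<in>carrier M. \<forall>y\<in>carrier M. f (x \<oplus>\<^bsub>M\<^esub> y) = f x \<oplus>\<^bsub>N\<^esub> f y) \<and>
     (\<forall>a\<in>carrier R. \<forall>x\<in>carrier M. f (a \<odot>\<^bsub>M\<^esub> x) = a \<odot>\<^bsub>N\<^esub> f x)}"

definition bilin_maps ::
    "'r ring \<Rightarrow> ('r, 'm) module \<Rightarrow> ('r, 'n) module \<Rightarrow> ('r, 'p) module \<Rightarrow> ('m \<Rightarrow> 'n \<Rightarrow> 'p) set" where
  "bilin_maps R M N P = {b. (\<forall>x\<in>carrier M. b x \<in> lin_maps R N P) \<and>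
     (\<forall>y\<in>carrier N. (\<lambda>x. b x y) \<in> lin_maps R M P)}"

text \<open>The fields \<open>mult\<close> and \<open>one\<close> of a module record carry no meaning.
  Elements of a product are extensional functions.\<close>

definition prod_module :: "'i set \<Rightarrow> ('i \<Rightarrow> ('r, 'm) module) \<Rightarrow> ('r, 'i \<Rightarrow> 'm) module" where
  "prod_module I M =
    \<lparr>carrier = (\<Pi>\<^sub>E i\<in>I. carrier (M i)),
     monoid.mult = (\<lambda>_ _. undefined),
     one = undefined,
     ring.zero = (\<lambda>i\<in>I. \<zero>\<^bsub>M i\<^esub>),
     add = (\<lambda>x y. \<lambda>i\<in>I. x i \<oplus>\<^bsub>M i\<^esub> y i),
     smult = (\<lambda>a x. \<lambda>i\<in>I. a \<odot>\<^bsub>M i\<^esub> x i)\<rparr>"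


section \<open>dg Lie algebras\<close>

record ('r, 'g) dgla =
  gr :: "int \<Rightarrow> ('r, 'g) module"
  bra :: "int \<Rightarrow> int \<Rightarrow> 'g \<Rightarrow> 'g \<Rightarrow> 'g"
  dif :: "int \<Rightarrow> 'g \<Rightarrow> 'g"

definition koszul :: "('r, 'g) module \<Rightarrow> int \<Rightarrow> 'g \<Rightarrow> 'g" where
  "koszul M n x = (if even n then x else \<ominus>\<^bsub>M\<^esub> x)"

locale dg_lie_algebra = cring R for R :: "'r ring" +
  fixes L :: "('r, 'g, 'z) dgla_scheme"
  assumes gr_module: "module R (gr L i)"
    and dif_linear: "dif L i \<in> lin_maps R (gr L i) (gr L (i - 1))"
    and dif_dif: "x \<in> carrier (gr L i) \<Longrightarrow> dif L (i - 1) (dif L i x) = \<zero>\<^bsub>gr L (i - 2)\<^esub>"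
    and bra_bilinear: "bra L i j \<in> bilin_maps R (gr L i) (gr L j) (gr L (i + j))"
    and bra_antisymmetric:
      "\<lbrakk>x \<in> carrier (gr L i); y \<in> carrier (gr L j)\<rbrakk> \<Longrightarrow>
        bra L i j x y = koszul (gr L (i + j)) (i * j + 1) (bra L j i y x)"
    and jacobi:
      "\<lbrakk>x \<in> carrier (gr L i); y \<in> carrier (gr L j); z \<in> carrier (gr L k)\<rbrakk> \<Longrightarrow>
        bra L i (j + k) x (bra L j k y z) =
        bra L (i + j) k (bra L i j x y) z
        \<oplus>\<^bsub>gr L (i + j + k)\<^esub>
        koszul (gr L (i + j + k)) (i * j) (bra L j (i + k) y (bra L i k x z))"
    and leibniz:
      "\<lbrakk>x \<in> carrier (gr L i); y \<in> carrier (gr L j)\<rbrakk> \<Longrightarrow>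
        dif L (i + j) (bra L i j x y) =
        bra L (i - 1) j (dif L i x) y
        \<oplus>\<^bsub>gr L (i + j - 1)\<^esub>
        koszul (gr L (i + j - 1)) i (bra L i (j - 1) x (dif L j y))"

definition MC :: "'r ring \<Rightarrow> ('r, 'g, 'z) dgla_scheme \<Rightarrow> 'g set" where
  "MC R L = {\<phi> \<in> carrier (gr L (- 1)).
     dif L (- 1) \<phi> \<oplus>\<^bsub>gr L (- 2)\<^esub> inv_nat R 2 \<odot>\<^bsub>gr L (- 2)\<^esub> bra L (- 1) (- 1) \<phi> \<phi>
     = \<zero>\<^bsub>gr L (- 2)\<^esub>}"

definition twist :: "('r, 'g, 'z) dgla_scheme \<Rightarrow> 'g \<Rightarrow> ('r, 'g, 'z) dgla_scheme" where
  "twist L \<phi> = L\<lparr>dif := \<lambda>i x. dif L i x \<oplus>\<^bsub>gr L (i - 1)\<^esub> bra L (- 1) i \<phi> x\<rparr>"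

definition cycles :: "('r, 'g, 'z) dgla_scheme \<Rightarrow> int \<Rightarrow> 'g set" where
  "cycles L i = {x \<in> carrier (gr L i). dif L i x = \<zero>\<^bsub>gr L (i - 1)\<^esub>}"

definition boundaries :: "('r, 'g, 'z) dgla_scheme \<Rightarrow> int \<Rightarrow> 'g set" where
  "boundaries L i = dif L (i + 1) ` carrier (gr L (i + 1))"

text \<open>The quotient group \<open>A_Mod\<close> is written multiplicatively: its \<open>\<one>\<close> is the zero class.\<close>

definition homology :: "('r, 'g, 'z) dgla_scheme \<Rightarrow> int \<Rightarrow> 'g set monoid" where
  "homology L i = ((gr L i)\<lparr>carrier := cycles L i\<rparr>) A_Mod (boundaries L i)"

definition homology_class :: "('r, 'g, 'z) dgla_scheme \<Rightarrow> int \<Rightarrow> 'g \<Rightarrow> 'g set" where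
  "homology_class L i x = boundaries L i +>\<^bsub>gr L i\<^esub> x"

text \<open>Formal power series: \<open>x n\<close> is the coefficient of the \<open>n\<close>th power of the variable.\<close>

definition powser :: "('r, 'g, 'z) dgla_scheme \<Rightarrow> ('r, nat \<Rightarrow> 'g) dgla" where
  "powser L =
    \<lparr>gr = (\<lambda>i. prod_module UNIV (\<lambda>_. gr L i)),
     bra = (\<lambda>i j x y n. finsum (gr L (i + j)) (\<lambda>m. bra L i j (x m) (y (n - m))) {..n}),
     dif = (\<lambda>i x n. dif L i (x n))\<rparr>"

definition powser_deriv :: "('r, 'g, 'z) dgla_scheme \<Rightarrow> int \<Rightarrow> (nat \<Rightarrow> 'g) \<Rightarrow> nat \<Rightarrow> 'g" where
  "powser_deriv L i x n = [Suc n] \<cdot>\<^bsub>gr L i\<^esub> x (Suc n)"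


section \<open>Weight-graded dg Lie algebras\<close>

text \<open>\<open>wt L i k\<close> is the part of degree \<open>i\<close> and weight \<open>k\<close>, and \<open>wproj L i k\<close> is the projection
  onto it coming from the isomorphism of \<open>gr L i\<close> with the product of its weight parts, so that
  \<open>\<phi>\<^sup>(\<^sup>k\<^sup>)\<close> is \<open>wproj L i k \<phi>\<close>.  Only weights \<open>k \<ge> 1\<close> are meaningful.\<close>

record ('r, 'g) wdgla = "('r, 'g) dgla" +
  wt :: "int \<Rightarrow> nat \<Rightarrow> 'g set"
  wproj :: "int \<Rightarrow> nat \<Rightarrow> 'g \<Rightarrow> 'g"

definition wt_module :: "('r, 'g, 'z) wdgla_scheme \<Rightarrow> int \<Rightarrow> nat \<Rightarrow> ('r, 'g) module" where
  "wt_module L i k = (gr L i)\<lparr>carrier := wt L i k\<rparr>"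

definition filt :: "('r, 'g, 'z) wdgla_scheme \<Rightarrow> nat \<Rightarrow> int \<Rightarrow> 'g set" where
  "filt L n i = {x \<in> carrier (gr L i). \<forall>k. 1 \<le> k \<and> k < n \<longrightarrow> wproj L i k x = \<zero>\<^bsub>gr L i\<^esub>}"

text \<open>The last two axioms make the structure compatible with the complete filtration.
  Since an element of a product is not a finite sum of its components, the two preceding
  axioms alone do not determine the differential and the bracket by their components.\<close>

locale weight_graded_dg_lie_algebra = dg_lie_algebra R L
  for R :: "'r ring" and \<delta> :: nat and L :: "('r, 'g, 'z) wdgla_scheme" +
  assumes wt_submodule: "1 \<le> k \<Longrightarrow> submodule (wt L i k) R (gr L i)"
    and wproj_linear: "1 \<le> k \<Longrightarrow> wproj L i k \<in> lin_maps R (gr L i) (wt_module L i k)"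
    and wproj_same: "\<lbrakk>1 \<le> k; x \<in> wt L i k\<rbrakk> \<Longrightarrow> wproj L i k x = x"
    and wproj_other:
      "\<lbrakk>1 \<le> k; 1 \<le> l; k \<noteq> l; x \<in> wt L i k\<rbrakk> \<Longrightarrow> wproj L i l x = \<zero>\<^bsub>gr L i\<^esub>"
    and product_decomposition:
      "bij_betw (\<lambda>x. \<lambda>k\<in>{1..}. wproj L i k x) (carrier (gr L i)) (\<Pi>\<^sub>E k\<in>{1..}. wt L i k)"
    and dif_wt: "\<lbrakk>1 \<le> k; x \<in> wt L i k\<rbrakk> \<Longrightarrow> dif L i x \<in> wt L (i - 1) (k + \<delta>)"
    and bra_wt:
      "\<lbrakk>1 \<le> k; 1 \<le> l; x \<in> wt L i k; y \<in> wt L j l\<rbrakk> \<Longrightarrow> bra L i j x y \<in> wt L (i + j) (k + l)"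
    and dif_filt: "x \<in> filt L n i \<Longrightarrow> dif L i x \<in> filt L n (i - 1)"
    and bra_filt: "\<lbrakk>x \<in> filt L n i; y \<in> filt L m j\<rbrakk> \<Longrightarrow> bra L i j x y \<in> filt L (n + m) (i + j)"

definition MC_filt :: "'r ring \<Rightarrow> ('r, 'g, 'z) wdgla_scheme \<Rightarrow> nat \<Rightarrow> 'g set" where
  "MC_filt R L n = MC R L \<inter> filt L n (- 1)"

text \<open>The sum of a series in degree \<open>i\<close>, for the topology defined by the filtration.\<close>

definition filt_sum :: "('r, 'g, 'z) wdgla_scheme \<Rightarrow> int \<Rightarrow> (nat \<Rightarrow> 'g) \<Rightarrow> 'g" where
  "filt_sum L i a = (THE s. s \<in> carrier (gr L i) \<and>
     (\<forall>n. \<exists>N. \<forall>m\<ge>N. s \<ominus>\<^bsub>gr L i\<^esub> finsum (gr L i) a {..<m} \<in> filt L n i))"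

text \<open>\<open>exp_ad\<close> is \<open>e\<^sup>a\<^sup>d\<close>, and \<open>exp_ad1\<close> is \<open>(e\<^sup>a\<^sup>d - id) / ad\<close>, the power series
  with coefficients \<open>1 / (n + 1)!\<close>; both act on elements of degree \<open>i\<close>.\<close>

definition exp_ad :: "'r ring \<Rightarrow> ('r, 'g, 'z) wdgla_scheme \<Rightarrow> 'g \<Rightarrow> int \<Rightarrow> 'g \<Rightarrow> 'g" where
  "exp_ad R L l i x =
     filt_sum L i (\<lambda>n. inv_nat R (fact n) \<odot>\<^bsub>gr L i\<^esub> (bra L 0 i l ^^ n) x)"

definition exp_ad1 :: "'r ring \<Rightarrow> ('r, 'g, 'z) wdgla_scheme \<Rightarrow> 'g \<Rightarrow> int \<Rightarrow> 'g \<Rightarrow> 'g" where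
  "exp_ad1 R L l i x =
     filt_sum L i (\<lambda>n. inv_nat R (fact (Suc n)) \<odot>\<^bsub>gr L i\<^esub> (bra L 0 i l ^^ n) x)"

definition gauge :: "'r ring \<Rightarrow> ('r, 'g, 'z) wdgla_scheme \<Rightarrow> 'g \<Rightarrow> 'g \<Rightarrow> 'g" where
  "gauge R L l \<phi> = exp_ad R L l (- 1) \<phi> \<ominus>\<^bsub>gr L (- 1)\<^esub> exp_ad1 R L l (- 1) (dif L 0 l)"

definition gauge_equiv :: "'r ring \<Rightarrow> ('r, 'g, 'z) wdgla_scheme \<Rightarrow> 'g \<Rightarrow> 'g \<Rightarrow> bool" where
  "gauge_equiv R L \<phi> \<psi> \<longleftrightarrow>
     (\<exists>l\<in>carrier (gr L 0). gauge R L l \<phi> = \<psi> \<or> gauge R L l \<psi> = \<phi>)"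

definition prismatic :: "('r, 'g, 'z) wdgla_scheme \<Rightarrow> nat \<Rightarrow> 'g \<Rightarrow> nat \<Rightarrow> 'g" where
  "prismatic L \<delta> \<phi> n = wproj L (- 1) (\<delta> + n) \<phi>"

abbreviation kaledin_complex ::
    "('r, 'g, 'z) wdgla_scheme \<Rightarrow> nat \<Rightarrow> 'g \<Rightarrow> ('r, nat \<Rightarrow> 'g) dgla" where
  "kaledin_complex L \<delta> \<phi> \<equiv> twist (powser L) (prismatic L \<delta> \<phi>)"

definition kaledin_class :: "('r, 'g, 'z) wdgla_scheme \<Rightarrow> nat \<Rightarrow> 'g \<Rightarrow> (nat \<Rightarrow> 'g) set" where
  "kaledin_class L \<delta> \<phi> =
     homology_class (kaledin_complex L \<delta> \<phi>) (- 1) (powser_deriv L (- 1) (prismatic L \<delta> \<phi>))"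


section \<open>Tensor products\<close>

text \<open>\<open>M \<otimes>\<^sub>R N\<close> is the free abelian group on pairs modulo the subgroup generated by the
  bilinearity relations; its elements are cosets, and as a quotient group it is
  written multiplicatively.\<close>

definition tensor_free :: "('r, 'm) module \<Rightarrow> ('r, 'n) module \<Rightarrow> ('m \<times> 'n \<Rightarrow>\<^sub>0 int) monoid" where
  "tensor_free M N = free_Abelian_group (carrier M \<times> carrier N)"

definition tensor_rels :: "'r ring \<Rightarrow> ('r, 'm) module \<Rightarrow> ('r, 'n) module \<Rightarrow> ('m \<times> 'n \<Rightarrow>\<^sub>0 int) set" where
  "tensor_rels R M N =
     {frag_of (x \<oplus>\<^bsub>M\<^esub> x', y) - frag_of (x, y) - frag_of (x', y) | x x' y.
        x \<in> carrier M \<and> x' \<in> carrier M \<and> y \<in> carrier N} \<union>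
     {frag_of (x, y \<oplus>\<^bsub>N\<^esub> y') - frag_of (x, y) - frag_of (x, y') | x y y'.
        x \<in> carrier M \<and> y \<in> carrier N \<and> y' \<in> carrier N} \<union>
     {frag_of (a \<odot>\<^bsub>M\<^esub> x, y) - frag_of (x, a \<odot>\<^bsub>N\<^esub> y) | a x y.
        a \<in> carrier R \<and> x \<in> carrier M \<and> y \<in> carrier N}"

definition tensor_null :: "'r ring \<Rightarrow> ('r, 'm) module \<Rightarrow> ('r, 'n) module \<Rightarrow> ('m \<times> 'n \<Rightarrow>\<^sub>0 int) set" where
  "tensor_null R M N = generate (tensor_free M N) (tensor_rels R M N)"

definition tensor_coset ::
    "'r ring \<Rightarrow> ('r, 'm) module \<Rightarrow> ('r, 'n) module \<Rightarrow> ('m \<times> 'n \<Rightarrow>\<^sub>0 int) \<Rightarrow> ('m \<times> 'n \<Rightarrow>\<^sub>0 int) set" where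
  "tensor_coset R M N c = tensor_null R M N #>\<^bsub>tensor_free M N\<^esub> c"

definition tensor :: "'r ring \<Rightarrow> ('r, 'm) module \<Rightarrow> ('r, 'n) module \<Rightarrow> ('m \<times> 'n \<Rightarrow>\<^sub>0 int) set monoid" where
  "tensor R M N = tensor_free M N Mod tensor_null R M N"

definition pure_tensor ::
    "'r ring \<Rightarrow> ('r, 'm) module \<Rightarrow> ('r, 'n) module \<Rightarrow> 'm \<Rightarrow> 'n \<Rightarrow> ('m \<times> 'n \<Rightarrow>\<^sub>0 int) set" where
  "pure_tensor R M N x y = tensor_coset R M N (frag_of (x, y))"

text \<open>\<open>tensor_map R M' N' f g\<close> is the map \<open>f \<otimes> g\<close> into \<open>M' \<otimes> N'\<close>, and \<open>tensor_map2 R M' N' f g\<close>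
  sends \<open>(x \<otimes> y, x' \<otimes> y')\<close> to \<open>f x x' \<otimes> g y y'\<close>.  They are computed on representatives; for
  (bi)linear \<open>f\<close> and \<open>g\<close> the image set is a singleton.\<close>

definition tensor_map ::
    "'r ring \<Rightarrow> ('r, 'p) module \<Rightarrow> ('r, 'q) module \<Rightarrow> ('m \<Rightarrow> 'p) \<Rightarrow> ('n \<Rightarrow> 'q) \<Rightarrow>
     ('m \<times> 'n \<Rightarrow>\<^sub>0 int) set \<Rightarrow> ('p \<times> 'q \<Rightarrow>\<^sub>0 int) set" where
  "tensor_map R M' N' f g C = the_elem
     ((\<lambda>c. tensor_coset R M' N' (frag_extend (\<lambda>(x, y). frag_of (f x, g y)) c)) ` C)"

definition tensor_map2 ::
    "'r ring \<Rightarrow> ('r, 'p) module \<Rightarrow> ('r, 'q) module \<Rightarrow>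
     ('m \<Rightarrow> 'm2 \<Rightarrow> 'p) \<Rightarrow> ('n \<Rightarrow> 'n2 \<Rightarrow> 'q) \<Rightarrow>
     ('m \<times> 'n \<Rightarrow>\<^sub>0 int) set \<Rightarrow> ('m2 \<times> 'n2 \<Rightarrow>\<^sub>0 int) set \<Rightarrow> ('p \<times> 'q \<Rightarrow>\<^sub>0 int) set" where
  "tensor_map2 R M' N' f g C D = the_elem
     ((\<lambda>(c, d). tensor_coset R M' N'
        (frag_extend (\<lambda>(x, y). frag_extend (\<lambda>(x', y'). frag_of (f x x', g y y')) d) c)) ` (C \<times> D))"

text \<open>\<open>N\<close> is faithfully flat if a sequence \<open>A \<rightarrow> B \<rightarrow> C\<close> of \<open>R\<close>-modules is exact if and only if it
  becomes exact after tensoring with \<open>N\<close>.  HOL cannot quantify over all types here, so the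
  elements of the test modules are taken from a type \<open>'u\<close>.  Since flatness can be
  tested on the inclusions of ideals \<open>I \<subseteq> R\<close>, and faithfulness on the cyclic modules \<open>R/I\<close>,
  every type \<open>'u\<close> into which \<open>R\<close> embeds gives the usual notion.\<close>

definition faithfully_flat :: "'u itself \<Rightarrow> 'r ring \<Rightarrow> ('r, 'n) module \<Rightarrow> bool" where
  "faithfully_flat U R N \<longleftrightarrow> module R N \<and>
     (\<forall>(A :: ('r, 'u) module) (B :: ('r, 'u) module) (C :: ('r, 'u) module).
        module R A \<and> module R B \<and> module R C \<longrightarrow>
        (\<forall>f\<in>lin_maps R A B. \<forall>g\<in>lin_maps R B C.
           f ` carrier A = a_kernel B C g \<longleftrightarrow>
           tensor_map R B N f id ` carrier (tensor R A N) =
             kernel (tensor R B N) (tensor R C N) (tensor_map R C N g id)))"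


section \<open>Base change\<close>

definition restrict_scalars :: "'s ring \<Rightarrow> ('r \<Rightarrow> 's) \<Rightarrow> ('r, 's) module" where
  "restrict_scalars S h =
    \<lparr>carrier = carrier S, monoid.mult = monoid.mult S, one = one S, ring.zero = ring.zero S, add = add S,
     smult = (\<lambda>a s. h a \<otimes>\<^bsub>S\<^esub> s)\<rparr>"

text \<open>\<open>M \<otimes>\<^sub>R S\<close> as an \<open>S\<close>-module, for a ring homomorphism \<open>h : R \<rightarrow> S\<close>.\<close>

definition extend_scalars ::
    "'r ring \<Rightarrow> 's ring \<Rightarrow> ('r \<Rightarrow> 's) \<Rightarrow> ('r, 'm) module \<Rightarrow> ('s, ('m \<times> 's \<Rightarrow>\<^sub>0 int) set) module" where
  "extend_scalars R S h M =
    \<lparr>carrier = carrier (tensor R M (restrict_scalars S h)),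
     monoid.mult = (\<lambda>_ _. undefined),
     one = undefined,
     ring.zero = \<one>\<^bsub>tensor R M (restrict_scalars S h)\<^esub>,
     add = monoid.mult (tensor R M (restrict_scalars S h)),
     smult = (\<lambda>s. tensor_map R M (restrict_scalars S h) id (\<lambda>t. s \<otimes>\<^bsub>S\<^esub> t))\<rparr>"

definition wt_base_change ::
    "'r ring \<Rightarrow> 's ring \<Rightarrow> ('r \<Rightarrow> 's) \<Rightarrow> ('r, 'g, 'z) wdgla_scheme \<Rightarrow> int \<Rightarrow> nat \<Rightarrow>
     ('s, ('g \<times> 's \<Rightarrow>\<^sub>0 int) set) module" where
  "wt_base_change R S h L i k = extend_scalars R S h (wt_module L i k)"

text \<open>The product over \<open>k \<ge> 1\<close> of the \<open>S\<close>-modules \<open>\<gg>\<^sup>(\<^sup>k\<^sup>) \<otimes>\<^sub>R S\<close>, with the extended structure.\<close>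

definition base_change ::
    "'r ring \<Rightarrow> 's ring \<Rightarrow> ('r \<Rightarrow> 's) \<Rightarrow> nat \<Rightarrow> ('r, 'g) wdgla \<Rightarrow>
     ('s, nat \<Rightarrow> ('g \<times> 's \<Rightarrow>\<^sub>0 int) set) wdgla" where
  "base_change R S h \<delta> L =
    (let B = wt_base_change R S h L; P = (\<lambda>i. prod_module {1..} (B i)) in
    \<lparr>gr = P,
     bra = (\<lambda>i j x y. \<lambda>k\<in>{1..}. finsum (B (i + j) k)
       (\<lambda>l. tensor_map2 R (wt_module L (i + j) k) (restrict_scalars S h)
              (bra L i j) (monoid.mult S) (x l) (y (k - l))) {1..<k}),
     dif = (\<lambda>i x. \<lambda>k\<in>{1..}. if k \<le> \<delta> then \<zero>\<^bsub>B (i - 1) k\<^esub>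
       else tensor_map R (wt_module L (i - 1) k) (restrict_scalars S h) (dif L i) id (x (k - \<delta>))),
     wt = (\<lambda>i k. {x \<in> carrier (P i). \<forall>l. 1 \<le> l \<and> l \<noteq> k \<longrightarrow> x l = \<zero>\<^bsub>B i l\<^esub>}),
     wproj = (\<lambda>i k x. \<lambda>l\<in>{1..}. if l = k then x k else \<zero>\<^bsub>B i l\<^esub>)\<rparr>)"

text \<open>The image \<open>x \<otimes> 1\<close> of an element \<open>x\<close> of degree \<open>i\<close>.\<close>

definition tensor_one ::
    "'r ring \<Rightarrow> 's ring \<Rightarrow> ('r \<Rightarrow> 's) \<Rightarrow> ('r, 'g) wdgla \<Rightarrow> int \<Rightarrow> 'g \<Rightarrow>
     nat \<Rightarrow> ('g \<times> 's \<Rightarrow>\<^sub>0 int) set" where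
  "tensor_one R S h L i x =
     (\<lambda>k\<in>{1..}. pure_tensor R (wt_module L i k) (restrict_scalars S h) (wproj L i k x) \<one>\<^bsub>S\<^esub>)"

end

theory Submission
  imports Defs "HOL-Library.Function_Algebras" "HOL.Vector_Spaces"
begin

text \<open>Let $E$ be the derivation multiplying weight $k$ by $k$, so that $[E, d] = \delta d$. Reading off
  weights, the Kaledin class of $\varphi$ vanishes iff some $u$ of degree $0$ solves
  $[E + u, d + \varphi] = \delta (d + \varphi)$. This equation is transported by $e^{\mathrm{ad}_\lambda}$ when
  $\lambda$ also acts on $E + u$. Since the weights $k \ge 1$ are invertible, for every $u$ some
  $\lambda$, found weight by weight, moves $E + u$ to $E$; then
  $[E, d + \lambda \cdot \varphi] = \delta (d + \lambda \cdot \varphi)$ says that $\lambda \cdot \varphi$ is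
  concentrated in weight $\delta$. Conversely, transporting the solution $u = 0$ back along a gauge
  from $\varphi^{(\delta)}$ solves the equation for $\varphi$.

  Suppose that $u$ satisfies the equation below weight $n + \delta$, and put $\psi = \varphi^{(\delta)}$. The
  component in weight $n + \delta$ of the residual $[E + u, d + \varphi] - \delta (d + \varphi)$ is a cycle for
  $d^\psi$, and moving $E + u$ to $E$ shows that it is a $d^\psi$-boundary as soon as the equation has any
  solution at all. Hence the obstruction does not depend on the earlier choices, and extending $u$
  to weight $n$ is a linear problem for $d^\psi$ from weight $n$ to weight $n + \delta$. Vanishing of
  $H_{-1}$ solves it; and as it involves single weights only, where base change is a plain tensor product,
  its solvability descends along a faithfully flat $R \to S$, although infinite products do not commute with
  $- \otimes_R S$.\<close>

section \<open>Gauge flows on weight-graded families\<close>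

text \<open>\<open>E\<close> and \<open>d\<close> are derivations rather than elements, so
  \<open>E + u\<close> and \<open>d + \<phi>\<close> live in an extension of the algebra. There ad_g
  sends E to -E(g) and d to -d(g). Hence the gauge formula with \<open>E g\<close> in place of
  \<open>d g\<close> describes the motion of u, and one recursion with an inhomogeneous term
  \<open>w\<close> serves u, \<phi> and, with w = 0, the residual, which is an honest element. As
  ad_g raises the weight, all series are finite in each weight, and the residual moves by a
  unitriangular map: its vanishing is not affected, and its lowest component does not change at all.
  The obstacle in descent is that the partial solutions over R are built without regard to the given
  solution over S. Carrying the latter along while a partial solution is moved to 0 makes the two
  comparable. The residual calculus uses only brackets of degree 0 with degrees 0 and -1, hence no
  Koszul signs; degree -2 serves to see that a residual is a cycle. The calculus takes place in
  rational vector spaces with total operations, of which modules over a Q-algebra are retracts,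
  compatibly with sums and rational multiples.\<close>

definition biadd :: "(nat \<Rightarrow> nat \<Rightarrow> 'v::ab_group_add \<Rightarrow> 'w::ab_group_add \<Rightarrow> 'u::ab_group_add) \<Rightarrow> bool" where
  "biadd b \<longleftrightarrow> (\<forall>l m x x' y. b l m (x + x') y = b l m x y + b l m x' y) \<and>
     (\<forall>l m x y y'. b l m x (y + y') = b l m x y + b l m x y') \<and>
     (\<forall>m x y. b 0 m x y = 0) \<and> (\<forall>l x y. b l 0 x y = 0)"

lemma biadd_additive:
  assumes "biadd b"
  shows "additive (\<lambda>x. b l m x y)" "additive (b l m x)"
  using assms unfolding biadd_def additive_def by auto

lemma biadd_simps:
  assumes "biadd b"
  shows "b l m (x + x') y = b l m x y + b l m x' y" "b l m x (y + y') = b l m x y + b l m x y'"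
    "b l m (x - x') y = b l m x y - b l m x' y" "b l m x (y - y') = b l m x y - b l m x y'"
    "b l m (- x) y = - b l m x y" "b l m x (- y) = - b l m x y"
    "b l m 0 y = 0" "b l m x 0 = 0" "b 0 m x y = 0" "b l 0 x y = 0"
    "b l m (sum f S) y = (\<Sum>i\<in>S. b l m (f i) y)" "b l m x (sum g T) = (\<Sum>i\<in>T. b l m x (g i))"
proof -
  interpret l: additive "\<lambda>x. b l m x y" for l m y by (rule biadd_additive[OF assms])
  interpret r: additive "b l m x" for l m x by (rule biadd_additive[OF assms])
  show "b l m (x + x') y = b l m x y + b l m x' y" "b l m x (y + y') = b l m x y + b l m x y'"
    by (rule l.add, rule r.add)
  show "b l m (x - x') y = b l m x y - b l m x' y" "b l m x (y - y') = b l m x y - b l m x y'"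
    by (rule l.diff, rule r.diff)
  show "b l m (- x) y = - b l m x y" "b l m x (- y) = - b l m x y"
    by (rule l.minus, rule r.minus)
  show "b l m 0 y = 0" "b l m x 0 = 0"
    by (rule l.zero, rule r.zero)
  show "b l m (sum f S) y = (\<Sum>i\<in>S. b l m (f i) y)" "b l m x (sum g T) = (\<Sum>i\<in>T. b l m x (g i))"
    by (rule l.sum, rule r.sum)
qed (use assms in \<open>auto simp: biadd_def\<close>)

definition conv :: "(nat \<Rightarrow> nat \<Rightarrow> 'v \<Rightarrow> 'w \<Rightarrow> 'u::comm_monoid_add) \<Rightarrow> (nat \<Rightarrow> 'v) \<Rightarrow> (nat \<Rightarrow> 'w) \<Rightarrow> nat \<Rightarrow> 'u" where
  "conv b x y k = (\<Sum>l\<le>k. b l (k - l) (x l) (y (k - l)))"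

lemma conv_biadd_simps:
  assumes "biadd b"
  shows "conv b (x + x') y = conv b x y + conv b x' y" "conv b x (y + y') = conv b x y + conv b x y'"
    "conv b (x - x') y = conv b x y - conv b x' y" "conv b x (y - y') = conv b x y - conv b x y'"
    "conv b (- x) y = - conv b x y" "conv b x (- y) = - conv b x y"
    "conv b 0 y = 0" "conv b x 0 = 0"
  by (auto simp: conv_def fun_eq_iff biadd_simps[OF assms] sum.distrib sum_subtractf sum_negf)

lemma conv_additive:
  assumes "biadd b"
  shows "additive (\<lambda>x. conv b x y)" "additive (conv b x)"
  by (simp_all add: additive_def conv_biadd_simps[OF assms])

text \<open>With \<open>y\<close> zero below weight \<open>k\<close>, a nonzero entry of
  \<open>y\<close> could only sit in weight \<open>k\<close>, opposite \<open>x 0\<close>, and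
  weight 0 is annihilated. So a bracket strictly raises the lowest weight.\<close>

lemma conv_low:
  assumes "biadd b" "\<And>j. j < k \<Longrightarrow> y j = 0"
  shows "conv b x y k = 0"
  unfolding conv_def
proof (rule sum.neutral, intro ballI)
  fix l assume "l \<in> {..k}"
  show "b l (k - l) (x l) (y (k - l)) = 0"
    by (cases "l = 0 \<or> k = 0") (use assms(2)[of "k - l"] in \<open>auto simp: biadd_simps[OF assms(1)]\<close>)
qed

text \<open>The end terms \<open>l = 0\<close> and \<open>l = k\<close> vanish, so weight
  \<open>k\<close> of a product sees only strictly smaller weights of both factors. Every recursion
  on the weight rests on this.\<close>

lemma conv_cong_low:
  assumes "biadd b" "\<And>j. j < k \<Longrightarrow> x j = x' j" "\<And>j. j < k \<Longrightarrow> y j = y' j"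
  shows "conv b x y k = conv b x' y' k"
  unfolding conv_def
proof (rule sum.cong[OF refl])
  fix l assume l: "l \<in> {..k}"
  consider "l = 0" | "l = k" | "0 < l" "l < k" using l by force
  then show "b l (k - l) (x l) (y (k - l)) = b l (k - l) (x' l) (y' (k - l))"
    by cases (auto simp: biadd_simps[OF assms(1)] assms)
qed

abbreviation triples :: "nat \<Rightarrow> (nat \<times> nat \<times> nat) set" where
  "triples n \<equiv> {(a, b, c). a + b + c = n}"

text \<open>Both nestings become sums over ordered triples of weights, so that an identity such as
  Jacobi can be applied triple by triple.\<close>

lemma conv_conv_right:
  assumes "biadd b"
  shows "conv b x (conv b' y z) n =
    (\<Sum>(k, l, m)\<in>triples n. b k (l + m) (x k) (b' l m (y l) (z m)))"
proof -
  have "conv b x (conv b' y z) n =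
      (\<Sum>k\<le>n. \<Sum>l\<le>n - k. b k (n - k) (x k) (b' l (n - k - l) (y l) (z (n - k - l))))"
    by (simp add: conv_def biadd_simps[OF assms])
  also have "\<dots> = (\<Sum>(k, l)\<in>Sigma {..n} (\<lambda>k. {..n - k}). b k (n - k) (x k) (b' l (n - k - l) (y l) (z (n - k - l))))"
    by (rule sum.Sigma) auto
  also have "\<dots> = (\<Sum>(k, l, m)\<in>triples n. b k (l + m) (x k) (b' l m (y l) (z m)))"
    by (rule sum.reindex_bij_witness[where i = "\<lambda>(k, l, m). (k, l)" and j = "\<lambda>(k, l). (k, l, n - k - l)"]) auto
  finally show ?thesis .
qed

lemma conv_conv_left:
  assumes "biadd b"
  shows "conv b (conv b' x y) z n =
    (\<Sum>(k, l, m)\<in>triples n. b (k + l) m (b' k l (x k) (y l)) (z m))"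
proof -
  have "conv b (conv b' x y) z n =
      (\<Sum>p\<le>n. \<Sum>k\<le>p. b p (n - p) (b' k (p - k) (x k) (y (p - k))) (z (n - p)))"
    by (simp add: conv_def biadd_simps[OF assms])
  also have "\<dots> = (\<Sum>(p, k)\<in>Sigma {..n} (\<lambda>p. {..p}). b p (n - p) (b' k (p - k) (x k) (y (p - k))) (z (n - p)))"
    by (rule sum.Sigma) auto
  also have "\<dots> = (\<Sum>(k, l, m)\<in>triples n. b (k + l) m (b' k l (x k) (y l)) (z m))"
    by (rule sum.reindex_bij_witness[where i = "\<lambda>(k, l, m). (k + l, k)" and j = "\<lambda>(p, k). (k, p - k, n - p)"]) auto
  finally show ?thesis .
qed

lemma sum_triples_swap:
  "(\<Sum>(k, l, m)\<in>triples n. f k l m) = (\<Sum>(k, l, m)\<in>triples n. f l k m)"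
  by (rule sum.reindex_bij_witness[where i = "\<lambda>(k, l, m). (l, k, m)" and j = "\<lambda>(k, l, m). (l, k, m)"]) auto

text \<open>The Cauchy product of two series truncated at \<open>k\<close>: the hypothesis kills the
  part of the square beyond total degree \<open>k\<close>.\<close>

lemma sum_square_triangle:
  fixes f :: "nat \<Rightarrow> nat \<Rightarrow> 'a::comm_monoid_add"
  assumes "\<And>i j. k < i + j \<Longrightarrow> f i j = 0"
  shows "(\<Sum>i\<le>k. \<Sum>j\<le>k. f i j) = (\<Sum>n\<le>k. \<Sum>i\<le>n. f i (n - i))"
proof -
  have "(\<Sum>i\<le>k. \<Sum>j\<le>k. f i j) = (\<Sum>(i, j)\<in>{..k} \<times> {..k}. f i j)"
    by (simp add: sum.cartesian_product)
  also have "\<dots> = (\<Sum>(i, j)\<in>{(i, j). i + j \<le> k}. f i j)"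
    by (rule sum.mono_neutral_right) (auto intro!: assms)
  also have "\<dots> = (\<Sum>n\<le>k. \<Sum>i\<le>n. f i (n - i))"
    by (rule sum.triangle_reindex_eq)
  finally show ?thesis .
qed

text \<open>In the application \<open>f c\<close> is multiplication by the number \<open>c\<close>,
  and \<open>P i j\<close> is a product of orbit terms. After an index shift the factors
  \<open>i\<close> and \<open>Suc n - i\<close> add up to \<open>Suc n\<close>, which is the Leibniz
  rule for divided powers.\<close>

lemma sum_weighted_pairs:
  fixes P :: "nat \<Rightarrow> nat \<Rightarrow> 'a::ab_group_add" and f :: "nat \<Rightarrow> 'a \<Rightarrow> 'a"
  assumes f: "\<And>c. additive (f c)" and lin: "\<And>m n x. f (m + n) x = f m x + f n x" "\<And>x. f 0 x = 0"
  shows "(\<Sum>i\<le>n. f (Suc i) (P (Suc i) (n - i))) + (\<Sum>i\<le>n. f (Suc (n - i)) (P i (Suc (n - i))))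
    = f (Suc n) (\<Sum>i\<le>Suc n. P i (Suc n - i))"
proof -
  have "(\<Sum>i\<le>n. f (Suc i) (P (Suc i) (n - i))) = (\<Sum>i\<le>Suc n. f i (P i (Suc n - i)))"
    by (subst sum.atMost_Suc_shift) (simp add: lin)
  moreover have "(\<Sum>i\<le>n. f (Suc (n - i)) (P i (Suc (n - i)))) = (\<Sum>i\<le>Suc n. f (Suc n - i) (P i (Suc n - i)))"
    by (auto simp: lin Suc_diff_le intro!: sum.cong)
  ultimately show ?thesis
    by (simp only: additive.sum[OF f] sum.distrib[symmetric] lin(1)[symmetric])
       (auto intro!: sum.cong arg_cong2[where f = f] simp del: sum.atMost_Suc)
qed

text \<open>Multiplication by an integer is repeated addition, and division by a nonzero integer is
  unique in a rational vector space. This is why the operations below are only required to be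
  additive.\<close>

lemma additive_rat:
  fixes sc :: "rat \<Rightarrow> 'a::ab_group_add \<Rightarrow> 'a" and sc' :: "rat \<Rightarrow> 'b::ab_group_add \<Rightarrow> 'b"
  assumes "vector_space sc" "vector_space sc'" "additive f"
  shows "f (sc c x) = sc' c (f x)"
proof -
  interpret f: additive f by fact
  interpret sc: vector_space sc by fact
  interpret sc': vector_space sc' by fact
  have nat: "f (sc (of_nat n) y) = sc' (of_nat n) (f y)" for n y
    by (induction n) (simp_all add: sc.scale_left_distrib sc'.scale_left_distrib f.add f.zero)
  have int: "f (sc (of_int z) y) = sc' (of_int z) (f y)" for z y
    by (cases z rule: int_cases2) (simp_all add: nat f.minus)
  obtain p q where pq: "c = of_int p / of_int q" "q \<noteq> 0"
    by (metis Fract_of_int_quotient Rat_cases less_irrefl)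
  have "sc' (of_int q) (f (sc c x)) = sc' (of_int q) (sc' c (f x))"
    using pq by (simp add: int[symmetric])
  then show ?thesis
    using pq(2) sc'.scale_cancel_left[of "of_int q" "f (sc c x)" "sc' c (f x)"] by simp
qed

text \<open>The $n$-th term of $e^A x - \frac{e^A - \mathrm{id}}{A} w$.\<close>

definition orbit :: "(rat \<Rightarrow> 'v \<Rightarrow> 'v::ab_group_add) \<Rightarrow>
    ((nat \<Rightarrow> 'v) \<Rightarrow> nat \<Rightarrow> 'v) \<Rightarrow> (nat \<Rightarrow> 'v) \<Rightarrow> (nat \<Rightarrow> 'v) \<Rightarrow> nat \<Rightarrow> nat \<Rightarrow> 'v" where
  "orbit sc A w x n = rec_nat x (\<lambda>n y k. sc (1 / of_nat (Suc n)) ((A y - (if n = 0 then w else 0)) k)) n"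

lemma orbit_simps:
  "orbit sc A w x 0 = x"
  "orbit sc A w x (Suc n) = (\<lambda>k. sc (1 / of_nat (Suc n)) ((A (orbit sc A w x n) - (if n = 0 then w else 0)) k))"
  by (simp_all add: orbit_def)

text \<open>Sequences of components are indexed by all naturals, but the entry at weight $0$ carries no
  information since every operation vanishes there. Totality of the operations on a rational vector
  space spares all carrier conditions.\<close>

locale graded_total = vector_space sc for sc :: "rat \<Rightarrow> 'v::ab_group_add \<Rightarrow> 'v" +
  fixes \<delta> :: nat and b0 b1 :: "nat \<Rightarrow> nat \<Rightarrow> 'v \<Rightarrow> 'v \<Rightarrow> 'v" and d :: "nat \<Rightarrow> 'v \<Rightarrow> 'v"
  assumes \<delta>_pos: "1 \<le> \<delta>"
    and biadd_b0: "biadd b0" and biadd_b1: "biadd b1"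
    and d_add: "d k (x + y) = d k x + d k y" and d_0: "d 0 x = 0"
    and act: "b1 k (l + m) x (b1 l m y z) = b1 (k + l) m (b0 k l x y) z + b1 l (k + m) y (b1 k m x z)"
    and derivation: "d (k + l) (b0 k l x y) = b1 k (l + \<delta>) x (d l y) - b1 l (k + \<delta>) y (d k x)"
begin

lemmas additive_sc = additive_rat[OF vector_space_axioms vector_space_axioms]

lemmas b1_simps = biadd_simps[OF biadd_b1]

lemma d_additive: "additive (d k)"
  by (simp add: additive_def d_add)

lemmas d_simps = d_add additive.diff[OF d_additive] additive.minus[OF d_additive]
  additive.zero[OF d_additive] additive.sum[OF d_additive]

lemmas sc_simps = additive_sc[OF d_additive] additive_sc[OF biadd_additive(1)[OF biadd_b0]]
  additive_sc[OF biadd_additive(2)[OF biadd_b0]]  additive_sc[OF biadd_additive(1)[OF biadd_b1]]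
  additive_sc[OF biadd_additive(2)[OF biadd_b1]]

text \<open>\<open>b0\<close> stands for the bracket on degree 0 and \<open>b1\<close> for the
  action of degree 0 on degree -1, with families of both degrees in the same space. \<open>D\<close>
  is the differential from degree 0 to degree -1, \<open>E\<close> the weight derivation on either
  degree, \<open>S\<close> a scalar acting on a whole family.\<close>

definition B0 where "B0 = conv b0"
definition B1 where "B1 = conv b1"
definition D where "D x k = (if k < \<delta> then 0 else d (k - \<delta>) (x (k - \<delta>)))" for x :: "nat \<Rightarrow> 'v"
definition E where "E x k = sc (of_nat k) (x k)" for x :: "nat \<Rightarrow> 'v"
definition S where "S c x k = sc c (x k)" for x :: "nat \<Rightarrow> 'v"

lemmas B1_simps = conv_biadd_simps[OF biadd_b1, folded B1_def]

lemma D_simps: "D (x + y) = D x + D y" "D (x - y) = D x - D y" "D 0 = 0"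
  by (auto simp: D_def fun_eq_iff d_simps)

lemma E_simps: "E (x + y) = E x + E y" "E (x - y) = E x - E y" "E 0 = 0"
  by (auto simp: E_def fun_eq_iff scale_right_distrib scale_right_diff_distrib)

lemma S_simps: "S c (x + y) = S c x + S c y" "S c (x - y) = S c x - S c y" "S c 0 = 0"
  "S a (S c x) = S (a * c) x" "S 1 x = x" "S 0 x = 0" "S (a + c) x = S a x + S c x" "S (a - c) x = S a x - S c x"
  by (auto simp: S_def fun_eq_iff scale_right_distrib scale_right_diff_distrib scale_left_distrib scale_left_diff_distrib)

lemma S_additive: "additive (S c)"
  by (simp add: additive_def S_simps)

lemma S_commute: "D (S c x) = S c (D x)" "E (S c x) = S c (E x)"
  "B0 (S c x) y = S c (B0 x y)" "B0 x (S c y) = S c (B0 x y)"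
  "B1 (S c x) y = S c (B1 x y)" "B1 x (S c y) = S c (B1 x y)"
  by (auto simp: D_def E_def S_def B0_def B1_def conv_def fun_eq_iff sc_simps scale_sum_right mult.commute)

text \<open>Jacobi holds for each triple of weights by \<open>act\<close>; exchanging the first two
  weights identifies the last summand.\<close>

lemma B1_act: "B1 x (B1 y z) = B1 (B0 x y) z + B1 y (B1 x z)"
proof
  fix n
  have "B1 x (B1 y z) n = (\<Sum>(k, l, m)\<in>triples n.
      b1 (k + l) m (b0 k l (x k) (y l)) (z m) + b1 l (k + m) (y l) (b1 k m (x k) (z m)))"
    unfolding B1_def conv_conv_right[OF biadd_b1]
    by (rule sum.cong) (auto intro: act)
  also have "\<dots> = B1 (B0 x y) z n + (\<Sum>(k, l, m)\<in>triples n. b1 l (k + m) (y l) (b1 k m (x k) (z m)))"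
    by (simp add: B1_def B0_def conv_conv_left[OF biadd_b1] case_prod_unfold sum.distrib)
  also have "(\<Sum>(k, l, m)\<in>triples n. b1 l (k + m) (y l) (b1 k m (x k) (z m))) = B1 y (B1 x z) n"
    unfolding B1_def conv_conv_right[OF biadd_b1] by (rule sum_triples_swap)
  finally show "B1 x (B1 y z) n = (B1 (B0 x y) z + B1 y (B1 x z)) n"
    by simp
qed

lemma E_B1: "E (B1 x y) = B1 (E x) y + B1 x (E y)"
  by (auto simp: fun_eq_iff E_def B1_def conv_def sc_simps scale_sum_right simp flip: sum.distrib scale_left_distrib of_nat_add
      intro!: sum.cong)

lemma E_D: "E (D x) = D (E x) + S (of_nat \<delta>) (D x)"
  by (auto simp: fun_eq_iff E_def D_def S_def sc_simps simp flip: scale_left_distrib of_nat_add)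

text \<open>This is the Leibniz rule with [dx, y] rewritten as -[y, dx], so that degree 0 always
  acts from the left. In the second sum the two weights are interchanged accordingly.\<close>

lemma D_B0: "D (B0 x y) = B1 x (D y) - B1 y (D x)"
proof
  fix n
  have D0: "B1 u (D v) n = (if n < \<delta> then 0 else \<Sum>l\<le>n-\<delta>. b1 l (n - l) (u l) (d (n - \<delta> - l) (v (n - \<delta> - l))))" for u v
  proof -
    have "(\<Sum>l\<le>n. b1 l (n - l) (u l) (D v (n - l))) = (\<Sum>l\<in>{l. l \<le> n \<and> \<delta> \<le> n - l}. b1 l (n - l) (u l) (D v (n - l)))"
      by (rule sum.mono_neutral_right) (auto simp: D_def b1_simps)
    also have "{l. l \<le> n \<and> \<delta> \<le> n - l} = (if n < \<delta> then {} else {..n-\<delta>})"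
      using \<delta>_pos by auto
    finally show ?thesis
      unfolding B1_def conv_def by (auto simp: D_def diff_commute add.commute intro!: sum.cong)
  qed
  show "D (B0 x y) n = (B1 x (D y) - B1 y (D x)) n"
  proof (cases "n < \<delta>")
    case True
    then show ?thesis by (simp add: D0 D_def)
  next
    case False
    define p where "p = n - \<delta>"
    then have n: "n = p + \<delta>" using False by simp
    have "D (B0 x y) n = (\<Sum>l\<le>p. d p (b0 l (p - l) (x l) (y (p - l))))"
      by (simp add: n D_def B0_def conv_def d_simps)
    also have "\<dots> = (\<Sum>l\<le>p. b1 l (n - l) (x l) (d (p - l) (y (p - l)))) - (\<Sum>l\<le>p. b1 (p - l) (l + \<delta>) (y (p - l)) (d l (x l)))"
      unfolding sum_subtractf[symmetric]
    proof (rule sum.cong[OF refl])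
      fix l assume "l \<in> {..p}"
      then show "d p (b0 l (p - l) (x l) (y (p - l))) =
         b1 l (n - l) (x l) (d (p - l) (y (p - l))) - b1 (p - l) (l + \<delta>) (y (p - l)) (d l (x l))"
        using derivation[of l "p - l" "x l" "y (p - l)"] by (simp add: n)
    qed
    also have "(\<Sum>l\<le>p. b1 (p - l) (l + \<delta>) (y (p - l)) (d l (x l))) = (\<Sum>l\<le>p. b1 l (n - l) (y l) (d (p - l) (x (p - l))))"
      by (rule sum.reindex_bij_witness[where i = "\<lambda>l. p - l" and j = "\<lambda>l. p - l"]) (auto simp: n add.commute)
    finally show ?thesis
      using False by (simp add: D0 p_def)
  qed
qed

text \<open>With \<open>E + u\<close> and \<open>D + \<phi>\<close> read as operators, \<open>res u \<phi>\<close> is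
  $[E + u, D + \varphi] - \delta (D + \varphi)$.\<close>

definition res where "res u \<phi> = E \<phi> - S (of_nat \<delta>) \<phi> - D u + B1 u \<phi>"

text \<open>Terms of e^{ad_g} applied to \<open>E + u\<close>, to \<open>D + \<phi>\<close> and to
  the residual, with the fixed summands \<open>E\<close> and \<open>D\<close> left out. Since [g, E]
  = -E g and [g, D] = -D g, these summands contribute once, at the first step, as
  \<open>- w\<close>; the residual has no such summand.\<close>

abbreviation "orb0 g \<equiv> orbit sc (B0 g) (E g)"
abbreviation "orb1 g \<equiv> orbit sc (B1 g) (D g)"
abbreviation "orbe g \<equiv> orbit sc (B1 g) 0"

lemma orb_Suc: "S (of_nat (Suc n)) (orbit sc A w x (Suc n)) = A (orbit sc A w x n) - (if n = 0 then w else 0)"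
  by (auto simp: orbit_simps S_def fun_eq_iff simp del: of_nat_Suc)

lemma S_cancel: "S (of_nat (Suc n)) x = S (of_nat (Suc n)) y \<Longrightarrow> x = y"
  by (auto simp: S_def fun_eq_iff simp del: of_nat_Suc)

text \<open>The Leibniz rule for the divided powers of $\mathrm{ad}_g$ applied to that bracket.\<close>

lemma orbit_res:
  "orbe g (res u \<phi>) n = E (orb1 g \<phi> n) - S (of_nat \<delta>) (orb1 g \<phi> n) - D (orb0 g u n)
     + (\<Sum>i\<le>n. B1 (orb0 g u i) (orb1 g \<phi> (n - i)))"
proof (induction n)
  case 0
  then show ?case by (simp add: orbit_simps(1) res_def)
next
  case (Suc n)
  define x where "x = orb0 g u"
  define y where "y = orb1 g \<phi>"
  \<comment> \<open>\<open>e\<close> keeps the inhomogeneous terms, which occur only in the step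
    from 0 to 1.\<close>
  define e where "e = (\<lambda>z :: nat \<Rightarrow> 'v. if n = 0 then z else 0)"
  have x: "B0 g (x i) = S (of_nat (Suc i)) (x (Suc i)) + (if i = 0 then E g else 0)" for i
    using orb_Suc[of i "B0 g" "E g" u] by (simp add: x_def algebra_simps)
  have y: "B1 g (y i) = S (of_nat (Suc i)) (y (Suc i)) + (if i = 0 then D g else 0)" for i
    using orb_Suc[of i "B1 g" "D g" \<phi>] by (simp add: y_def algebra_simps)
  have Bsum: "B1 g (sum f I) = (\<Sum>i\<in>I. B1 g (f i))" for f and I :: "nat set"
    by (rule additive.sum[OF conv_additive(2)[OF biadd_b1], folded B1_def])
  \<comment> \<open>\<open>E\<close> and \<open>D\<close> are moved past \<open>B1 g\<close> by
    their derivation rules, at the price of the terms \<open>B1 (E g) (y n)\<close> and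
    \<open>B1 (x n) (D g)\<close>.\<close>
  have t1: "B1 g (E (y n)) = S (of_nat (Suc n)) (E (y (Suc n))) + e (E (D g)) - B1 (E g) (y n)"
    using E_B1[of g "y n"] by (simp add: y e_def E_simps S_commute algebra_simps split: if_splits)
  have t2: "B1 g (S (of_nat \<delta>) (y n)) = S (of_nat (Suc n)) (S (of_nat \<delta>) (y (Suc n))) + e (S (of_nat \<delta>) (D g))"
    by (cases "n = 0") (simp_all add: S_commute y e_def S_simps mult.commute del: of_nat_Suc)
  have t3: "B1 g (D (x n)) = S (of_nat (Suc n)) (D (x (Suc n))) + e (D (E g)) + B1 (x n) (D g)"
    using D_B0[of g "x n"] by (simp add: x e_def D_simps S_commute algebra_simps split: if_splits)
  have "(\<Sum>i\<le>n. B1 g (B1 (x i) (y (n - i)))) =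
      (\<Sum>i\<le>n. B1 (S (of_nat (Suc i)) (x (Suc i))) (y (n - i))) + (\<Sum>i\<le>n. B1 (x i) (S (of_nat (Suc (n - i))) (y (Suc (n - i)))))
      + (\<Sum>i\<le>n. B1 (if i = 0 then E g else 0) (y (n - i))) + (\<Sum>i\<le>n. B1 (x i) (if n - i = 0 then D g else 0))"
    by (simp only: B1_act[of g] x y B1_simps sum.distrib add.assoc add.left_commute)
  also have "(\<Sum>i\<le>n. B1 (if i = 0 then E g else 0) (y (n - i))) = (\<Sum>i\<le>n. if i = 0 then B1 (E g) (y (n - i)) else 0)"
    by (rule sum.cong) (auto simp: B1_simps)
  also have "\<dots> = B1 (E g) (y n)"
    by simp
  also have "(\<Sum>i\<le>n. B1 (x i) (if n - i = 0 then D g else 0)) = (\<Sum>i\<le>n. if i = n then B1 (x i) (D g) else 0)"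
    by (rule sum.cong) (auto simp: B1_simps)
  also have "\<dots> = B1 (x n) (D g)"
    by simp
  also have "(\<Sum>i\<le>n. B1 (S (of_nat (Suc i)) (x (Suc i))) (y (n - i))) + (\<Sum>i\<le>n. B1 (x i) (S (of_nat (Suc (n - i))) (y (Suc (n - i)))))
    = S (of_nat (Suc n)) (\<Sum>i\<le>Suc n. B1 (x i) (y (Suc n - i)))"
    unfolding S_commute
    by (rule sum_weighted_pairs[where f = "\<lambda>c. S (of_nat c)" and P = "\<lambda>i j. B1 (x i) (y j)"])
       (simp_all add: S_additive S_simps)
  finally have t4: "(\<Sum>i\<le>n. B1 g (B1 (x i) (y (n - i)))) =
     S (of_nat (Suc n)) (\<Sum>i\<le>Suc n. B1 (x i) (y (Suc n - i))) + B1 (E g) (y n) + B1 (x n) (D g)" .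
  have "S (of_nat (Suc n)) (orbe g (res u \<phi>) (Suc n)) = B1 g (orbe g (res u \<phi>) n)"
    by (simp add: orb_Suc del: of_nat_Suc)
  also have "\<dots> = B1 g (E (y n)) - B1 g (S (of_nat \<delta>) (y n)) - B1 g (D (x n)) + (\<Sum>i\<le>n. B1 g (B1 (x i) (y (n - i))))"
    unfolding Suc x_def[symmetric] y_def[symmetric] by (simp add: B1_simps Bsum)
  \<comment> \<open>The extra terms of \<open>t1\<close> and \<open>t3\<close> cancel those of
    \<open>t4\<close>, and the \<open>e\<close> terms cancel because E D g = D E g + \<delta> D
    g.\<close>
  also have "\<dots> = S (of_nat (Suc n)) (E (y (Suc n)) - S (of_nat \<delta>) (y (Suc n)) - D (x (Suc n)) + (\<Sum>i\<le>Suc n. B1 (x i) (y (Suc n - i))))"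
    unfolding t1 t2 t3 t4 by (simp only: S_simps) (simp add: e_def E_D)
  finally show ?case
    unfolding x_def y_def by (rule S_cancel)
qed

section \<open>Flows: the orbits summed up, weight by weight\<close>

definition flow where "flow A w x k = (\<Sum>n\<le>k. orbit sc A w x n k)"
definition rest where "rest A w x k = (\<Sum>n<k. sc (1 / of_nat (Suc n)) (A (orbit sc A w x n) k))"

abbreviation "flow0 g \<equiv> flow (B0 g) (E g)"
abbreviation "flow1 g \<equiv> flow (B1 g) (D g)"
abbreviation "flowe g \<equiv> flow (B1 g) 0"

lemma E_0: "E x 0 = 0" and D_0: "k \<le> \<delta> \<Longrightarrow> D x k = 0"
  by (auto simp: E_def D_def d_0)

text \<open>Each step applies one more bracket and so pushes the lowest weight up by one. The term
  \<open>w\<close> enters at the first step, where weight 0 is the only weight in question. Hence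
  truncating \<open>flow\<close> at \<open>n \<le> k\<close> loses nothing.\<close>

lemma orbit_low:
  assumes "biadd b" "w 0 = 0" "k < n"
  shows "orbit sc (conv b g) w x n k = 0"
  using assms(3)
proof (induction n arbitrary: k)
  case (Suc n)
  then have "conv b g (orbit sc (conv b g) w x n) k = 0"
    by (intro conv_low[OF assms(1)]) auto
  then show ?case
    using Suc.prems assms(2) by (auto simp: orbit_simps)
qed simp

lemma orb0_low: "k < n \<Longrightarrow> orb0 g u n k = 0" and orb1_low: "k < n \<Longrightarrow> orb1 g \<phi> n k = 0"
  unfolding B0_def B1_def by (rule orbit_low[where w = "E g", OF biadd_b0 E_0], assumption)
    (rule orbit_low[where w = "D g", OF biadd_b1 D_0[OF le0]], assumption)

lemma flow_sum:
  assumes "\<And>n. k < n \<Longrightarrow> orbit sc A w x n k = 0" "k \<le> N"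
  shows "flow A w x k = (\<Sum>n\<le>N. orbit sc A w x n k)"
  unfolding flow_def by (rule sum.mono_neutral_left) (use assms in auto)

text \<open>Weight \<open>k\<close> of the data enters through \<open>x k - w k\<close> alone; by
  \<open>rest_cong\<close> the remainder sees strictly smaller weights. This makes a prescribed flow
  solvable for \<open>x\<close>, and also for \<open>g\<close> when \<open>w = E g\<close>.\<close>

lemma flow_rest:
  assumes "w 0 = 0"
  shows "flow A w x k = x k - w k + rest A w x k"
proof (cases k)
  case 0
  then show ?thesis by (simp add: flow_def rest_def orbit_simps assms)
next
  case (Suc m)
  have "flow A w x k = x k + (\<Sum>n<k. orbit sc A w x (Suc n) k)"
    by (simp add: flow_def Suc sum.atMost_Suc_shift orbit_simps(1) lessThan_Suc_atMost del: sum.atMost_Suc)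
  also have "(\<Sum>n<k. orbit sc A w x (Suc n) k) =
      rest A w x k - (\<Sum>n<k. if n = 0 then w k else 0)"
    unfolding rest_def sum_subtractf[symmetric]
    by (rule sum.cong) (auto simp: orbit_simps scale_right_diff_distrib)
  finally show ?thesis using Suc by simp
qed

lemma orbit_cong:
  assumes "biadd b" "\<And>j. j < k \<Longrightarrow> g j = g' j" "\<And>j. j < k \<Longrightarrow> w j = w' j" "\<And>j. j < k \<Longrightarrow> x j = x' j" "j < k"
  shows "orbit sc (conv b g) w x n j = orbit sc (conv b g') w' x' n j"
  using assms(5)
proof (induction n arbitrary: j)
  case (Suc n)
  have "conv b g (orbit sc (conv b g) w x n) j = conv b g' (orbit sc (conv b g') w' x' n) j"
    by (rule conv_cong_low[OF assms(1)]) (use Suc assms(2) in auto)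
  then show ?case
    using Suc.prems assms(3) by (simp add: orbit_simps)
qed (simp add: orbit_simps assms)

text \<open>\<open>rest\<close> consists of brackets with \<open>g\<close>, and a bracket turns
  agreement below \<open>k\<close> into agreement at \<open>k\<close>.\<close>

lemma rest_cong:
  assumes "biadd b" "\<And>j. j < k \<Longrightarrow> g j = g' j" "\<And>j. j < k \<Longrightarrow> w j = w' j" "\<And>j. j < k \<Longrightarrow> x j = x' j"
  shows "rest (conv b g) w x k = rest (conv b g') w' x' k"
  unfolding rest_def
proof (rule sum.cong[OF refl])
  fix n
  have "conv b g (orbit sc (conv b g) w x n) k = conv b g' (orbit sc (conv b g') w' x' n) k"
    by (rule conv_cong_low[OF assms(1)]) (erule assms(2), rule orbit_cong[OF assms])
  then show "sc (1 / of_nat (Suc n)) (conv b g (orbit sc (conv b g) w x n) k) =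
      sc (1 / of_nat (Suc n)) (conv b g' (orbit sc (conv b g') w' x' n) k)"
    by simp
qed

lemma rest_zero:
  assumes "biadd b" "\<And>j. j < k \<Longrightarrow> w j = 0" "\<And>j. j < k \<Longrightarrow> x j = 0"
  shows "rest (conv b g) w x k = 0"
proof -
  have "orbit sc (conv b g) 0 0 n k = 0" for n k
  proof (induction n arbitrary: k)
    case (Suc n)
    have "conv b g (orbit sc (conv b g) 0 0 n) k = 0"
      by (rule conv_low[OF assms(1)]) (rule Suc)
    then show ?case
      unfolding orbit_simps(2) fun_diff_def if_cancel by (simp only: zero_fun_apply diff_self scale_zero_right)
  qed (simp add: orbit_simps)
  then have "conv b g (orbit sc (conv b g) 0 0 n) k = 0" for n
    by (intro conv_low[OF assms(1)])
  then have "rest (conv b g) 0 0 k = 0"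
    unfolding rest_def by (intro sum.neutral ballI) (simp only: scale_zero_right)
  then show ?thesis
    using rest_cong[OF assms(1), of k g g w 0 x 0] assms by simp
qed

text \<open>e^{ad_g} is compatible with brackets: this is \<open>orbit_res\<close> summed over
  \<open>n\<close>. Only the product \<open>B1\<close> needs care. The two flows truncated at
  \<open>k\<close> multiply to a sum over a square, and terms with \<open>i + j > k\<close> vanish
  because the orbit terms \<open>i\<close> and \<open>j\<close> start in weights \<open>i\<close>
  and \<open>j\<close>.\<close>

lemma flow_res: "flowe g (res u \<phi>) = res (flow0 g u) (flow1 g \<phi>)"
proof
  fix k
  have f0: "flow0 g u j = (\<Sum>n\<le>k. orb0 g u n j)" if "j \<le> k" for j
    by (rule flow_sum[OF orb0_low that])
  have f1: "flow1 g \<phi> j = (\<Sum>n\<le>k. orb1 g \<phi> n j)" if "j \<le> k" for j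
    by (rule flow_sum[OF orb1_low that])
  have app: "(\<Sum>i\<in>I. h i) j = (\<Sum>i\<in>I. h i j)" for h :: "nat \<Rightarrow> nat \<Rightarrow> 'v" and I j
    by (induction I rule: infinite_finite_induct) auto
  have B1_eq: "B1 x y k = (\<Sum>l\<le>k. b1 l (k - l) (x l) (y (k - l)))" for x y k
    by (simp add: B1_def conv_def)
  have "B1 (flow0 g u) (flow1 g \<phi>) k =
      (\<Sum>l\<le>k. \<Sum>j\<le>k. \<Sum>i\<le>k. b1 l (k - l) (orb0 g u i l) (orb1 g \<phi> j (k - l)))"
    by (simp add: B1_eq f0 f1 b1_simps)
  also have "\<dots> = (\<Sum>j\<le>k. \<Sum>i\<le>k. B1 (orb0 g u i) (orb1 g \<phi> j) k)"
    unfolding B1_eq by (rule trans[OF sum.swap], rule sum.cong[OF refl], rule sum.swap)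
  also have "\<dots> = (\<Sum>i\<le>k. \<Sum>j\<le>k. B1 (orb0 g u i) (orb1 g \<phi> j) k)"
    by (rule sum.swap)
  also have "\<dots> = (\<Sum>n\<le>k. \<Sum>i\<le>n. B1 (orb0 g u i) (orb1 g \<phi> (n - i)) k)"
  proof (rule sum_square_triangle[where f = "\<lambda>i j. B1 (orb0 g u i) (orb1 g \<phi> j) k"])
    fix i j assume "k < i + j"
    show "B1 (orb0 g u i) (orb1 g \<phi> j) k = 0"
    proof (subst B1_eq, rule sum.neutral, intro ballI)
      fix l assume "l \<in> {..k}"
      with \<open>k < i + j\<close> have "l < i \<or> k - l < j" by auto
      then show "b1 l (k - l) (orb0 g u i l) (orb1 g \<phi> j (k - l)) = 0"
        using orb0_low[of l i g u] orb1_low[of "k - l" j g \<phi>] by (auto simp: b1_simps)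
    qed
  qed
  finally have B: "B1 (flow0 g u) (flow1 g \<phi>) k = (\<Sum>n\<le>k. \<Sum>i\<le>n. B1 (orb0 g u i) (orb1 g \<phi> (n - i)) k)" .
  have Dk: "D (flow0 g u) k = (\<Sum>n\<le>k. D (orb0 g u n) k)"
    by (simp add: D_def f0 d_simps)
  show "flowe g (res u \<phi>) k = res (flow0 g u) (flow1 g \<phi>) k"
    by (simp add: flow_def[of _ 0] orbit_res res_def[of "flow0 g u"] B Dk app E_def S_def f1 scale_sum_right sum.distrib sum_subtractf)
qed

section \<open>Recursion on the weight: solving for the gauge or for the source\<close>

lemma below_fixpoint:
  fixes F :: "(nat \<Rightarrow> 'a) \<Rightarrow> nat \<Rightarrow> 'a"
  assumes "\<And>f f' k. (\<And>j. j < k \<Longrightarrow> f j = f' j) \<Longrightarrow> F f k = F f' k"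
  obtains f where "\<And>k. f k = F f k"
proof
  have "wfrec less_than F = F (wfrec less_than F)"
    by (rule wfrec_fixpoint) (auto simp: adm_wf_def intro: assms)
  then show "wfrec less_than F k = F (wfrec less_than F) k" for k
    by (rule fun_cong)
qed

text \<open>By \<open>flow_rest\<close> with \<open>w = E g\<close>, weight \<open>k\<close> of the
  equation reads \<open>k * g k = u k + rest\<close>, where \<open>rest\<close> involves
  \<open>g\<close> below \<open>k\<close> only. In weight 0 the flow is \<open>u 0\<close> itself,
  whence the assumption.\<close>

lemma obtain_gauge:
  assumes "u 0 = 0"
  obtains g where "flow0 g u = 0"
proof -
  \<comment> \<open>For \<open>k = 0\<close> the coefficient \<open>1 / of_nat 0\<close> is 0, so
    the recursion starts with \<open>g 0 = 0\<close>.\<close>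
  obtain g where g: "\<And>k. g k = sc (1 / of_nat k) (u k + rest (B0 g) (E g) u k)"
  proof (rule below_fixpoint[of "\<lambda>g k. sc (1 / of_nat k) (u k + rest (B0 g) (E g) u k)"])
    fix f f' :: "nat \<Rightarrow> 'v" and k assume "\<And>j. j < k \<Longrightarrow> f j = f' j"
    then have "rest (B0 f) (E f) u k = rest (B0 f') (E f') u k"
      unfolding B0_def by (intro rest_cong[OF biadd_b0]) (auto simp: E_def)
    then show "sc (1 / of_nat k) (u k + rest (B0 f) (E f) u k) = sc (1 / of_nat k) (u k + rest (B0 f') (E f') u k)"
      by simp
  qed blast
  have "flow0 g u k = 0" for k
  proof (cases "k = 0")
    case True
    then show ?thesis by (simp add: flow_def orbit_simps assms)
  next
    case False
    then have "E g k = u k + rest (B0 g) (E g) u k"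
      by (subst E_def, subst g) simp
    then show ?thesis by (simp add: flow_rest E_0)
  qed
  then show ?thesis by (intro that[of g]) (simp add: fun_eq_iff)
qed

text \<open>The same equation with \<open>g\<close> given and \<open>u\<close> unknown; the unknown
  has coefficient 1, so nothing is divided. In effect \<open>E + u\<close> is e^{-ad_g} applied to
  \<open>E\<close>.\<close>

lemma obtain_source:
  obtains u where "flow0 g u = 0"
proof -
  obtain u where u: "\<And>k. u k = E g k - rest (B0 g) (E g) u k"
  proof (rule below_fixpoint[of "\<lambda>u k. E g k - rest (B0 g) (E g) u k"])
    fix f f' :: "nat \<Rightarrow> 'v" and k assume "\<And>j. j < k \<Longrightarrow> f j = f' j"
    then have "rest (B0 g) (E g) f k = rest (B0 g) (E g) f' k"
      unfolding B0_def by (intro rest_cong[OF biadd_b0]) auto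
    then show "E g k - rest (B0 g) (E g) f k = E g k - rest (B0 g) (E g) f' k"
      by simp
  qed blast
  have "flow0 g u k = 0" for k
    using u[of k] by (simp add: flow_rest E_0)
  then show ?thesis by (intro that[of u]) (simp add: fun_eq_iff)
qed

text \<open>Every bracket with \<open>g\<close> lands above weight \<open>k\<close>, so up to weight
  \<open>k\<close> only the term \<open>n = 0\<close> remains.\<close>

lemma flow_lead:
  assumes "\<And>j. j < k \<Longrightarrow> x j = 0" "\<And>j. j \<le> k \<Longrightarrow> w j = 0" "j \<le> k"
  shows "flow (B1 g) w x j = x j"
  using assms by (simp add: flow_rest B1_def rest_zero[OF biadd_b1])

text \<open>\<open>flowe g\<close> is unitriangular for the weight.\<close>

lemma flowe_inj:
  assumes "flowe g r = 0"
  shows "r = 0"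
proof -
  have "r k = 0" for k
  proof (induction k rule: less_induct)
    case (less k)
    then show ?case using flow_lead[of k r 0 k g] assms by simp
  qed
  then show ?thesis by (simp add: fun_eq_iff)
qed

lemma flow_zero: "flowe g 0 = 0"
  using flow_lead[of k 0 0 k g for k] by (auto simp: fun_eq_iff)

section \<open>The residual equation and the gauge to the leading component\<close>

definition lead :: "(nat \<Rightarrow> 'v) \<Rightarrow> nat \<Rightarrow> 'v" where
  "lead \<phi> k = (if k = \<delta> then \<phi> \<delta> else 0)"

lemma res_lead: "res 0 (lead \<phi>) = 0"
  by (auto simp: res_def lead_def fun_eq_iff E_def S_def D_simps B1_simps)

text \<open>For \<open>u = 0\<close> only the \<open>E\<close> term and the scalar term survive,
  giving k - \<delta> times \<open>\<phi> k\<close>, with k - \<delta> invertible in the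
  rationals.\<close>

lemma res_0_eq_0:
  assumes "res 0 \<phi> k = 0" "k \<noteq> \<delta>"
  shows "\<phi> k = 0"
proof -
  have "sc (of_nat k - of_nat \<delta>) (\<phi> k) = 0"
    using assms(1) by (simp add: res_def D_simps B1_simps E_def S_def scale_left_diff_distrib)
  then show ?thesis using assms(2) by simp
qed

text \<open>All operations ignore weight 0, so its entry may be reset to 0, as
  \<open>obtain_gauge\<close> requires.\<close>

lemma res_cut: "res (u(0 := 0)) \<phi> = res u \<phi>"
proof -
  have "D (u(0 := 0)) = D u" by (auto simp: D_def fun_eq_iff d_simps d_0)
  moreover have "B1 (u(0 := 0)) \<phi> = B1 u \<phi>"
    by (auto simp: B1_def conv_def fun_eq_iff b1_simps intro!: sum.cong)
  ultimately show ?thesis by (simp add: res_def)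
qed

text \<open>Both \<open>D g\<close> and the brackets of \<open>g\<close> with \<phi> start above
  weight \<delta>; a gauge transformation leaves the leading component alone.\<close>

lemma flow1_lead:
  assumes "\<And>j. j < \<delta> \<Longrightarrow> \<phi> j = 0" "j \<le> \<delta>"
  shows "flow1 g \<phi> j = \<phi> j"
  using flow_lead[of \<delta> \<phi> "D g" j g] assms D_0 by auto

text \<open>From left to right, \<open>u\<close> is the source that the given \<open>g\<close> moves
  to 0. The transported residual is then that of \<open>lead \<phi>\<close>, which is zero, and
  \<open>flowe g\<close> is injective.\<close>

theorem gauge_lead_iff:
  assumes "\<And>j. j < \<delta> \<Longrightarrow> \<phi> j = 0"
  shows "(\<exists>g. flow1 g \<phi> = lead \<phi>) \<longleftrightarrow> (\<exists>u. res u \<phi> = 0)"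
proof
  assume "\<exists>g. flow1 g \<phi> = lead \<phi>"
  then obtain g where g: "flow1 g \<phi> = lead \<phi>" by blast
  obtain u where "flow0 g u = 0" by (rule obtain_source)
  then have "flowe g (res u \<phi>) = 0"
    using flow_res[of g u \<phi>] by (simp add: g res_lead)
  then show "\<exists>u. res u \<phi> = 0" using flowe_inj by blast
next
  assume "\<exists>u. res u \<phi> = 0"
  then obtain u where u: "res u \<phi> = 0" by blast
  obtain g where g: "flow0 g (u(0 := 0)) = 0" by (rule obtain_gauge[of "u(0 := 0)"], simp)
  have "res 0 (flow1 g \<phi>) = 0"
    using flow_res[of g "u(0 := 0)" \<phi>] by (simp add: res_cut u flow_zero g)
  then have "flow1 g \<phi> k = lead \<phi> k" for k
    using flow1_lead[OF assms order_refl] res_0_eq_0[of "flow1 g \<phi>" k] by (auto simp: lead_def)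
  then show "\<exists>g. flow1 g \<phi> = lead \<phi>" by auto
qed

text \<open>Here the gauge starts at the leading component. The solution 0 for
  \<open>lead \<phi>\<close> is carried to \<open>flow0 g 0\<close>, a solution for \<phi>, so no
  inverse gauge has to be constructed.\<close>

theorem lead_gauge:
  assumes "flow1 g (lead \<phi>) = \<phi>"
  shows "\<exists>u. res u \<phi> = 0"
  using flow_res[of g 0 "lead \<phi>"] assms by (auto simp: res_lead flow_zero)

text \<open>Below weight n + \<delta> only \<open>\<phi> \<delta>\<close> is present, and the entry
  of \<phi> in weight n + \<delta> meets \<open>v 0\<close>, which acts as zero.\<close>

lemma B1_tail:
  assumes "\<And>j. j < n + \<delta> \<Longrightarrow> j \<noteq> \<delta> \<Longrightarrow> \<phi> j = 0"
  shows "B1 v \<phi> (n + \<delta>) = b1 n \<delta> (v n) (\<phi> \<delta>)"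
proof -
  have "B1 v \<phi> (n + \<delta>) = (\<Sum>l\<le>n + \<delta>. if l = n then b1 n \<delta> (v n) (\<phi> \<delta>) else 0)"
    unfolding B1_def conv_def
  proof (rule sum.cong[OF refl])
    fix l assume "l \<in> {..n + \<delta>}"
    then show "b1 l (n + \<delta> - l) (v l) (\<phi> (n + \<delta> - l)) = (if l = n then b1 n \<delta> (v n) (\<phi> \<delta>) else 0)"
      using assms[of "n + \<delta> - l"] by (cases "l = 0") (auto simp: b1_simps)
  qed
  then show ?thesis by simp
qed

text \<open>After the gauge transformation that moves $E + u$ to $E$, the leading residual is that of the
  zero solution, which differs from an exact solution only by the boundary in the conclusion.\<close>

theorem lead_residue_exact:
  assumes \<phi>: "\<And>j. j < \<delta> \<Longrightarrow> \<phi> j = 0" and U: "res U \<phi> = 0"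
    and u: "\<And>j. j < n + \<delta> \<Longrightarrow> res u \<phi> j = 0" and n: "1 \<le> n"
  shows "\<exists>v. res u \<phi> (n + \<delta>) = d n v - b1 n \<delta> v (\<phi> \<delta>)"
proof -
  obtain g where g: "flow0 g (u(0 := 0)) = 0" by (rule obtain_gauge[of "u(0 := 0)"], simp)
  define \<phi>' where "\<phi>' = flow1 g \<phi>"
  define V where "V = flow0 g U"
  have lead: "flowe g (res u \<phi>) j = res u \<phi> j" if "j \<le> n + \<delta>" for j
    using flow_lead[of "n + \<delta>" "res u \<phi>" 0 j g] u that by simp
  have r: "flowe g (res u \<phi>) = res 0 \<phi>'"
    using flow_res[of g "u(0 := 0)" \<phi>] by (simp add: res_cut g \<phi>'_def)
  \<comment> \<open>In weight \<open>j\<close> the transported residual is j - \<delta> times the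
    entry of \<phi>', so its vanishing below n + \<delta> leaves \<phi>' only its entry in weight
    \<delta> there. This is the hypothesis of \<open>B1_tail\<close>.\<close>
  have small: "\<phi>' j = 0" if "j < n + \<delta>" "j \<noteq> \<delta>" for j
    using lead[of j] u[of j] r that res_0_eq_0[of \<phi>' j] by simp
  have \<delta>: "\<phi>' \<delta> = \<phi> \<delta>" unfolding \<phi>'_def by (rule flow1_lead[OF \<phi>]) auto
  \<comment> \<open>The exact solution is carried along by the same \<open>g\<close>. In weight n +
    \<delta> its residual differs from that of the zero solution by terms in \<open>V n\<close>
    only, and \<open>V n\<close> becomes the witness.\<close>
  have "res V \<phi>' = 0"
    using flow_res[of g U \<phi>] by (simp add: U flow_zero V_def \<phi>'_def)
  then have "res V \<phi>' (n + \<delta>) = 0" by simp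
  moreover have "res V \<phi>' (n + \<delta>) = res 0 \<phi>' (n + \<delta>) - d n (V n) + b1 n \<delta> (V n) (\<phi> \<delta>)"
    using B1_tail[of n \<phi>' V] small by (simp add: res_def D_simps B1_simps D_def \<delta>)
  moreover have "res 0 \<phi>' (n + \<delta>) = res u \<phi> (n + \<delta>)"
    using lead[of "n + \<delta>"] r by simp
  moreover have "r = x - y" if "r - x + y = 0" for r x y :: 'v
  proof -
    have "r = (r - x + y) + (x - y)" by simp
    then show ?thesis by (simp only: that) simp
  qed
  ultimately show ?thesis by (intro exI[of _ "V n"]) simp
qed

section \<open>Constructing a solution one weight at a time\<close>

lemma res_low:
  assumes "\<And>j. j < \<delta> \<Longrightarrow> \<phi> j = 0" "k \<le> \<delta>"
  shows "res u \<phi> k = 0"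
proof -
  have "B1 u \<phi> k = 0" unfolding B1_def by (rule conv_low[OF biadd_b1]) (use assms in auto)
  moreover have "E \<phi> k = S (of_nat \<delta>) \<phi> k"
    by (cases "k = \<delta>") (use assms in \<open>auto simp: E_def S_def\<close>)
  ultimately show ?thesis using assms by (simp add: res_def D_0)
qed

text \<open>As \<phi> starts in weight \<delta>, the entry \<open>u j\<close> is first felt in
  weight j + \<delta>, through \<open>D\<close> and through the bracket.\<close>

lemma res_cong:
  assumes "\<And>j. j < \<delta> \<Longrightarrow> \<phi> j = 0" "\<And>j. j + \<delta> \<le> k \<Longrightarrow> u j = u' j"
  shows "res u \<phi> k = res u' \<phi> k"
proof -
  have "B1 u \<phi> k = B1 u' \<phi> k"
    unfolding B1_def conv_def
  proof (rule sum.cong[OF refl])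
    fix l assume "l \<in> {..k}"
    then show "b1 l (k - l) (u l) (\<phi> (k - l)) = b1 l (k - l) (u' l) (\<phi> (k - l))"
      by (cases "l + \<delta> \<le> k") (use assms in \<open>auto simp: b1_simps\<close>)
  qed
  moreover have "D u k = D u' k" using assms(2)[of "k - \<delta>"] by (auto simp: D_def)
  ultimately show ?thesis by (simp add: res_def)
qed

text \<open>Adding \<open>v\<close> in weight \<open>n\<close> changes the residual in weight n +
  \<delta> by minus the right-hand side of \<open>step\<close>, and changes nothing below. Dependent
  choice repeats this, and the diagonal of the stages is the solution.\<close>

theorem stepwise_solution:
  assumes \<phi>: "\<And>j. j < \<delta> \<Longrightarrow> \<phi> j = 0"
    and step: "\<And>n u. 1 \<le> n \<Longrightarrow> (\<And>j. j < n + \<delta> \<Longrightarrow> res u \<phi> j = 0) \<Longrightarrow>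
      \<exists>v. res u \<phi> (n + \<delta>) = d n v - b1 n \<delta> v (\<phi> \<delta>)"
  shows "\<exists>u. res u \<phi> = 0"
proof -
  \<comment> \<open>Stage \<open>n\<close> controls the residual up to and including weight n +
    \<delta>, which by \<open>res_cong\<close> involves the entries of \<open>u\<close> up to
    \<open>n\<close>.\<close>
  define P where "P n u \<longleftrightarrow> (\<forall>j < Suc n + \<delta>. res u \<phi> j = 0)" for n u
  have "\<exists>f. \<forall>n. P n (f n) \<and> (\<forall>j. j \<noteq> Suc n \<longrightarrow> f (Suc n) j = f n j)"
  proof (rule dependent_nat_choice)
    show "\<exists>u. P 0 u" using res_low[OF \<phi>] by (auto simp: P_def less_Suc_eq_le)
  next
    fix u n assume u: "P n u"
    then obtain v where v: "res u \<phi> (Suc n + \<delta>) = d (Suc n) v - b1 (Suc n) \<delta> v (\<phi> \<delta>)"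
      using step[of "Suc n" u] by (auto simp: P_def)
    define s where "s = (\<lambda>j. if j = Suc n then v else 0)"
    have B: "B1 s \<phi> j = (if Suc n \<le> j then b1 (Suc n) (j - Suc n) v (\<phi> (j - Suc n)) else 0)" for j
    proof -
      have "B1 s \<phi> j = (\<Sum>l\<le>j. if l = Suc n then b1 (Suc n) (j - Suc n) v (\<phi> (j - Suc n)) else 0)"
        unfolding B1_def conv_def by (rule sum.cong) (auto simp: s_def b1_simps)
      then show ?thesis by simp
    qed
    have "res (u + s) \<phi> j = 0" if "j < Suc (Suc n) + \<delta>" for j
    proof -
      have e: "res (u + s) \<phi> j = res u \<phi> j - D s j + B1 s \<phi> j"
        by (simp add: res_def D_simps B1_simps)
      show ?thesis
      proof (cases "j = Suc n + \<delta>")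
        case True
        have "B1 s \<phi> j = b1 (Suc n) \<delta> v (\<phi> \<delta>)" by (simp add: B True)
        moreover have "D s j = d (Suc n) v" by (simp add: D_def s_def True)
        ultimately show ?thesis using v unfolding e by (simp add: True)
      next
        case False
        with that have j: "j < Suc n + \<delta>" by simp
        \<comment> \<open>The correction reaches weight \<open>j\<close> through the entry of \<phi>
          in weight \<open>j - Suc n\<close>, which is still below \<delta> and hence zero.\<close>
        then have "j - Suc n < \<delta>" by (cases "Suc n \<le> j") (use \<delta>_pos in auto)
        with j have "B1 s \<phi> j = 0" by (simp add: B \<phi> b1_simps)
        moreover have "D s j = 0" using j by (auto simp: D_def s_def d_simps)
        moreover have "res u \<phi> j = 0" using u j by (simp add: P_def)
        ultimately show ?thesis by (simp add: e)
      qed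
    qed
    then show "\<exists>u'. P (Suc n) u' \<and> (\<forall>j. j \<noteq> Suc n \<longrightarrow> u' j = u j)"
      by (intro exI[of _ "u + s"]) (auto simp: P_def s_def)
  qed
  then obtain f where f: "\<And>n. P n (f n)" "\<And>n j. j \<noteq> Suc n \<Longrightarrow> f (Suc n) j = f n j"
    by blast
  \<comment> \<open>Entry \<open>j\<close> is final from stage \<open>j\<close> on, so the diagonal
    agrees with stage \<open>k\<close> on all entries visible in weight \<open>k\<close>.\<close>
  have stable: "f (n + i) j = f n j" if "j \<le> n" for n i j
    by (induction i) (use that f(2) in auto)
  have "res (\<lambda>k. f k k) \<phi> k = 0" for k
  proof -
    have "res (\<lambda>j. f j j) \<phi> k = res (f k) \<phi> k"
    proof (rule res_cong[OF \<phi>])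
      fix j assume "j + \<delta> \<le> k"
      then show "f j j = f k j" using stable[of j j "k - j"] by simp
    qed simp
    also have "\<dots> = 0" using f(1)[of k] by (simp add: P_def)
    finally show ?thesis .
  qed
  then show ?thesis by (intro exI[of _ "\<lambda>k. f k k"]) (simp add: fun_eq_iff)
qed

end

section \<open>Modules over a rational algebra\<close>

text \<open>The scalar multiplication of the free rational vector space on a type, with vectors as
  finitely supported functions.\<close>

definition psc :: "rat \<Rightarrow> ('a \<Rightarrow>\<^sub>0 rat) \<Rightarrow> 'a \<Rightarrow>\<^sub>0 rat" where
  "psc c f = Poly_Mapping.map ((*) c) f"

lemma lookup_psc: "Poly_Mapping.lookup (psc c f) x = c * Poly_Mapping.lookup f x"
  by (simp add: psc_def Poly_Mapping.map.rep_eq when_def)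

interpretation psc: vector_space psc
  by unfold_locales (auto intro!: poly_mapping_eqI simp: lookup_psc lookup_add algebra_simps)

interpretation psc_pair: vector_space_pair psc psc ..

context comm_Q_algebra
begin

definition rat_map where "rat_map = (SOME h. h \<in> ring_hom rat_ring R)"

lemma rat_map_hom: "rat_map \<in> ring_hom rat_ring R"
  unfolding rat_map_def using rat_structure_map by (rule someI_ex)

lemma rat_map_closed [simp]: "rat_map a \<in> carrier R"
  and rat_map_add: "rat_map (a + b) = rat_map a \<oplus>\<^bsub>R\<^esub> rat_map b"
  and rat_map_mult: "rat_map (a * b) = rat_map a \<otimes>\<^bsub>R\<^esub> rat_map b"
  and rat_map_1 [simp]: "rat_map 1 = \<one>\<^bsub>R\<^esub>"
  using rat_map_hom by (auto simp: ring_hom_def rat_ring_def)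

lemma rat_map_0 [simp]: "rat_map 0 = \<zero>\<^bsub>R\<^esub>"
  using rat_map_add[of 0 0] by (simp add: local.add.l_cancel_one')

lemma add_pow_one: "[n] \<cdot>\<^bsub>R\<^esub> \<one>\<^bsub>R\<^esub> = rat_map (of_nat n)" for n :: nat
  by (induction n) (simp_all add: rat_map_add add.nat_pow_Suc a_comm)

lemma inv_nat_eq: "n \<noteq> 0 \<Longrightarrow> inv_nat R n = rat_map (1 / of_nat n)"
  unfolding inv_nat_def add_pow_one
  by (rule comm_inv_char) (simp_all add: rat_map_mult[symmetric])

lemma add_pow_smult:
  assumes "Module.module R M" "x \<in> carrier M"
  shows "[n] \<cdot>\<^bsub>M\<^esub> x = rat_map (of_nat n) \<odot>\<^bsub>M\<^esub> x"
proof -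
  interpret M: Module.module R M by fact
  show ?thesis
    by (induction n) (simp_all add: assms M.add.nat_pow_Suc M.smult_l_distr rat_map_add M.a_comm)
qed

end

locale comm_Q_module = comm_Q_algebra R + Module.module R M for R :: "'r ring" and M :: "('r, 'm) module"
begin

text \<open>Evaluation of a formal rational combination inside the module. Keys outside the carrier
  are discarded, so the map is total and always lands in the carrier.\<close>

definition realize :: "('m \<Rightarrow>\<^sub>0 rat) \<Rightarrow> 'm" where
  "realize f = (\<Oplus>\<^bsub>M\<^esub>x\<in>Poly_Mapping.keys f \<inter> carrier M. rat_map (Poly_Mapping.lookup f x) \<odot>\<^bsub>M\<^esub> x)"

lemma realize_superset:
  assumes "finite A" "Poly_Mapping.keys f \<subseteq> A"
  shows "realize f = (\<Oplus>\<^bsub>M\<^esub>x\<in>A \<inter> carrier M. rat_map (Poly_Mapping.lookup f x) \<odot>\<^bsub>M\<^esub> x)"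
  unfolding realize_def
  by (rule M.add.finprod_mono_neutral_cong_left) (use assms in \<open>auto simp: in_keys_iff\<close>)

lemma realize_closed [simp]: "realize f \<in> carrier M"
  unfolding realize_def by (rule M.finsum_closed) auto

lemma realize_add: "realize (f + g) = realize f \<oplus>\<^bsub>M\<^esub> realize g"
proof -
  define A where "A = Poly_Mapping.keys f \<union> Poly_Mapping.keys g"
  have A: "finite A" "Poly_Mapping.keys f \<subseteq> A" "Poly_Mapping.keys g \<subseteq> A" "Poly_Mapping.keys (f + g) \<subseteq> A"
    by (auto simp: A_def dest: subsetD[OF Poly_Mapping.keys_add])
  have "(\<Oplus>\<^bsub>M\<^esub>x\<in>A \<inter> carrier M. rat_map (Poly_Mapping.lookup (f + g) x) \<odot>\<^bsub>M\<^esub> x) =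
      (\<Oplus>\<^bsub>M\<^esub>x\<in>A \<inter> carrier M. rat_map (Poly_Mapping.lookup f x) \<odot>\<^bsub>M\<^esub> x \<oplus>\<^bsub>M\<^esub> rat_map (Poly_Mapping.lookup g x) \<odot>\<^bsub>M\<^esub> x)"
    by (rule M.finsum_cong') (auto simp: lookup_add rat_map_add smult_l_distr)
  also have "\<dots> = (\<Oplus>\<^bsub>M\<^esub>x\<in>A \<inter> carrier M. rat_map (Poly_Mapping.lookup f x) \<odot>\<^bsub>M\<^esub> x) \<oplus>\<^bsub>M\<^esub>
      (\<Oplus>\<^bsub>M\<^esub>x\<in>A \<inter> carrier M. rat_map (Poly_Mapping.lookup g x) \<odot>\<^bsub>M\<^esub> x)"
    by (rule M.finsum_addf) auto
  finally show ?thesis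
    unfolding A(2-)[THEN realize_superset[OF A(1)]] .
qed

lemma realize_psc: "realize (psc c f) = rat_map c \<odot>\<^bsub>M\<^esub> realize f"
proof -
  have "Poly_Mapping.keys (psc c f) \<subseteq> Poly_Mapping.keys f"
    by (auto simp: in_keys_iff lookup_psc)
  then show ?thesis
    by (simp add: realize_superset[OF finite_keys, of "psc c f" f] realize_def[of f] finsum_smult_ldistr Pi_def lookup_psc rat_map_mult smult_assoc1
        cong: M.finsum_cong)
qed

lemma realize_single: "x \<in> carrier M \<Longrightarrow> realize (Poly_Mapping.single x 1) = x"
  by (simp add: realize_def M.finsum_singleton)

lemma realize_0 [simp]: "realize 0 = \<zero>\<^bsub>M\<^esub>"
  by (simp add: realize_def)

lemma realize_diff: "realize (f - g) = realize f \<ominus>\<^bsub>M\<^esub> realize g"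
proof -
  have "realize (f - g) \<oplus>\<^bsub>M\<^esub> realize g = realize f"
    by (simp flip: realize_add)
  then show ?thesis
    by (metis M.add.inv_solve_right M.minus_eq realize_closed)
qed

text \<open>The kernel of \<open>realize\<close> is a direct summand over \<open>\<rat>\<close>, so \<open>M\<close> is a retract of the
  free rational vector space on its elements.\<close>

lemma retract_exists:
  "\<exists>emb. (\<forall>x\<in>carrier M. \<forall>y\<in>carrier M. emb (x \<oplus>\<^bsub>M\<^esub> y) = emb x + emb y) \<and> (\<forall>x\<in>carrier M. realize (emb x) = x)"
proof -
  define K where "K = {f. realize f = \<zero>\<^bsub>M\<^esub>}"
  have K: "psc.subspace K"
    by (auto simp: psc.subspace_def K_def realize_add realize_psc)
  obtain B where B: "B \<subseteq> K" "psc.independent B" "K \<subseteq> psc.span B"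
    using psc.maximal_independent_subset by blast
  have span: "psc.span B = K"
    using B K by (metis psc.span_minimal subset_antisym)
  \<comment> \<open>\<open>s\<close> fixes a basis of the kernel and has values in its span: a
    rational projection onto the kernel.\<close>
  define s where "s = psc_pair.construct B id"
  interpret s: linear psc psc s
    unfolding s_def by (rule psc_pair.linear_construct[OF B(2)])
  have sK: "s f \<in> K" for f
    using psc_pair.construct_in_span[OF B(2), of id f] by (simp add: s_def span)
  have s_id: "s f = f" if "f \<in> K" for f
  proof -
    have "f \<in> psc.span B" using that span by simp
    then show ?thesis
    proof (induction rule: psc.span_induct_alt)
      case (step c x y)
      then show ?case by (simp add: s.add s.scale psc_pair.construct_basis[OF B(2)] s_def[symmetric])
         (simp add: s_def psc_pair.construct_basis[OF B(2)])
    qed simp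
  qed
  \<comment> \<open>Subtracting the projection makes the embedding additive, since the defect of
    additivity of \<open>x \<mapsto> single x 1\<close> lies in the kernel, where \<open>s\<close>
    is the identity. As \<open>s\<close> has values in the kernel, \<open>realize\<close> does not
    notice the subtraction.\<close>
  define emb where "emb x = Poly_Mapping.single x 1 - s (Poly_Mapping.single x 1)" for x
  have "emb (x \<oplus>\<^bsub>M\<^esub> y) = emb x + emb y" if "x \<in> carrier M" "y \<in> carrier M" for x y
  proof -
    let ?e = "\<lambda>x. Poly_Mapping.single x 1 :: 'm \<Rightarrow>\<^sub>0 rat"
    have "?e (x \<oplus>\<^bsub>M\<^esub> y) - (?e x + ?e y) \<in> K"
      using that by (simp add: K_def realize_diff realize_add realize_single M.minus_eq M.r_neg)
    then have "s (?e (x \<oplus>\<^bsub>M\<^esub> y) - (?e x + ?e y)) = ?e (x \<oplus>\<^bsub>M\<^esub> y) - (?e x + ?e y)"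
      by (rule s_id)
    then show ?thesis
      by (simp add: emb_def s.diff s.add algebra_simps)
  qed
  moreover have "realize (emb x) = x" if "x \<in> carrier M" for x
    using that sK[of "Poly_Mapping.single x 1"]
    by (simp add: emb_def realize_diff realize_single K_def M.minus_eq)
  ultimately show ?thesis by (intro exI[of _ emb]) simp
qed

definition emb :: "'m \<Rightarrow> 'm \<Rightarrow>\<^sub>0 rat" where
  "emb = (SOME e. (\<forall>x\<in>carrier M. \<forall>y\<in>carrier M. e (x \<oplus>\<^bsub>M\<^esub> y) = e x + e y) \<and> (\<forall>x\<in>carrier M. realize (e x) = x))"

lemma emb_add: "\<lbrakk>x \<in> carrier M; y \<in> carrier M\<rbrakk> \<Longrightarrow> emb (x \<oplus>\<^bsub>M\<^esub> y) = emb x + emb y"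
  and realize_emb [simp]: "x \<in> carrier M \<Longrightarrow> realize (emb x) = x"
  using someI_ex[OF retract_exists] unfolding emb_def by auto

lemma emb_zero [simp]: "emb \<zero>\<^bsub>M\<^esub> = 0"
  using emb_add[of "\<zero>\<^bsub>M\<^esub>" "\<zero>\<^bsub>M\<^esub>"] by simp

lemma emb_eq_iff: "\<lbrakk>x \<in> carrier M; y \<in> carrier M\<rbrakk> \<Longrightarrow> emb x = emb y \<longleftrightarrow> x = y"
  by (metis realize_emb)

lemma emb_diff: "\<lbrakk>x \<in> carrier M; y \<in> carrier M\<rbrakk> \<Longrightarrow> emb (x \<ominus>\<^bsub>M\<^esub> y) = emb x - emb y"
  using emb_add[of "x \<ominus>\<^bsub>M\<^esub> y" y] by (simp add: M.minus_eq M.a_assoc M.l_neg)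

lemma emb_finsum: "f \<in> A \<rightarrow> carrier M \<Longrightarrow> emb (finsum M f A) = (\<Sum>i\<in>A. emb (f i))"
  by (induction A rule: infinite_finite_induct) (simp_all add: emb_add M.finsum_infinite Pi_def)

text \<open>\<open>emb\<close> was chosen additive only; compatibility with rational multiples is
  automatic for the additive map \<open>emb\<close> after \<open>realize\<close>.\<close>

lemma emb_rat_smult:
  assumes "x \<in> carrier M"
  shows "emb (rat_map c \<odot>\<^bsub>M\<^esub> x) = psc c (emb x)"
proof -
  have "additive (\<lambda>f. emb (realize f))"
    by (simp add: additive_def realize_add emb_add)
  from additive_rat[OF psc.vector_space_axioms psc.vector_space_axioms this, of c "emb x"]
  show ?thesis by (simp add: realize_psc assms)
qed

end

section \<open>Gauge transformations in components\<close>

text \<open>Unfolding the recursion gives A^n x / n! - A^{n-1} w / n!, which links it to the two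
  exponential series in the definition of the gauge action.\<close>

lemma orbit_powers:
  assumes "vector_space sc" and A: "additive A" "\<And>c x. A (\<lambda>k. sc c (x k)) = (\<lambda>k. sc c (A x k))"
  shows "orbit sc A w x n k = sc (1 / fact n) ((A ^^ n) x k) -
    (if n = 0 then 0 else sc (1 / fact n) ((A ^^ (n - 1)) w k))"
proof (induction n arbitrary: k)
  case 0
  interpret sc: vector_space sc by fact
  show ?case by (simp add: orbit_simps)
next
  case (Suc n)
  interpret sc: vector_space sc by fact
  interpret A: additive A by fact
  have "orbit sc A w x n = (\<lambda>k. sc (1 / fact n) ((A ^^ n) x k)) -
      (if n = 0 then 0 else (\<lambda>k. sc (1 / fact n) ((A ^^ (n - 1)) w k)))"
    using Suc by (auto simp: fun_eq_iff)
  then have "A (orbit sc A w x n) = (\<lambda>k. sc (1 / fact n) ((A ^^ Suc n) x k)) -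
      (if n = 0 then 0 else (\<lambda>k. sc (1 / fact n) ((A ^^ n) w k)))"
    by (cases n) (simp_all add: A.diff A.zero A(2))
  then have "A (orbit sc A w x n) k = sc (1 / fact n) ((A ^^ Suc n) x k) -
      (if n = 0 then 0 else sc (1 / fact n) ((A ^^ n) w k))"
    by (simp split: if_splits)
  moreover have "1 / of_nat (Suc n) * (1 / fact n) = (1 / fact (Suc n) :: rat)"
    by simp
  ultimately show ?case
    by (simp add: orbit_simps(2) sc.scale_right_diff_distrib del: fact_Suc of_nat_Suc funpow.simps(2)) (auto simp del: fact_Suc)
qed

text \<open>Covers both $\mathfrak g$, whose components are weight projections, and its base change, whose
  elements are families of tensors.\<close>

locale weight_components = comm_Q_algebra K for K :: "'k ring" +
  fixes \<delta> :: nat and L :: "('k, 'a, 'z) wdgla_scheme"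
    and V0 V1 :: "nat \<Rightarrow> ('k, 'v) module"
    and c0 c1 :: "nat \<Rightarrow> 'a \<Rightarrow> 'v"
    and b0 b1 :: "nat \<Rightarrow> nat \<Rightarrow> 'v \<Rightarrow> 'v \<Rightarrow> 'v" and d :: "nat \<Rightarrow> 'v \<Rightarrow> 'v"
  assumes \<delta>_pos: "1 \<le> \<delta>"
    and gr0_module: "Module.module K (gr L 0)" and gr1_module: "Module.module K (gr L (- 1))"
    and V0_module: "1 \<le> k \<Longrightarrow> Module.module K (V0 k)" and V1_module: "1 \<le> k \<Longrightarrow> Module.module K (V1 k)"
    and c0_closed: "\<lbrakk>1 \<le> k; s \<in> carrier (gr L 0)\<rbrakk> \<Longrightarrow> c0 k s \<in> carrier (V0 k)"
    and c0_surj: "(\<And>k. 1 \<le> k \<Longrightarrow> f k \<in> carrier (V0 k)) \<Longrightarrow> \<exists>s\<in>carrier (gr L 0). \<forall>k\<ge>1. c0 k s = f k"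
    and c1_linear: "1 \<le> k \<Longrightarrow> c1 k \<in> lin_maps K (gr L (- 1)) (V1 k)"
    and c1_surj: "(\<And>k. 1 \<le> k \<Longrightarrow> f k \<in> carrier (V1 k)) \<Longrightarrow> \<exists>s\<in>carrier (gr L (- 1)). \<forall>k\<ge>1. c1 k s = f k"
    and c1_inj: "\<lbrakk>s \<in> carrier (gr L (- 1)); t \<in> carrier (gr L (- 1)); \<And>k. 1 \<le> k \<Longrightarrow> c1 k s = c1 k t\<rbrakk> \<Longrightarrow> s = t"
    and filt_iff: "filt L n (- 1) = {s \<in> carrier (gr L (- 1)). \<forall>k. 1 \<le> k \<and> k < n \<longrightarrow> c1 k s = \<zero>\<^bsub>V1 k\<^esub>}"
    and bra_closed: "\<lbrakk>s \<in> carrier (gr L 0); t \<in> carrier (gr L (- 1))\<rbrakk> \<Longrightarrow> bra L 0 (- 1) s t \<in> carrier (gr L (- 1))"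
    and c1_bra: "\<lbrakk>1 \<le> k; s \<in> carrier (gr L 0); t \<in> carrier (gr L (- 1))\<rbrakk> \<Longrightarrow>
      c1 k (bra L 0 (- 1) s t) = finsum (V1 k) (\<lambda>l. b1 l (k - l) (c0 l s) (c1 (k - l) t)) {1..<k}"
    and dif_closed: "s \<in> carrier (gr L 0) \<Longrightarrow> dif L 0 s \<in> carrier (gr L (- 1))"
    and c1_dif: "\<lbrakk>1 \<le> k; s \<in> carrier (gr L 0)\<rbrakk> \<Longrightarrow>
      c1 k (dif L 0 s) = (if k \<le> \<delta> then \<zero>\<^bsub>V1 k\<^esub> else d (k - \<delta>) (c0 (k - \<delta>) s))"
    and b0_closed: "\<lbrakk>1 \<le> k; 1 \<le> l; x \<in> carrier (V0 k); y \<in> carrier (V0 l)\<rbrakk> \<Longrightarrow> b0 k l x y \<in> carrier (V0 (k + l))"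
    and b0_add_left: "\<lbrakk>1 \<le> k; 1 \<le> l; x \<in> carrier (V0 k); x' \<in> carrier (V0 k); y \<in> carrier (V0 l)\<rbrakk> \<Longrightarrow>
      b0 k l (x \<oplus>\<^bsub>V0 k\<^esub> x') y = b0 k l x y \<oplus>\<^bsub>V0 (k + l)\<^esub> b0 k l x' y"
    and b0_add_right: "\<lbrakk>1 \<le> k; 1 \<le> l; x \<in> carrier (V0 k); y \<in> carrier (V0 l); y' \<in> carrier (V0 l)\<rbrakk> \<Longrightarrow>
      b0 k l x (y \<oplus>\<^bsub>V0 l\<^esub> y') = b0 k l x y \<oplus>\<^bsub>V0 (k + l)\<^esub> b0 k l x y'"
    and b1_closed: "\<lbrakk>1 \<le> k; 1 \<le> l; x \<in> carrier (V0 k); y \<in> carrier (V1 l)\<rbrakk> \<Longrightarrow> b1 k l x y \<in> carrier (V1 (k + l))"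
    and b1_add_left: "\<lbrakk>1 \<le> k; 1 \<le> l; x \<in> carrier (V0 k); x' \<in> carrier (V0 k); y \<in> carrier (V1 l)\<rbrakk> \<Longrightarrow>
      b1 k l (x \<oplus>\<^bsub>V0 k\<^esub> x') y = b1 k l x y \<oplus>\<^bsub>V1 (k + l)\<^esub> b1 k l x' y"
    and b1_add_right: "\<lbrakk>1 \<le> k; 1 \<le> l; x \<in> carrier (V0 k); y \<in> carrier (V1 l); y' \<in> carrier (V1 l)\<rbrakk> \<Longrightarrow>
      b1 k l x (y \<oplus>\<^bsub>V1 l\<^esub> y') = b1 k l x y \<oplus>\<^bsub>V1 (k + l)\<^esub> b1 k l x y'"
    and d_closed: "\<lbrakk>1 \<le> k; x \<in> carrier (V0 k)\<rbrakk> \<Longrightarrow> d k x \<in> carrier (V1 (k + \<delta>))"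
    and d_add: "\<lbrakk>1 \<le> k; x \<in> carrier (V0 k); y \<in> carrier (V0 k)\<rbrakk> \<Longrightarrow>
      d k (x \<oplus>\<^bsub>V0 k\<^esub> y) = d k x \<oplus>\<^bsub>V1 (k + \<delta>)\<^esub> d k y"
    and act: "\<lbrakk>1 \<le> k; 1 \<le> l; 1 \<le> m; x \<in> carrier (V0 k); y \<in> carrier (V0 l); z \<in> carrier (V1 m)\<rbrakk> \<Longrightarrow>
      b1 k (l + m) x (b1 l m y z) = b1 (k + l) m (b0 k l x y) z \<oplus>\<^bsub>V1 (k + l + m)\<^esub> b1 l (k + m) y (b1 k m x z)"
    and derivation: "\<lbrakk>1 \<le> k; 1 \<le> l; x \<in> carrier (V0 k); y \<in> carrier (V0 l)\<rbrakk> \<Longrightarrow>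
      d (k + l) (b0 k l x y) = b1 k (l + \<delta>) x (d l y) \<ominus>\<^bsub>V1 (k + l + \<delta>)\<^esub> b1 l (k + \<delta>) y (d k x)"
begin

section \<open>Transport of the component operations to total rational ones\<close>

lemma Q_module: "1 \<le> k \<Longrightarrow> comm_Q_module K (V0 k)" "1 \<le> k \<Longrightarrow> comm_Q_module K (V1 k)"
  using V0_module V1_module by (simp_all add: comm_Q_module_def comm_Q_algebra_axioms)

definition e0 where "e0 k = comm_Q_module.emb K (V0 k)"
definition e1 where "e1 k = comm_Q_module.emb K (V1 k)"
definition p0 where "p0 k = comm_Q_module.realize K (V0 k)"
definition p1 where "p1 k = comm_Q_module.realize K (V1 k)"

lemmas p0_closed = comm_Q_module.realize_closed[OF Q_module(1), folded p0_def]
  and p1_closed = comm_Q_module.realize_closed[OF Q_module(2), folded p1_def]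
lemmas p0_add = comm_Q_module.realize_add[OF Q_module(1), folded p0_def]
  and p1_add = comm_Q_module.realize_add[OF Q_module(2), folded p1_def]
lemmas p0_e0 = comm_Q_module.realize_emb[OF Q_module(1), folded p0_def e0_def]
  and p1_e1 = comm_Q_module.realize_emb[OF Q_module(2), folded p1_def e1_def]
lemmas e0_add = comm_Q_module.emb_add[OF Q_module(1), folded e0_def]
  and e1_add = comm_Q_module.emb_add[OF Q_module(2), folded e1_def]
lemmas e1_0 = comm_Q_module.emb_zero[OF Q_module(2), folded e1_def]
lemmas e1_diff = comm_Q_module.emb_diff[OF Q_module(2), folded e1_def]
lemmas e1_finsum = comm_Q_module.emb_finsum[OF Q_module(2), folded e1_def]
lemmas e1_smult = comm_Q_module.emb_rat_smult[OF Q_module(2), folded e1_def]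
lemmas e1_eq_iff = comm_Q_module.emb_eq_iff[OF Q_module(2), folded e1_def]

text \<open>Arguments are realized in the module, the operation is applied there, and the result is
  embedded. All arguments are admissible because \<open>realize\<close> lands in the carrier, and
  composites collapse because \<open>realize\<close> undoes \<open>emb\<close>.\<close>

definition t0 where "t0 l m x y = (if l = 0 \<or> m = 0 then 0 else e0 (l + m) (b0 l m (p0 l x) (p0 m y)))"
definition t1 where "t1 l m x y = (if l = 0 \<or> m = 0 then 0 else e1 (l + m) (b1 l m (p0 l x) (p1 m y)))"
definition td where "td l x = (if l = 0 then 0 else e1 (l + \<delta>) (d l (p0 l x)))"

lemma biadd_t0: "biadd t0" and biadd_t1: "biadd t1"
  unfolding biadd_def t0_def t1_def
  by (auto simp: p0_add p1_add p0_closed p1_closed b0_add_left b0_add_right b0_closed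
      b1_add_left b1_add_right b1_closed e0_add e1_add)

lemma td_add: "td k (x + y) = td k x + td k y"
  by (simp add: td_def p0_add d_add p0_closed d_closed e1_add)

lemma td_zero: "td k 0 = 0" "td 0 x = 0"
  using td_add[of k 0 0] by (simp_all add: td_def)

text \<open>Each axiom is the corresponding identity for the realized arguments; the cases with a
  weight 0 are trivial by the definition of the operations.\<close>

sublocale T: graded_total psc \<delta> t0 t1 td
proof
  fix k l m x y z
  show "1 \<le> \<delta>" "biadd t0" "biadd t1" by (rule \<delta>_pos biadd_t0 biadd_t1)+
  show "td k (x + y) = td k x + td k y"
    by (rule td_add)
  show "td 0 x = 0" by (simp add: td_def)
  show "t1 k (l + m) x (t1 l m y z) = t1 (k + l) m (t0 k l x y) z + t1 l (k + m) y (t1 k m x z)"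
  proof (cases "k = 0 \<or> l = 0 \<or> m = 0")
    case True
    then show ?thesis by (auto simp: biadd_simps[OF biadd_t1] biadd_simps[OF biadd_t0])
  next
    case False
    define X Y Z where XYZ: "X = p0 k x" "Y = p0 l y" "Z = p1 m z"
    have X: "X \<in> carrier (V0 k)" and Y: "Y \<in> carrier (V0 l)" and Z: "Z \<in> carrier (V1 m)"
      using False by (simp_all add: XYZ p0_closed p1_closed)
    have "t1 k (l + m) x (t1 l m y z) = e1 (k + l + m) (b1 k (l + m) X (b1 l m Y Z))"
      using False X Y Z by (simp add: t1_def XYZ[symmetric] p1_e1 b1_closed add.assoc)
    also have "\<dots> = e1 (k + l + m) (b1 (k + l) m (b0 k l X Y) Z \<oplus>\<^bsub>V1 (k + l + m)\<^esub> b1 l (k + m) Y (b1 k m X Z))"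
      using False X Y Z by (subst act) auto
    also have "\<dots> = e1 (k + l + m) (b1 (k + l) m (b0 k l X Y) Z) + e1 (k + l + m) (b1 l (k + m) Y (b1 k m X Z))"
      using False X Y Z b1_closed[of l "k + m" Y "b1 k m X Z"] b1_closed[of "k + l" m "b0 k l X Y" Z]
      by (intro e1_add) (auto simp: b0_closed b1_closed add.assoc add.left_commute)
    also have "\<dots> = t1 (k + l) m (t0 k l x y) z + t1 l (k + m) y (t1 k m x z)"
      using False X Y Z by (simp add: t0_def t1_def XYZ[symmetric] p0_e0 p1_e1 b0_closed b1_closed add.assoc add.left_commute)
    finally show ?thesis .
  qed
  show "td (k + l) (t0 k l x y) = t1 k (l + \<delta>) x (td l y) - t1 l (k + \<delta>) y (td k x)"
  proof (cases "k = 0 \<or> l = 0")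
    case True
    then show ?thesis
      by (auto simp: biadd_simps[OF biadd_t1] biadd_simps[OF biadd_t0] td_zero)
  next
    case False
    define X Y where XY: "X = p0 k x" "Y = p0 l y"
    have X: "X \<in> carrier (V0 k)" and Y: "Y \<in> carrier (V0 l)"
      using False by (simp_all add: XY p0_closed)
    have "td (k + l) (t0 k l x y) = e1 (k + l + \<delta>) (d (k + l) (b0 k l X Y))"
      using False X Y by (simp add: td_def t0_def XY[symmetric] p0_e0 b0_closed)
    also have "\<dots> = e1 (k + l + \<delta>) (b1 k (l + \<delta>) X (d l Y) \<ominus>\<^bsub>V1 (k + l + \<delta>)\<^esub> b1 l (k + \<delta>) Y (d k X))"
      using False X Y by (subst derivation) auto
    also have "\<dots> = e1 (k + l + \<delta>) (b1 k (l + \<delta>) X (d l Y)) - e1 (k + l + \<delta>) (b1 l (k + \<delta>) Y (d k X))"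
      using False X Y b1_closed[of l "k + \<delta>" Y "d k X"] b1_closed[of k "l + \<delta>" X "d l Y"]
      by (intro e1_diff) (auto simp: d_closed add.assoc add.left_commute)
    also have "\<dots> = t1 k (l + \<delta>) x (td l y) - t1 l (k + \<delta>) y (td k x)"
      using False X Y \<delta>_pos by (simp add: td_def t1_def XY[symmetric] p1_e1 d_closed add.assoc add.left_commute)
    finally show ?thesis .
  qed
qed

definition s0 where "s0 s k = (if k = 0 then 0 else e0 k (c0 k s))"
definition s1 where "s1 t k = (if k = 0 then 0 else e1 k (c1 k t))"

sublocale gr0: Module.module K "gr L 0" by (rule gr0_module)
sublocale gr1: Module.module K "gr L (- 1)" by (rule gr1_module)

lemma c1_closed: "\<lbrakk>1 \<le> k; t \<in> carrier (gr L (- 1))\<rbrakk> \<Longrightarrow> c1 k t \<in> carrier (V1 k)"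
  using c1_linear[of k] by (auto simp: lin_maps_def)

lemma s1_add: "\<lbrakk>s \<in> carrier (gr L (- 1)); t \<in> carrier (gr L (- 1))\<rbrakk> \<Longrightarrow> s1 (s \<oplus>\<^bsub>gr L (- 1)\<^esub> t) = s1 s + s1 t"
  using c1_linear by (simp add: fun_eq_iff s1_def lin_maps_def e1_add c1_closed)

lemma s1_diff:
  assumes "s \<in> carrier (gr L (- 1))" "t \<in> carrier (gr L (- 1))"
  shows "s1 (s \<ominus>\<^bsub>gr L (- 1)\<^esub> t) = s1 s - s1 t"
  using s1_add[of "s \<ominus>\<^bsub>gr L (- 1)\<^esub> t" t] assms
  by (simp add: gr1.M.minus_eq gr1.M.a_assoc gr1.M.l_neg)

lemma s1_smult: "t \<in> carrier (gr L (- 1)) \<Longrightarrow> s1 (rat_map c \<odot>\<^bsub>gr L (- 1)\<^esub> t) = (\<lambda>k. psc c (s1 t k))"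
  using c1_linear by (simp add: fun_eq_iff s1_def lin_maps_def e1_smult c1_closed)

lemma s1_inj: "\<lbrakk>s \<in> carrier (gr L (- 1)); t \<in> carrier (gr L (- 1)); s1 s = s1 t\<rbrakk> \<Longrightarrow> s = t"
proof (rule c1_inj)
  fix k :: nat assume k: "1 \<le> k" and st: "s \<in> carrier (gr L (- 1))" "t \<in> carrier (gr L (- 1))" "s1 s = s1 t"
  from st(3) have "s1 s k = s1 t k" by simp
  then show "c1 k s = c1 k t" using k st(1,2) by (simp add: s1_def e1_eq_iff c1_closed)
qed

lemma s1_finsum:
  "f \<in> A \<rightarrow> carrier (gr L (- 1)) \<Longrightarrow> s1 (finsum (gr L (- 1)) f A) k = (\<Sum>i\<in>A. s1 (f i) k)"
proof (induction A rule: infinite_finite_induct)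
  case (insert i A)
  then show ?case by (simp add: Pi_def s1_add)
next
  case empty
  have "s1 \<zero>\<^bsub>gr L (- 1)\<^esub> = 0"
    using s1_add[of "\<zero>\<^bsub>gr L (- 1)\<^esub>" "\<zero>\<^bsub>gr L (- 1)\<^esub>"] by simp
  then show ?case by simp
next
  case (infinite A)
  have "s1 \<zero>\<^bsub>gr L (- 1)\<^esub> = 0"
    using s1_add[of "\<zero>\<^bsub>gr L (- 1)\<^esub>" "\<zero>\<^bsub>gr L (- 1)\<^esub>"] by simp
  then show ?case using infinite by (simp add: gr1.M.finsum_infinite)
qed

lemma B1_eq: "T.B1 x y k = (\<Sum>l\<in>{1..<k}. t1 l (k - l) (x l) (y (k - l)))"
  unfolding T.B1_def conv_def
  by (rule sum.mono_neutral_right) (auto simp: t1_def)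

lemma s1_bra:
  assumes "s \<in> carrier (gr L 0)" "t \<in> carrier (gr L (- 1))"
  shows "s1 (bra L 0 (- 1) s t) = T.B1 (s0 s) (s1 t)"
proof
  fix k
  show "s1 (bra L 0 (- 1) s t) k = T.B1 (s0 s) (s1 t) k"
  proof (cases "k = 0")
    case False
    have c: "b1 l (k - l) (c0 l s) (c1 (k - l) t) \<in> carrier (V1 k)" if "l \<in> {1..<k}" for l
    proof -
      have l: "1 \<le> l" "1 \<le> k - l" "l + (k - l) = k" using that by auto
      show ?thesis using b1_closed[OF l(1,2) c0_closed[OF l(1) assms(1)] c1_closed[OF l(2) assms(2)]] l(3) by simp
    qed
    have "s1 (bra L 0 (- 1) s t) k = (\<Sum>l\<in>{1..<k}. e1 k (b1 l (k - l) (c0 l s) (c1 (k - l) t)))"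
      using False assms c by (simp add: s1_def c1_bra e1_finsum Pi_def)
    also have "\<dots> = T.B1 (s0 s) (s1 t) k"
      unfolding B1_eq
      by (rule sum.cong) (use assms in \<open>auto simp: t1_def s0_def s1_def p0_e0 p1_e1 c0_closed c1_closed\<close>)
    finally show ?thesis .
  qed (simp add: s1_def B1_eq)
qed

lemma s1_dif:
  assumes "s \<in> carrier (gr L 0)"
  shows "s1 (dif L 0 s) = T.D (s0 s)"
proof
  fix k
  show "s1 (dif L 0 s) k = T.D (s0 s) k"
    using assms \<delta>_pos by (auto simp: s1_def s0_def T.D_def c1_dif td_def p0_e0 c0_closed e1_0)
qed

lemma s1_e1: "t \<in> carrier (gr L (- 1)) \<Longrightarrow> s1 t k = 0 \<longleftrightarrow> k = 0 \<or> c1 k t = \<zero>\<^bsub>V1 k\<^esub>"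
  using e1_eq_iff[of k "c1 k t" "\<zero>\<^bsub>V1 k\<^esub>"] comm_Q_module.axioms(2)[OF Q_module(2), of k]
  by (auto simp: s1_def e1_0 c1_closed Module.module_def abelian_group_def abelian_monoid.zero_closed)

section \<open>Convergent series and the gauge action in components\<close>

lemma filt_s1: "filt L n (- 1) = {t \<in> carrier (gr L (- 1)). \<forall>k<n. s1 t k = 0}"
  unfolding filt_iff by (auto simp: s1_e1 less_eq_Suc_le)

text \<open>Term \<open>n\<close> lives above weight \<open>n\<close>, so weight \<open>k\<close>
  receives only the terms \<open>n < k\<close>. The limit exists because components may be
  prescribed freely, and is unique because an element is determined by its components.\<close>

lemma filt_sum_s1:
  assumes a: "\<And>n. a n \<in> carrier (gr L (- 1))" and low: "\<And>n k. k \<le> n \<Longrightarrow> s1 (a n) k = 0"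
  shows "filt_sum L (- 1) a \<in> carrier (gr L (- 1))"
    and "s1 (filt_sum L (- 1) a) k = (\<Sum>n<k. s1 (a n) k)"
proof -
  let ?P = "\<lambda>s. s \<in> carrier (gr L (- 1)) \<and>
    (\<forall>n. \<exists>N. \<forall>m\<ge>N. s \<ominus>\<^bsub>gr L (- 1)\<^esub> finsum (gr L (- 1)) a {..<m} \<in> filt L n (- 1))"
  have fin: "finsum (gr L (- 1)) a {..<m} \<in> carrier (gr L (- 1))"
    "s1 (finsum (gr L (- 1)) a {..<m}) k = (\<Sum>n<m. s1 (a n) k)" for m k
    using a by (simp_all add: s1_finsum)
  have stable: "(\<Sum>n<m. s1 (a n) k) = (\<Sum>n<k. s1 (a n) k)" if "k \<le> m" for m k
    by (rule sum.mono_neutral_right) (use that low in auto)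
  \<comment> \<open>In weight \<open>k\<close> the limit is taken to be the partial sum up to
    \<open>k\<close>; by \<open>stable\<close> all later partial sums agree with it there.\<close>
  obtain s where s: "s \<in> carrier (gr L (- 1))" "\<And>k. 1 \<le> k \<Longrightarrow> c1 k s = c1 k (finsum (gr L (- 1)) a {..<k})"
    using c1_surj[of "\<lambda>k. c1 k (finsum (gr L (- 1)) a {..<k})"] fin(1) c1_closed by blast
  have s1s: "s1 s k = (\<Sum>n<k. s1 (a n) k)" for k
  proof -
    have "s1 s k = s1 (finsum (gr L (- 1)) a {..<k}) k" using s(2) by (simp add: s1_def)
    then show ?thesis by (simp add: fin)
  qed
  have Ps: "?P s"
  proof (intro conjI allI exI impI)
    fix n m :: nat assume "n \<le> m"
    then show "s \<ominus>\<^bsub>gr L (- 1)\<^esub> finsum (gr L (- 1)) a {..<m} \<in> filt L n (- 1)"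
      using s(1) fin(1) by (auto simp: filt_s1 s1_diff s1s fin(2) stable[where m = m])
  qed (rule s(1))
  have unique: "s' = s" if s': "?P s'" for s'
  proof (rule s1_inj)
    show "s1 s' = s1 s"
    proof
      fix k
      \<comment> \<open>Membership in filtration level \<open>Suc k\<close> is what controls weight
        \<open>k\<close>.\<close>
      obtain N where N: "\<forall>m\<ge>N. s' \<ominus>\<^bsub>gr L (- 1)\<^esub> finsum (gr L (- 1)) a {..<m} \<in> filt L (Suc k) (- 1)"
        using s' by blast
      then have "s' \<ominus>\<^bsub>gr L (- 1)\<^esub> finsum (gr L (- 1)) a {..<max N k} \<in> filt L (Suc k) (- 1)"
        by simp
      then show "s1 s' k = s1 s k"
        using s' fin(1) by (auto simp: filt_s1 s1_diff fin(2) s1s stable[where m = "max N k"])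
    qed
  qed (use s' s(1) in auto)
  have "filt_sum L (- 1) a = s"
    unfolding filt_sum_def by (rule the_equality[of ?P, OF Ps unique])
  then show "filt_sum L (- 1) a \<in> carrier (gr L (- 1))" "s1 (filt_sum L (- 1) a) k = (\<Sum>n<k. s1 (a n) k)"
    by (simp_all add: s(1) s1s)
qed

lemma bra_power:
  assumes "s \<in> carrier (gr L 0)" "t \<in> carrier (gr L (- 1))"
  shows "(bra L 0 (- 1) s ^^ n) t \<in> carrier (gr L (- 1))"
    and "s1 ((bra L 0 (- 1) s ^^ n) t) = (T.B1 (s0 s) ^^ n) (s1 t)"
proof -
  show closed: "(bra L 0 (- 1) s ^^ n) t \<in> carrier (gr L (- 1))" for n
    by (induction n) (simp_all add: assms bra_closed)
  show "s1 ((bra L 0 (- 1) s ^^ n) t) = (T.B1 (s0 s) ^^ n) (s1 t)"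
    by (induction n) (simp_all add: assms closed s1_bra)
qed

lemma B1_power_low: "x 0 = 0 \<Longrightarrow> k \<le> n \<Longrightarrow> (T.B1 g ^^ n) x k = 0"
proof (induction n arbitrary: k)
  case (Suc n)
  show ?case
    unfolding funpow.simps comp_def T.B1_def
    by (rule conv_low[OF T.biadd_b1]) (use Suc in \<open>simp add: T.B1_def\<close>)
qed simp

lemma s1_0: "s1 t 0 = 0"
  by (simp add: s1_def)

lemma exp_ad_s1:
  assumes s: "s \<in> carrier (gr L 0)" and t: "t \<in> carrier (gr L (- 1))"
  shows "exp_ad K L s (- 1) t \<in> carrier (gr L (- 1))"
    and "s1 (exp_ad K L s (- 1) t) k = (\<Sum>n<k. psc (1 / fact n) ((T.B1 (s0 s) ^^ n) (s1 t) k))"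
    and "exp_ad1 K L s (- 1) t \<in> carrier (gr L (- 1))"
    and "s1 (exp_ad1 K L s (- 1) t) k = (\<Sum>n<k. psc (1 / fact (Suc n)) ((T.B1 (s0 s) ^^ n) (s1 t) k))"
proof -
  have inv: "inv_nat K (fact n) = rat_map (1 / fact n)" for n
    by (simp add: inv_nat_eq)
  have car: "rat_map c \<odot>\<^bsub>gr L (- 1)\<^esub> (bra L 0 (- 1) s ^^ n) t \<in> carrier (gr L (- 1))" for c n
    using bra_power(1)[OF s t] by simp
  have val: "s1 (rat_map c \<odot>\<^bsub>gr L (- 1)\<^esub> (bra L 0 (- 1) s ^^ n) t) k = psc c ((T.B1 (s0 s) ^^ n) (s1 t) k)" for c n k
    by (simp add: s1_smult bra_power[OF s t])
  have low: "s1 (rat_map c \<odot>\<^bsub>gr L (- 1)\<^esub> (bra L 0 (- 1) s ^^ n) t) k = 0" if "k \<le> n" for c n k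
    unfolding val by (simp add: B1_power_low s1_0 that)
  show "exp_ad K L s (- 1) t \<in> carrier (gr L (- 1))" "exp_ad1 K L s (- 1) t \<in> carrier (gr L (- 1))"
    unfolding exp_ad_def exp_ad1_def inv by (rule filt_sum_s1(1)[OF car low], assumption)+
  show "s1 (exp_ad K L s (- 1) t) k = (\<Sum>n<k. psc (1 / fact n) ((T.B1 (s0 s) ^^ n) (s1 t) k))"
    "s1 (exp_ad1 K L s (- 1) t) k = (\<Sum>n<k. psc (1 / fact (Suc n)) ((T.B1 (s0 s) ^^ n) (s1 t) k))"
    unfolding exp_ad_def exp_ad1_def inv by (subst filt_sum_s1(2)[OF car low], assumption, simp only: val)+
qed

text \<open>The identification of the exponential formula with the abstract flow: both are finite
  sums in each weight, and the summands agree by \<open>orbit_powers\<close>.\<close>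

lemma s1_gauge:
  assumes s: "s \<in> carrier (gr L 0)" and t: "t \<in> carrier (gr L (- 1))"
  shows "gauge K L s t \<in> carrier (gr L (- 1))"
    and "s1 (gauge K L s t) = T.flow (T.B1 (s0 s)) (T.D (s0 s)) (s1 t)"
proof -
  note e = exp_ad_s1[OF s t] exp_ad_s1[OF s dif_closed[OF s]]
  show "gauge K L s t \<in> carrier (gr L (- 1))"
    unfolding gauge_def using e by (simp add: gr1.M.minus_eq)
  show "s1 (gauge K L s t) = T.flow (T.B1 (s0 s)) (T.D (s0 s)) (s1 t)"
  proof
    fix k
    have "s1 (gauge K L s t) k = (\<Sum>n<k. psc (1 / fact n) ((T.B1 (s0 s) ^^ n) (s1 t) k))
        - (\<Sum>n<k. psc (1 / fact (Suc n)) ((T.B1 (s0 s) ^^ n) (T.D (s0 s)) k))"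
      unfolding gauge_def by (simp add: s1_diff e s1_dif s del: fact_Suc)
    also have "(\<Sum>n<k. psc (1 / fact n) ((T.B1 (s0 s) ^^ n) (s1 t) k)) =
        (\<Sum>n\<le>k. psc (1 / fact n) ((T.B1 (s0 s) ^^ n) (s1 t) k))"
      by (rule sum.mono_neutral_left) (auto simp: B1_power_low s1_0 not_less)
    \<comment> \<open>The coefficient 1/(n+1)! of ad^n is re-indexed as 1/n! of ad^{n-1}, which is
      how \<open>w\<close> occurs in the n-th orbit term.\<close>
    also have "(\<Sum>n<k. psc (1 / fact (Suc n)) ((T.B1 (s0 s) ^^ n) (T.D (s0 s)) k)) =
        (\<Sum>n\<le>k. if n = 0 then 0 else psc (1 / fact n) ((T.B1 (s0 s) ^^ (n - 1)) (T.D (s0 s)) k))"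
      by (subst sum.atMost_shift) (simp del: fact_Suc)
    also have "(\<Sum>n\<le>k. psc (1 / fact n) ((T.B1 (s0 s) ^^ n) (s1 t) k)) -
        (\<Sum>n\<le>k. if n = 0 then 0 else psc (1 / fact n) ((T.B1 (s0 s) ^^ (n - 1)) (T.D (s0 s)) k)) =
        T.flow (T.B1 (s0 s)) (T.D (s0 s)) (s1 t) k"
      unfolding T.flow_def sum_subtractf[symmetric]
    proof (rule sum.cong[OF refl])
      fix n
      have A: "additive (T.B1 (s0 s))" by (simp add: additive_def T.B1_simps)
      have S: "T.B1 (s0 s) (\<lambda>k. psc c (x k)) = (\<lambda>k. psc c (T.B1 (s0 s) x k))" for c x
        using T.S_commute(6)[of "s0 s" c x] by (simp add: T.S_def[abs_def] fun_eq_iff)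
      show "psc (1 / fact n) ((T.B1 (s0 s) ^^ n) (s1 t) k) -
          (if n = 0 then 0 else psc (1 / fact n) ((T.B1 (s0 s) ^^ (n - 1)) (T.D (s0 s)) k)) =
          orbit psc (T.B1 (s0 s)) (T.D (s0 s)) (s1 t) n k"
        by (rule orbit_powers[OF psc.vector_space_axioms A S, symmetric])
    qed
    finally show "s1 (gauge K L s t) k = T.flow (T.B1 (s0 s)) (T.D (s0 s)) (s1 t) k" .
  qed
qed

text \<open>\<open>res\<close> written with the module operations on genuine components. It is meant
  for k > \<delta>, where the natural subtraction is a true one.\<close>

definition residual where
  "residual u f k = [(k - \<delta>)] \<cdot>\<^bsub>V1 k\<^esub> f k \<ominus>\<^bsub>V1 k\<^esub> d (k - \<delta>) (u (k - \<delta>)) \<oplus>\<^bsub>V1 k\<^esub>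
     finsum (V1 k) (\<lambda>l. b1 l (k - l) (u l) (f (k - l))) {1..<k}"

definition up where "up u k = (if k = 0 then 0 else e0 k (u k))"

lemma residual_res:
  assumes u: "\<And>k. 1 \<le> k \<Longrightarrow> u k \<in> carrier (V0 k)" and t: "t \<in> carrier (gr L (- 1))" and k: "\<delta> < k"
  shows "residual u (\<lambda>k. c1 k t) k \<in> carrier (V1 k)"
    and "e1 k (residual u (\<lambda>k. c1 k t) k) = T.res (up u) (s1 t) k"
proof -
  have k1: "1 \<le> k" "1 \<le> k - \<delta>" "k - \<delta> + \<delta> = k" using k by auto
  interpret V: comm_Q_module K "V1 k" by (rule Q_module(2)[OF k1(1)])
  let ?s = "\<lambda>l. b1 l (k - l) (u l) (c1 (k - l) t)"
  have ck: "c1 k t \<in> carrier (V1 k)" by (rule c1_closed[OF k1(1) t])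
  have dk: "d (k - \<delta>) (u (k - \<delta>)) \<in> carrier (V1 k)"
    using d_closed[OF k1(2) u[OF k1(2)]] k1(3) by simp
  have bk: "?s l \<in> carrier (V1 k)" if "l \<in> {1..<k}" for l
  proof -
    have l: "1 \<le> l" "1 \<le> k - l" "l + (k - l) = k" using that by auto
    show ?thesis using b1_closed[OF l(1,2) u[OF l(1)] c1_closed[OF l(2) t]] l(3) by simp
  qed
  have pw: "[(k - \<delta>)] \<cdot>\<^bsub>V1 k\<^esub> c1 k t = rat_map (of_nat (k - \<delta>)) \<odot>\<^bsub>V1 k\<^esub> c1 k t"
    by (rule add_pow_smult[OF V1_module[OF k1(1)] ck])
  have fs: "finsum (V1 k) ?s {1..<k} \<in> carrier (V1 k)"
    by (rule V.M.finsum_closed) (use bk in auto)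
  show "residual u (\<lambda>k. c1 k t) k \<in> carrier (V1 k)"
    unfolding residual_def pw using ck dk fs by simp
  define F where "F = finsum (V1 k) ?s {1..<k}"
  have "e1 k (residual u (\<lambda>k. c1 k t) k) =
      psc (of_nat (k - \<delta>)) (e1 k (c1 k t)) - e1 k (d (k - \<delta>) (u (k - \<delta>))) + e1 k F"
    using fs unfolding residual_def pw F_def[symmetric]
    by (simp add: e1_add[OF k1(1)] e1_diff[OF k1(1)] e1_smult[OF k1(1)] ck dk)
  also have "e1 k F = (\<Sum>l\<in>{1..<k}. e1 k (?s l))"
    unfolding F_def by (rule e1_finsum[OF k1(1)]) (use bk in auto)
  also have "\<dots> = T.B1 (up u) (s1 t) k"
    unfolding B1_eq
    by (rule sum.cong) (use t in \<open>auto simp: t1_def up_def s1_def p0_e0 p1_e1 u c1_closed\<close>)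
  also have "e1 k (d (k - \<delta>) (u (k - \<delta>))) = T.D (up u) k"
    using k by (auto simp: T.D_def td_def up_def p0_e0 u)
  also have "psc (of_nat (k - \<delta>)) (e1 k (c1 k t)) = T.E (s1 t) k - T.S (of_nat \<delta>) (s1 t) k"
    using k by (simp add: T.E_def T.S_def s1_def of_nat_diff psc.scale_left_diff_distrib)
  finally show "e1 k (residual u (\<lambda>k. c1 k t) k) = T.res (up u) (s1 t) k"
    by (simp add: T.res_def)
qed

text \<open>The transported operations see \<open>x k\<close> only through its realization. So a
  solution found in the rational vector space can be replaced by one that comes from genuine
  components.\<close>

lemma up_p0:
  shows "T.B1 (up (\<lambda>k. p0 k (x k))) y = T.B1 x y" "T.D (up (\<lambda>k. p0 k (x k))) = T.D x"
    "T.res (up (\<lambda>k. p0 k (x k))) y = T.res x y"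
proof -
  show B: "T.B1 (up (\<lambda>k. p0 k (x k))) y = T.B1 x y"
    unfolding B1_eq fun_eq_iff by (auto simp: up_def t1_def p0_e0 p0_closed intro!: sum.cong)
  show D: "T.D (up (\<lambda>k. p0 k (x k))) = T.D x"
    by (auto simp: T.D_def up_def td_def fun_eq_iff p0_e0 p0_closed)
  show "T.res (up (\<lambda>k. p0 k (x k))) y = T.res x y"
    by (simp add: T.res_def B D)
qed

lemma s1_low:
  assumes "t \<in> carrier (gr L (- 1))" "\<And>k. \<lbrakk>1 \<le> k; k < \<delta>\<rbrakk> \<Longrightarrow> c1 k t = \<zero>\<^bsub>V1 k\<^esub>" "k < \<delta>"
  shows "s1 t k = 0"
  using assms by (cases "k = 0") (auto simp: s1_e1)

text \<open>In weights up to \<delta> the abstract residual is zero by \<open>res_low\<close>; above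
  \<delta> the embedding is injective.\<close>

lemma residual_zero_iff:
  assumes u: "\<And>k. 1 \<le> k \<Longrightarrow> u k \<in> carrier (V0 k)" and t: "t \<in> carrier (gr L (- 1))"
    and low: "\<And>k. \<lbrakk>1 \<le> k; k < \<delta>\<rbrakk> \<Longrightarrow> c1 k t = \<zero>\<^bsub>V1 k\<^esub>"
  shows "(\<forall>k<N. T.res (up u) (s1 t) k = 0) \<longleftrightarrow> (\<forall>k. \<delta> < k \<and> k < N \<longrightarrow> residual u (\<lambda>k. c1 k t) k = \<zero>\<^bsub>V1 k\<^esub>)"
proof -
  have small: "T.res (up u) (s1 t) k = 0" if "k \<le> \<delta>" for k
    by (rule T.res_low[OF _ that]) (rule s1_low[OF t low])
  have "T.res (up u) (s1 t) k = 0 \<longleftrightarrow> residual u (\<lambda>k. c1 k t) k = \<zero>\<^bsub>V1 k\<^esub>" if "\<delta> < k" for k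
  proof -
    interpret V: comm_Q_module K "V1 k" by (rule Q_module(2)) (use that in simp)
    show ?thesis
      using residual_res[OF u t that] e1_eq_iff[of k "residual u (\<lambda>k. c1 k t) k" "\<zero>\<^bsub>V1 k\<^esub>"] e1_0[of k] that by auto
  qed
  with small show ?thesis
    by (auto simp: linorder_not_less[symmetric])
qed

text \<open>The equation [E + u, d + t] = \<delta> (d + t) in components. It is the middle term
  through which gauge triviality, the Kaledin class and base change are compared.\<close>

definition solution where
  "solution t u \<longleftrightarrow> (\<forall>k\<ge>1. u k \<in> carrier (V0 k)) \<and> (\<forall>k>\<delta>. residual u (\<lambda>k. c1 k t) k = \<zero>\<^bsub>V1 k\<^esub>)"

lemma solution_iff:
  assumes t: "t \<in> carrier (gr L (- 1))" and low: "\<And>k. \<lbrakk>1 \<le> k; k < \<delta>\<rbrakk> \<Longrightarrow> c1 k t = \<zero>\<^bsub>V1 k\<^esub>"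
  shows "(\<exists>u. solution t u) \<longleftrightarrow> (\<exists>u. T.res u (s1 t) = 0)"
proof
  assume "\<exists>u. solution t u"
  then obtain u where u: "\<And>k. 1 \<le> k \<Longrightarrow> u k \<in> carrier (V0 k)" "\<And>k. \<delta> < k \<Longrightarrow> residual u (\<lambda>k. c1 k t) k = \<zero>\<^bsub>V1 k\<^esub>"
    by (auto simp: solution_def)
  then have "T.res (up u) (s1 t) k = 0" for k
    using residual_zero_iff[OF u(1) t low, of "Suc k"] by auto
  then show "\<exists>u. T.res u (s1 t) = 0" by (auto simp: fun_eq_iff)
next
  assume "\<exists>u. T.res u (s1 t) = 0"
  then obtain u where u: "T.res u (s1 t) = 0" by blast
  have cl: "p0 k (u k) \<in> carrier (V0 k)" if "1 \<le> k" for k by (rule p0_closed[OF that])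
  have "T.res (up (\<lambda>k. p0 k (u k))) (s1 t) k = 0" for k
    unfolding up_p0 u by simp
  then have "residual (\<lambda>k. p0 k (u k)) (\<lambda>k. c1 k t) k = \<zero>\<^bsub>V1 k\<^esub>" if "\<delta> < k" for k
    using residual_zero_iff[of "\<lambda>k. p0 k (u k)", OF cl t low, of "Suc k"] that by auto
  then show "\<exists>u. solution t u"
    unfolding solution_def using cl by (intro exI[of _ "\<lambda>k. p0 k (u k)"] conjI allI impI)
qed

lemma s1_lead:
  assumes "s \<in> carrier (gr L (- 1))" "t \<in> carrier (gr L (- 1))"
    and "\<And>k. 1 \<le> k \<Longrightarrow> c1 k s = (if k = \<delta> then c1 k t else \<zero>\<^bsub>V1 k\<^esub>)"
  shows "s1 s = T.lead (s1 t)"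
  using assms \<delta>_pos by (auto simp: fun_eq_iff s1_def T.lead_def e1_0)

theorem gauge_solution_iff:
  assumes t: "t \<in> carrier (gr L (- 1))" and low: "\<And>k. \<lbrakk>1 \<le> k; k < \<delta>\<rbrakk> \<Longrightarrow> c1 k t = \<zero>\<^bsub>V1 k\<^esub>"
    and s: "s \<in> carrier (gr L (- 1))" "\<And>k. 1 \<le> k \<Longrightarrow> c1 k s = (if k = \<delta> then c1 k t else \<zero>\<^bsub>V1 k\<^esub>)"
  shows "(\<exists>g\<in>carrier (gr L 0). gauge K L g t = s) \<longleftrightarrow> (\<exists>u. solution t u)"
proof -
  have "(\<exists>g\<in>carrier (gr L 0). gauge K L g t = s) \<longleftrightarrow> (\<exists>g. T.flow (T.B1 g) (T.D g) (s1 t) = T.lead (s1 t))"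
  proof
    assume "\<exists>g\<in>carrier (gr L 0). gauge K L g t = s"
    then obtain g where g: "g \<in> carrier (gr L 0)" "gauge K L g t = s" by blast
    then have "T.flow (T.B1 (s0 g)) (T.D (s0 g)) (s1 t) = T.lead (s1 t)"
      using s1_gauge(2)[OF g(1) t] s1_lead[OF s(1) t s(2)] by simp
    then show "\<exists>g. T.flow (T.B1 g) (T.D g) (s1 t) = T.lead (s1 t)" by blast
  next
    assume "\<exists>g. T.flow (T.B1 g) (T.D g) (s1 t) = T.lead (s1 t)"
    then obtain g where g: "T.flow (T.B1 g) (T.D g) (s1 t) = T.lead (s1 t)" by blast
    \<comment> \<open>\<open>g\<close> lies only in the rational vector space. Its realizations are
      the components of an actual element \<open>h\<close>, and the operations cannot tell the two
      apart.\<close>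
    obtain h where h: "h \<in> carrier (gr L 0)" "\<forall>k\<ge>1. c0 k h = p0 k (g k)"
      using c0_surj[of "\<lambda>k. p0 k (g k)"] p0_closed by blast
    then have h0: "s0 h = up (\<lambda>k. p0 k (g k))" by (auto simp: s0_def up_def)
    have "T.B1 (s0 h) = T.B1 g" "T.D (s0 h) = T.D g"
      unfolding h0 up_p0(2) by (rule ext, rule up_p0(1)) simp
    then have "s1 (gauge K L h t) = s1 s"
      using s1_gauge(2)[OF h(1) t] g s1_lead[OF s(1) t s(2)] by simp
    then show "\<exists>g\<in>carrier (gr L 0). gauge K L g t = s"
      using s1_inj[OF s1_gauge(1)[OF h(1) t] s(1)] h(1) by blast
  qed
  also have "\<dots> \<longleftrightarrow> (\<exists>u. T.res u (s1 t) = 0)"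
    by (rule T.gauge_lead_iff) (rule s1_low[OF t low])
  finally show ?thesis by (simp only: solution_iff[OF t low])
qed

theorem solution_if_gauge_from_lead:
  assumes t: "t \<in> carrier (gr L (- 1))" and low: "\<And>k. \<lbrakk>1 \<le> k; k < \<delta>\<rbrakk> \<Longrightarrow> c1 k t = \<zero>\<^bsub>V1 k\<^esub>"
    and s: "s \<in> carrier (gr L (- 1))" "\<And>k. 1 \<le> k \<Longrightarrow> c1 k s = (if k = \<delta> then c1 k t else \<zero>\<^bsub>V1 k\<^esub>)"
    and g: "g \<in> carrier (gr L 0)" "gauge K L g s = t"
  shows "\<exists>u. solution t u"
proof -
  have "T.flow (T.B1 (s0 g)) (T.D (s0 g)) (T.lead (s1 t)) = s1 t"
    using s1_gauge(2)[OF g(1) s(1)] g(2) s1_lead[OF s(1) t s(2)] by simp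
  then show ?thesis
    using T.lead_gauge solution_iff[OF t low] by blast
qed

text \<open>Here \<open>d n v\<close> minus the bracket of \<open>v\<close> with the leading
  component \<psi> is the twisted differential of \<open>v\<close>, since [\<psi>, v] = -[v, \<psi>]
  for \<open>v\<close> of degree 0.\<close>

lemma e1_twisted:
  assumes "1 \<le> n" "v \<in> carrier (V0 n)" "t \<in> carrier (gr L (- 1))"
  shows "d n v \<ominus>\<^bsub>V1 (n + \<delta>)\<^esub> b1 n \<delta> v (c1 \<delta> t) \<in> carrier (V1 (n + \<delta>))"
    and "e1 (n + \<delta>) (d n v \<ominus>\<^bsub>V1 (n + \<delta>)\<^esub> b1 n \<delta> v (c1 \<delta> t)) = td n (e0 n v) - t1 n \<delta> (e0 n v) (s1 t \<delta>)"
proof -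
  have k: "1 \<le> n + \<delta>" using assms by simp
  interpret V: comm_Q_module K "V1 (n + \<delta>)" by (rule Q_module(2)[OF k])
  have c: "d n v \<in> carrier (V1 (n + \<delta>))" "b1 n \<delta> v (c1 \<delta> t) \<in> carrier (V1 (n + \<delta>))"
    using assms \<delta>_pos by (simp_all add: d_closed b1_closed c1_closed)
  then show "d n v \<ominus>\<^bsub>V1 (n + \<delta>)\<^esub> b1 n \<delta> v (c1 \<delta> t) \<in> carrier (V1 (n + \<delta>))" by simp
  show "e1 (n + \<delta>) (d n v \<ominus>\<^bsub>V1 (n + \<delta>)\<^esub> b1 n \<delta> v (c1 \<delta> t)) = td n (e0 n v) - t1 n \<delta> (e0 n v) (s1 t \<delta>)"
    using assms \<delta>_pos c by (simp add: e1_diff td_def t1_def s1_def p0_e0 p1_e1 c1_closed)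
qed

lemma residual_twisted_iff:
  assumes t: "t \<in> carrier (gr L (- 1))" and u: "\<And>k. 1 \<le> k \<Longrightarrow> u k \<in> carrier (V0 k)" and n: "1 \<le> n"
  shows "(\<exists>v\<in>carrier (V0 n). residual u (\<lambda>k. c1 k t) (n + \<delta>) = d n v \<ominus>\<^bsub>V1 (n + \<delta>)\<^esub> b1 n \<delta> v (c1 \<delta> t))
    \<longleftrightarrow> (\<exists>v. T.res (up u) (s1 t) (n + \<delta>) = td n v - t1 n \<delta> v (s1 t \<delta>))"
proof -
  have k: "\<delta> < n + \<delta>" "1 \<le> n + \<delta>" using n by auto
  have v: "(residual u (\<lambda>k. c1 k t) (n + \<delta>) = d n v \<ominus>\<^bsub>V1 (n + \<delta>)\<^esub> b1 n \<delta> v (c1 \<delta> t)) \<longleftrightarrow>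
      T.res (up u) (s1 t) (n + \<delta>) = td n (e0 n v) - t1 n \<delta> (e0 n v) (s1 t \<delta>)" if "v \<in> carrier (V0 n)" for v
    using e1_eq_iff[OF k(2) residual_res(1)[OF u t k(1)] e1_twisted(1)[OF n that t]]
    by (simp add: residual_res(2)[OF u t k(1)] e1_twisted(2)[OF n that t])
  have "td n x = td n (e0 n (p0 n x))" "t1 n \<delta> x y = t1 n \<delta> (e0 n (p0 n x)) y" for x y
    using n by (simp_all add: td_def t1_def p0_e0 p0_closed)
  note td = this
  show ?thesis
  proof
    assume "\<exists>v. T.res (up u) (s1 t) (n + \<delta>) = td n v - t1 n \<delta> v (s1 t \<delta>)"
    then obtain w where "T.res (up u) (s1 t) (n + \<delta>) = td n w - t1 n \<delta> w (s1 t \<delta>)" by blast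
    then have "T.res (up u) (s1 t) (n + \<delta>) = td n (e0 n (p0 n w)) - t1 n \<delta> (e0 n (p0 n w)) (s1 t \<delta>)"
      by (simp only: td[symmetric])
    then show "\<exists>v\<in>carrier (V0 n). residual u (\<lambda>k. c1 k t) (n + \<delta>) = d n v \<ominus>\<^bsub>V1 (n + \<delta>)\<^esub> b1 n \<delta> v (c1 \<delta> t)"
      using v[OF p0_closed[OF n]] p0_closed[OF n] by blast
  qed (use v in blast)
qed

theorem leading_residual_exact:
  assumes t: "t \<in> carrier (gr L (- 1))" and low: "\<And>k. \<lbrakk>1 \<le> k; k < \<delta>\<rbrakk> \<Longrightarrow> c1 k t = \<zero>\<^bsub>V1 k\<^esub>"
    and U: "solution t U" and u: "\<And>k. 1 \<le> k \<Longrightarrow> u k \<in> carrier (V0 k)" and n: "1 \<le> n"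
    and res: "\<And>k. \<lbrakk>\<delta> < k; k < n + \<delta>\<rbrakk> \<Longrightarrow> residual u (\<lambda>k. c1 k t) k = \<zero>\<^bsub>V1 k\<^esub>"
  shows "\<exists>v\<in>carrier (V0 n). residual u (\<lambda>k. c1 k t) (n + \<delta>) = d n v \<ominus>\<^bsub>V1 (n + \<delta>)\<^esub> b1 n \<delta> v (c1 \<delta> t)"
proof -
  obtain V where V: "T.res V (s1 t) = 0" using solution_iff[OF t low] U by blast
  have "\<forall>k<n + \<delta>. T.res (up u) (s1 t) k = 0"
    by (rule residual_zero_iff[THEN iffD2]) (use u t low res in auto)
  then have "\<exists>v. T.res (up u) (s1 t) (n + \<delta>) = td n v - t1 n \<delta> v (s1 t \<delta>)"
    by (intro T.lead_residue_exact[OF s1_low[OF t low] V _ n]) auto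
  then show ?thesis using u by (intro residual_twisted_iff[OF t _ n, THEN iffD2])
qed

theorem solution_stepwise:
  assumes t: "t \<in> carrier (gr L (- 1))" and low: "\<And>k. \<lbrakk>1 \<le> k; k < \<delta>\<rbrakk> \<Longrightarrow> c1 k t = \<zero>\<^bsub>V1 k\<^esub>"
    and step: "\<And>n u. \<lbrakk>1 \<le> n; \<And>k. 1 \<le> k \<Longrightarrow> u k \<in> carrier (V0 k);
      \<And>k. \<lbrakk>\<delta> < k; k < n + \<delta>\<rbrakk> \<Longrightarrow> residual u (\<lambda>k. c1 k t) k = \<zero>\<^bsub>V1 k\<^esub>\<rbrakk> \<Longrightarrow>
      \<exists>v\<in>carrier (V0 n). residual u (\<lambda>k. c1 k t) (n + \<delta>) = d n v \<ominus>\<^bsub>V1 (n + \<delta>)\<^esub> b1 n \<delta> v (c1 \<delta> t)"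
  shows "\<exists>u. solution t u"
proof -
  have "\<exists>u. T.res u (s1 t) = 0"
  proof (rule T.stepwise_solution)
    show "s1 t j = 0" if "j < \<delta>" for j by (rule s1_low[OF t low that])
    fix n u assume n: "1 \<le> n" and u: "\<And>j. j < n + \<delta> \<Longrightarrow> T.res u (s1 t) j = 0"
    have cl: "p0 k (u k) \<in> carrier (V0 k)" if "1 \<le> k" for k by (rule p0_closed[OF that])
    have "\<forall>k<n + \<delta>. T.res (up (\<lambda>k. p0 k (u k))) (s1 t) k = 0"
      unfolding up_p0 using u by blast
    then have "residual (\<lambda>k. p0 k (u k)) (\<lambda>k. c1 k t) k = \<zero>\<^bsub>V1 k\<^esub>" if "\<delta> < k" "k < n + \<delta>" for k
      using residual_zero_iff[of "\<lambda>k. p0 k (u k)", OF cl t low, THEN iffD1] that by simp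
    then have "\<exists>v\<in>carrier (V0 n). residual (\<lambda>k. p0 k (u k)) (\<lambda>k. c1 k t) (n + \<delta>) =
        d n v \<ominus>\<^bsub>V1 (n + \<delta>)\<^esub> b1 n \<delta> v (c1 \<delta> t)"
      by (intro step[of n "\<lambda>k. p0 k (u k)"] n cl)
    then show "\<exists>v. T.res u (s1 t) (n + \<delta>) = td n v - t1 n \<delta> v (s1 t \<delta>)"
      using residual_twisted_iff[of t "\<lambda>k. p0 k (u k)", OF t cl n] unfolding up_p0 by (rule_tac iffD1)
  qed
  then show ?thesis using solution_iff[OF t low] by blast
qed

end

section \<open>The weight-graded dg Lie algebra\<close>

text \<open>Stated for additive rather than linear maps, because it is also applied to
  \<open>x \<mapsto> x \<otimes> 1\<close>, whose source and target are modules over different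
  rings.\<close>

lemma additive_hom_props:
  assumes f: "f \<in> carrier M \<rightarrow> carrier N" and M: "abelian_group M" and N: "abelian_group N"
    and add: "\<And>x y. \<lbrakk>x \<in> carrier M; y \<in> carrier M\<rbrakk> \<Longrightarrow> f (x \<oplus>\<^bsub>M\<^esub> y) = f x \<oplus>\<^bsub>N\<^esub> f y"
  shows additive_hom_zero: "f \<zero>\<^bsub>M\<^esub> = \<zero>\<^bsub>N\<^esub>"
    and additive_hom_uminus: "x \<in> carrier M \<Longrightarrow> f (\<ominus>\<^bsub>M\<^esub> x) = \<ominus>\<^bsub>N\<^esub> f x"
    and additive_hom_minus: "\<lbrakk>x \<in> carrier M; y \<in> carrier M\<rbrakk> \<Longrightarrow> f (x \<ominus>\<^bsub>M\<^esub> y) = f x \<ominus>\<^bsub>N\<^esub> f y"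
    and additive_hom_finsum: "g \<in> A \<rightarrow> carrier M \<Longrightarrow> f (finsum M g A) = finsum N (\<lambda>i. f (g i)) A"
    and additive_hom_add_pow: "x \<in> carrier M \<Longrightarrow> f ([(n::nat)] \<cdot>\<^bsub>M\<^esub> x) = [n] \<cdot>\<^bsub>N\<^esub> f x"
proof -
  interpret M: abelian_group M by fact
  interpret N: abelian_group N by fact
  have cl: "f x \<in> carrier N" if "x \<in> carrier M" for x using f that by auto
  show zero: "f \<zero>\<^bsub>M\<^esub> = \<zero>\<^bsub>N\<^esub>"
    using add[of "\<zero>\<^bsub>M\<^esub>" "\<zero>\<^bsub>M\<^esub>"] cl[of "\<zero>\<^bsub>M\<^esub>"] by simp
  show minus: "f (\<ominus>\<^bsub>M\<^esub> x) = \<ominus>\<^bsub>N\<^esub> f x" if "x \<in> carrier M" for x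
    using add[of "\<ominus>\<^bsub>M\<^esub> x" x] that cl zero by (simp add: M.l_neg N.minus_equality)
  show "f (x \<ominus>\<^bsub>M\<^esub> y) = f x \<ominus>\<^bsub>N\<^esub> f y" if "x \<in> carrier M" "y \<in> carrier M" for x y
    using that by (simp add: a_minus_def add minus)
  show "f (finsum M g A) = finsum N (\<lambda>i. f (g i)) A" if "g \<in> A \<rightarrow> carrier M"
    using that
  proof (induction A rule: infinite_finite_induct)
    case (insert i A)
    then show ?case by (simp add: Pi_def add cl)
  qed (simp_all add: zero M.finsum_infinite N.finsum_infinite)
  show "f ([n] \<cdot>\<^bsub>M\<^esub> x) = [n] \<cdot>\<^bsub>N\<^esub> f x" if "x \<in> carrier M"
    by (induction n) (simp_all add: that zero add cl M.add.nat_pow_Suc N.add.nat_pow_Suc)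
qed

lemma lin_maps_props:
  assumes f: "f \<in> lin_maps R M N" and M: "Module.module R M" and N: "Module.module R N"
  shows lin_maps_closed: "x \<in> carrier M \<Longrightarrow> f x \<in> carrier N"
    and lin_maps_add: "\<lbrakk>x \<in> carrier M; y \<in> carrier M\<rbrakk> \<Longrightarrow> f (x \<oplus>\<^bsub>M\<^esub> y) = f x \<oplus>\<^bsub>N\<^esub> f y"
    and lin_maps_zero: "f \<zero>\<^bsub>M\<^esub> = \<zero>\<^bsub>N\<^esub>"
    and lin_maps_minus: "x \<in> carrier M \<Longrightarrow> f (\<ominus>\<^bsub>M\<^esub> x) = \<ominus>\<^bsub>N\<^esub> f x"
    and lin_maps_finsum: "g \<in> A \<rightarrow> carrier M \<Longrightarrow> f (finsum M g A) = finsum N (\<lambda>i. f (g i)) A"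
proof -
  interpret M: Module.module R M by fact
  interpret N: Module.module R N by fact
  show cl: "f x \<in> carrier N" if "x \<in> carrier M" for x
    using f that by (auto simp: lin_maps_def)
  show add: "f (x \<oplus>\<^bsub>M\<^esub> y) = f x \<oplus>\<^bsub>N\<^esub> f y" if "x \<in> carrier M" "y \<in> carrier M" for x y
    using f that by (simp add: lin_maps_def)
  have fM: "f \<in> carrier M \<rightarrow> carrier N" using cl by blast
  note hom = additive_hom_props[OF fM M.M.abelian_group_axioms N.M.abelian_group_axioms add]
  show "f \<zero>\<^bsub>M\<^esub> = \<zero>\<^bsub>N\<^esub>" by (rule hom(1))
  show "f (\<ominus>\<^bsub>M\<^esub> x) = \<ominus>\<^bsub>N\<^esub> f x" if "x \<in> carrier M" for x
    by (rule hom(2)) (use that in simp_all)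
  show "f (finsum M g A) = finsum N (\<lambda>i. f (g i)) A" if "g \<in> A \<rightarrow> carrier M"
    by (rule hom(4)) (use that in simp_all)
qed

text \<open>Negatives and finite sums are defined through the carrier of the record, so restricting
  the carrier could change them; natural multiples refer to addition and zero only.\<close>

lemma submodule_ops:
  assumes M: "Module.module R M" and H: "submodule H R M"
  shows submodule_minus: "y \<in> H \<Longrightarrow> x \<ominus>\<^bsub>M\<lparr>carrier := H\<rparr>\<^esub> y = x \<ominus>\<^bsub>M\<^esub> y"
    and submodule_finsum: "f \<in> A \<rightarrow> H \<Longrightarrow> finsum (M\<lparr>carrier := H\<rparr>) f A = finsum M f A"
    and submodule_add_pow: "[(n::nat)] \<cdot>\<^bsub>M\<lparr>carrier := H\<rparr>\<^esub> x = [n] \<cdot>\<^bsub>M\<^esub> x"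
proof -
  interpret M: Module.module R M by fact
  interpret H: Module.module R "M\<lparr>carrier := H\<rparr>" by (rule submodule.submodule_is_module[OF H M])
  have sub: "H \<subseteq> carrier M" using M.submoduleE(1)[OF H] .
  have inv: "\<ominus>\<^bsub>M\<lparr>carrier := H\<rparr>\<^esub> y = \<ominus>\<^bsub>M\<^esub> y" if "y \<in> H" for y
  proof (rule M.M.minus_equality[symmetric])
    show "\<ominus>\<^bsub>M\<lparr>carrier := H\<rparr>\<^esub> y \<oplus>\<^bsub>M\<^esub> y = \<zero>\<^bsub>M\<^esub>" using H.M.l_neg[of y] that by simp
    show "\<ominus>\<^bsub>M\<lparr>carrier := H\<rparr>\<^esub> y \<in> carrier M" "y \<in> carrier M" using H.M.a_inv_closed[of y] that sub by auto
  qed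
  show "x \<ominus>\<^bsub>M\<lparr>carrier := H\<rparr>\<^esub> y = x \<ominus>\<^bsub>M\<^esub> y" if "y \<in> H"
    using inv[OF that] by (simp add: a_minus_def)
  show "finsum (M\<lparr>carrier := H\<rparr>) f A = finsum M f A" if "f \<in> A \<rightarrow> H"
    using that
  proof (induction A rule: infinite_finite_induct)
    case (insert i A)
    then have "f \<in> A \<rightarrow> carrier M" "f i \<in> carrier M" using sub by auto
    with insert show ?case by (simp add: Pi_def)
  qed (simp_all add: H.M.finsum_infinite M.M.finsum_infinite)
  show "[n] \<cdot>\<^bsub>M\<lparr>carrier := H\<rparr>\<^esub> x = [n] \<cdot>\<^bsub>M\<^esub> x"
    by (simp add: add_pow_def nat_pow_def)
qed

locale weight_graded_Q = weight_graded_dg_lie_algebra R \<delta> L + comm_Q_algebra R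
  for R :: "'r ring" and \<delta> :: nat and L :: "('r, 'g, 'z) wdgla_scheme" +
  assumes \<delta>_pos: "1 \<le> \<delta>"
begin

lemma gr_Q: "comm_Q_module R (gr L i)"
  by (intro comm_Q_module.intro comm_Q_algebra_axioms gr_module)

sublocale G: comm_Q_module R "gr L i" for i by (rule gr_Q)

lemma wt_subset: "1 \<le> k \<Longrightarrow> wt L i k \<subseteq> carrier (gr L i)"
  using G.submoduleE(1)[OF wt_submodule] .

lemma wt_carrier: "1 \<le> k \<Longrightarrow> x \<in> wt L i k \<Longrightarrow> x \<in> carrier (gr L i)"
  using wt_subset by blast

lemma wt_module_module: "1 \<le> k \<Longrightarrow> Module.module R (wt_module L i k)"
  unfolding wt_module_def by (rule submodule.submodule_is_module[OF wt_submodule gr_module])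

lemma wt_module_simps [simp]:
  "carrier (wt_module L i k) = wt L i k" "add (wt_module L i k) = add (gr L i)"
  "\<zero>\<^bsub>wt_module L i k\<^esub> = \<zero>\<^bsub>gr L i\<^esub>" "smult (wt_module L i k) = smult (gr L i)"
  by (simp_all add: wt_module_def)

lemma wt_module_minus: "\<lbrakk>1 \<le> k; y \<in> wt L i k\<rbrakk> \<Longrightarrow> x \<ominus>\<^bsub>wt_module L i k\<^esub> y = x \<ominus>\<^bsub>gr L i\<^esub> y"
  unfolding wt_module_def by (rule submodule_minus[OF gr_module wt_submodule])

lemma wt_module_finsum: "\<lbrakk>1 \<le> k; f \<in> A \<rightarrow> wt L i k\<rbrakk> \<Longrightarrow> finsum (wt_module L i k) f A = finsum (gr L i) f A"
  unfolding wt_module_def by (rule submodule_finsum[OF gr_module wt_submodule])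

lemma wt_module_add_pow: "1 \<le> k \<Longrightarrow> [(n::nat)] \<cdot>\<^bsub>wt_module L i k\<^esub> x = [n] \<cdot>\<^bsub>gr L i\<^esub> x"
  unfolding wt_module_def by (rule submodule_add_pow[OF gr_module wt_submodule])

lemma wproj_wt: "\<lbrakk>1 \<le> k; x \<in> carrier (gr L i)\<rbrakk> \<Longrightarrow> wproj L i k x \<in> wt L i k"
  using wproj_linear[of k i] by (auto simp: lin_maps_def)

lemma wproj_gr_linear: "1 \<le> k \<Longrightarrow> wproj L i k \<in> lin_maps R (gr L i) (gr L i)"
  using wproj_linear[of k i] wt_carrier[of k _ i] by (auto simp: lin_maps_def)

lemma wproj_closed [simp]: "\<lbrakk>1 \<le> k; x \<in> carrier (gr L i)\<rbrakk> \<Longrightarrow> wproj L i k x \<in> carrier (gr L i)"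
  by (rule wt_carrier[OF _ wproj_wt])

lemmas wproj_add = lin_maps_add[OF wproj_gr_linear gr_module gr_module]
lemmas wproj_zero = lin_maps_zero[OF wproj_gr_linear gr_module gr_module]
lemmas wproj_minus = lin_maps_minus[OF wproj_gr_linear gr_module gr_module]
lemmas wproj_finsum = lin_maps_finsum[OF wproj_gr_linear gr_module gr_module]
lemmas dif_closed [simp] = lin_maps_closed[OF dif_linear gr_module gr_module]
lemmas dif_add = lin_maps_add[OF dif_linear gr_module gr_module]
lemmas dif_zero = lin_maps_zero[OF dif_linear gr_module gr_module]
lemmas dif_minus = lin_maps_minus[OF dif_linear gr_module gr_module]
lemmas dif_finsum = lin_maps_finsum[OF dif_linear gr_module gr_module]

lemma bra_linear_right: "x \<in> carrier (gr L i) \<Longrightarrow> bra L i j x \<in> lin_maps R (gr L j) (gr L (i + j))"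
  using bra_bilinear[of i j] by (auto simp: bilin_maps_def)

lemma bra_linear_left: "y \<in> carrier (gr L j) \<Longrightarrow> (\<lambda>x. bra L i j x y) \<in> lin_maps R (gr L i) (gr L (i + j))"
  using bra_bilinear[of i j] by (auto simp: bilin_maps_def)

lemmas bra_closed [simp] = lin_maps_closed[OF bra_linear_right gr_module gr_module]
lemmas bra_add_right = lin_maps_add[OF bra_linear_right gr_module gr_module]
lemmas bra_zero_right = lin_maps_zero[OF bra_linear_right gr_module gr_module]
lemmas bra_minus_right = lin_maps_minus[OF bra_linear_right gr_module gr_module]
lemmas bra_finsum_right = lin_maps_finsum[OF bra_linear_right gr_module gr_module]
lemmas bra_add_left = lin_maps_add[OF bra_linear_left gr_module gr_module]
lemmas bra_zero_left = lin_maps_zero[OF bra_linear_left gr_module gr_module]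
lemmas bra_finsum_left = lin_maps_finsum[OF bra_linear_left gr_module gr_module]

lemma filt_wproj: "\<lbrakk>x \<in> filt L n i; 1 \<le> k; k < n\<rbrakk> \<Longrightarrow> wproj L i k x = \<zero>\<^bsub>gr L i\<^esub>"
  by (simp add: filt_def)

lemma filt_1: "filt L (Suc 0) i = carrier (gr L i)"
  by (auto simp: filt_def)

lemma wproj_eqI:
  assumes "x \<in> carrier (gr L i)" "y \<in> carrier (gr L i)" "\<And>k. 1 \<le> k \<Longrightarrow> wproj L i k x = wproj L i k y"
  shows "x = y"
proof -
  have "(\<lambda>k\<in>{1..}. wproj L i k x) = (\<lambda>k\<in>{1..}. wproj L i k y)"
    using assms(3) by (auto simp: restrict_def)
  then show ?thesis
    using assms(1,2) product_decomposition[of i] by (auto simp: bij_betw_def dest: inj_onD)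
qed

lemma wproj_surj:
  assumes "\<And>k. 1 \<le> k \<Longrightarrow> f k \<in> wt L i k"
  shows "\<exists>x\<in>carrier (gr L i). \<forall>k\<ge>1. wproj L i k x = f k"
proof -
  have "(\<lambda>k\<in>{1..}. f k) \<in> (\<Pi>\<^sub>E k\<in>{1..}. wt L i k)" using assms by auto
  then have "(\<lambda>k\<in>{1..}. f k) \<in> (\<lambda>x. \<lambda>k\<in>{1..}. wproj L i k x) ` carrier (gr L i)"
    using product_decomposition[of i] by (simp add: bij_betw_def)
  then obtain x where x: "x \<in> carrier (gr L i)" "(\<lambda>k\<in>{1..}. f k) = (\<lambda>k\<in>{1..}. wproj L i k x)"
    by blast
  have "wproj L i k x = f k" if "1 \<le> k" for k
    using fun_cong[OF x(2), of k] that by simp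
  with x(1) show ?thesis by blast
qed

section \<open>Weight components of the differential and of the bracket\<close>

definition head where "head i n x = finsum (gr L i) (\<lambda>l. wproj L i l x) {1..<n}"

lemma head_closed: "x \<in> carrier (gr L i) \<Longrightarrow> head i n x \<in> carrier (gr L i)"
  unfolding head_def by (rule G.M.finsum_closed) auto

lemma wproj_wproj:
  "\<lbrakk>1 \<le> k; 1 \<le> l; x \<in> carrier (gr L i)\<rbrakk> \<Longrightarrow> wproj L i k (wproj L i l x) = (if l = k then wproj L i l x else \<zero>\<^bsub>gr L i\<^esub>)"
  using wproj_same[OF _ wproj_wt] wproj_other[OF _ _ _ wproj_wt] by auto

lemma wproj_head:
  assumes "x \<in> carrier (gr L i)" "1 \<le> k" "k < n"
  shows "wproj L i k (head i n x) = wproj L i k x"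
proof -
  have "wproj L i k (head i n x) = finsum (gr L i) (\<lambda>l. wproj L i k (wproj L i l x)) {1..<n}"
    unfolding head_def by (rule wproj_finsum) (use assms in auto)
  also have "\<dots> = finsum (gr L i) (\<lambda>l. if k = l then wproj L i l x else \<zero>\<^bsub>gr L i\<^esub>) {1..<n}"
    by (rule G.M.finsum_cong') (use assms in \<open>auto simp: wproj_wproj\<close>)
  also have "\<dots> = wproj L i k x"
    by (rule G.M.finsum_singleton) (use assms in auto)
  finally show ?thesis .
qed

lemma tail_filt:
  assumes "x \<in> carrier (gr L i)"
  shows "x \<ominus>\<^bsub>gr L i\<^esub> head i n x \<in> filt L n i"
  unfolding filt_def using assms
  by (auto simp: head_closed a_minus_def wproj_add wproj_minus wproj_head G.M.r_neg)

lemma split_head: "x \<in> carrier (gr L i) \<Longrightarrow> x = (x \<ominus>\<^bsub>gr L i\<^esub> head i n x) \<oplus>\<^bsub>gr L i\<^esub> head i n x"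
  by (simp add: a_minus_def head_closed G.M.a_assoc G.M.l_neg)

text \<open>An element is not the sum of its components, so it is cut into a finite
  \<open>head\<close> and a tail in filtration level \<open>Suc k\<close>. By
  \<open>dif_filt\<close> the tail contributes nothing in weight \<open>k\<close>, and on the head
  additivity and \<open>dif_wt\<close> decide.\<close>

lemma wproj_dif:
  assumes "x \<in> carrier (gr L i)" "1 \<le> k"
  shows "wproj L (i - 1) k (dif L i x) = (if k \<le> \<delta> then \<zero>\<^bsub>gr L (i - 1)\<^esub> else dif L i (wproj L i (k - \<delta>) x))"
proof -
  define h where "h = head i (Suc k) x"
  define t where "t = x \<ominus>\<^bsub>gr L i\<^esub> h"
  have h: "h \<in> carrier (gr L i)" and t: "t \<in> carrier (gr L i)" "t \<in> filt L (Suc k) i" and x: "x = t \<oplus>\<^bsub>gr L i\<^esub> h"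
    using assms split_head[of x i "Suc k"] tail_filt[of x i "Suc k"] by (simp_all add: h_def t_def head_closed)
  have "wproj L (i - 1) k (dif L i t) = \<zero>\<^bsub>gr L (i - 1)\<^esub>"
    by (rule filt_wproj[OF dif_filt[OF t(2)]]) (use assms in auto)
  then have "wproj L (i - 1) k (dif L i x) = wproj L (i - 1) k (dif L i h)"
    unfolding x using h t assms by (simp add: dif_add wproj_add)
  also have "dif L i h = finsum (gr L (i - 1)) (\<lambda>l. dif L i (wproj L i l x)) {1..<Suc k}"
    unfolding h_def head_def by (rule dif_finsum) (use assms in auto)
  also have "wproj L (i - 1) k \<dots> = finsum (gr L (i - 1)) (\<lambda>l. wproj L (i - 1) k (dif L i (wproj L i l x))) {1..<Suc k}"
    by (rule wproj_finsum) (use assms in auto)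
  also have "\<dots> = finsum (gr L (i - 1)) (\<lambda>l. if l + \<delta> = k then dif L i (wproj L i l x) else \<zero>\<^bsub>gr L (i - 1)\<^esub>) {1..<Suc k}"
  proof (rule G.M.finsum_cong')
    fix l assume "l \<in> {1..<Suc k}"
    then have "dif L i (wproj L i l x) \<in> wt L (i - 1) (l + \<delta>)" "1 \<le> l + \<delta>"
      using assms dif_wt wproj_wt by auto
    then show "wproj L (i - 1) k (dif L i (wproj L i l x)) = (if l + \<delta> = k then dif L i (wproj L i l x) else \<zero>\<^bsub>gr L (i - 1)\<^esub>)"
      using wproj_same wproj_other assms(2) by auto
  qed (use assms in auto)
  also have "\<dots> = (if k \<le> \<delta> then \<zero>\<^bsub>gr L (i - 1)\<^esub> else dif L i (wproj L i (k - \<delta>) x))"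
  proof (cases "k \<le> \<delta>")
    case True
    then have "finsum (gr L (i - 1)) (\<lambda>l. if l + \<delta> = k then dif L i (wproj L i l x) else \<zero>\<^bsub>gr L (i - 1)\<^esub>) {1..<Suc k} =
        finsum (gr L (i - 1)) (\<lambda>l. \<zero>\<^bsub>gr L (i - 1)\<^esub>) {1..<Suc k}"
      by (intro G.M.finsum_cong') auto
    with True show ?thesis by simp
  next
    case False
    then have "finsum (gr L (i - 1)) (\<lambda>l. if l + \<delta> = k then dif L i (wproj L i l x) else \<zero>\<^bsub>gr L (i - 1)\<^esub>) {1..<Suc k} =
        finsum (gr L (i - 1)) (\<lambda>l. if k - \<delta> = l then dif L i (wproj L i l x) else \<zero>\<^bsub>gr L (i - 1)\<^esub>) {1..<Suc k}"
      using assms by (intro G.M.finsum_cong') auto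
    also have "\<dots> = dif L i (wproj L i (k - \<delta>) x)"
      by (rule G.M.finsum_singleton) (use False assms in auto)
    finally show ?thesis using False by simp
  qed
  finally show ?thesis .
qed

text \<open>The same cut, applied to the second argument. As \<open>x\<close> lies in level 1, its
  bracket with the tail lies beyond weight \<open>k\<close>.\<close>

lemma wproj_bra_homogeneous:
  assumes p: "1 \<le> p" "x \<in> wt L i p" and y: "y \<in> carrier (gr L j)" and k: "1 \<le> k"
  shows "wproj L (i + j) k (bra L i j x y) = (if k \<le> p then \<zero>\<^bsub>gr L (i + j)\<^esub> else bra L i j x (wproj L j (k - p) y))"
proof -
  define h where "h = head j (Suc k) y"
  define t where "t = y \<ominus>\<^bsub>gr L j\<^esub> h"
  have x: "x \<in> carrier (gr L i)" using wt_carrier p by blast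
  have h: "h \<in> carrier (gr L j)" and t: "t \<in> carrier (gr L j)" "t \<in> filt L (Suc k) j" and yt: "y = t \<oplus>\<^bsub>gr L j\<^esub> h"
    using y split_head[of y j "Suc k"] tail_filt[of y j "Suc k"] by (simp_all add: h_def t_def head_closed)
  have "bra L i j x t \<in> filt L (Suc 0 + Suc k) (i + j)"
    by (rule bra_filt[OF _ t(2)]) (simp add: filt_1 x)
  then have "wproj L (i + j) k (bra L i j x t) = \<zero>\<^bsub>gr L (i + j)\<^esub>"
    by (rule filt_wproj) (use k in auto)
  then have "wproj L (i + j) k (bra L i j x y) = wproj L (i + j) k (bra L i j x h)"
    unfolding yt using h t x k by (simp add: bra_add_right wproj_add)
  also have "bra L i j x h = finsum (gr L (i + j)) (\<lambda>l. bra L i j x (wproj L j l y)) {1..<Suc k}"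
    unfolding h_def head_def by (rule bra_finsum_right) (use x y in auto)
  also have "wproj L (i + j) k \<dots> = finsum (gr L (i + j)) (\<lambda>l. wproj L (i + j) k (bra L i j x (wproj L j l y))) {1..<Suc k}"
    by (rule wproj_finsum) (use x y k in auto)
  also have "\<dots> = finsum (gr L (i + j)) (\<lambda>l. if p + l = k then bra L i j x (wproj L j l y) else \<zero>\<^bsub>gr L (i + j)\<^esub>) {1..<Suc k}"
  proof (rule G.M.finsum_cong')
    fix l assume "l \<in> {1..<Suc k}"
    then have "bra L i j x (wproj L j l y) \<in> wt L (i + j) (p + l)" "1 \<le> p + l"
      using p y bra_wt wproj_wt by auto
    then show "wproj L (i + j) k (bra L i j x (wproj L j l y)) = (if p + l = k then bra L i j x (wproj L j l y) else \<zero>\<^bsub>gr L (i + j)\<^esub>)"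
      using wproj_same wproj_other k by auto
  qed (use x y in auto)
  also have "\<dots> = (if k \<le> p then \<zero>\<^bsub>gr L (i + j)\<^esub> else bra L i j x (wproj L j (k - p) y))"
  proof (cases "k \<le> p")
    case True
    then have "finsum (gr L (i + j)) (\<lambda>l. if p + l = k then bra L i j x (wproj L j l y) else \<zero>\<^bsub>gr L (i + j)\<^esub>) {1..<Suc k} =
        finsum (gr L (i + j)) (\<lambda>l. \<zero>\<^bsub>gr L (i + j)\<^esub>) {1..<Suc k}"
      by (intro G.M.finsum_cong') auto
    with True show ?thesis by simp
  next
    case False
    then have "finsum (gr L (i + j)) (\<lambda>l. if p + l = k then bra L i j x (wproj L j l y) else \<zero>\<^bsub>gr L (i + j)\<^esub>) {1..<Suc k} =
        finsum (gr L (i + j)) (\<lambda>l. if k - p = l then bra L i j x (wproj L j l y) else \<zero>\<^bsub>gr L (i + j)\<^esub>) {1..<Suc k}"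
      using x y by (intro G.M.finsum_cong') auto
    also have "\<dots> = bra L i j x (wproj L j (k - p) y)"
      by (rule G.M.finsum_singleton) (use False x y p in auto)
    finally show ?thesis using False by simp
  qed
  finally show ?thesis .
qed

text \<open>Only \<open>x\<close> is cut here; its head consists of homogeneous elements, whose
  brackets with the whole of \<open>y\<close> are already known.\<close>

lemma wproj_bra:
  assumes x: "x \<in> carrier (gr L i)" and y: "y \<in> carrier (gr L j)" and k: "1 \<le> k"
  shows "wproj L (i + j) k (bra L i j x y) =
    finsum (gr L (i + j)) (\<lambda>l. bra L i j (wproj L i l x) (wproj L j (k - l) y)) {1..<k}"
proof -
  define h where "h = head i (Suc k) x"
  define t where "t = x \<ominus>\<^bsub>gr L i\<^esub> h"
  have h: "h \<in> carrier (gr L i)" and t: "t \<in> carrier (gr L i)" "t \<in> filt L (Suc k) i" and xt: "x = t \<oplus>\<^bsub>gr L i\<^esub> h"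
    using x split_head[of x i "Suc k"] tail_filt[of x i "Suc k"] by (simp_all add: h_def t_def head_closed)
  have "bra L i j t y \<in> filt L (Suc k + Suc 0) (i + j)"
    by (rule bra_filt[OF t(2)]) (simp add: filt_1 y)
  then have "wproj L (i + j) k (bra L i j t y) = \<zero>\<^bsub>gr L (i + j)\<^esub>"
    by (rule filt_wproj) (use k in auto)
  then have "wproj L (i + j) k (bra L i j x y) = wproj L (i + j) k (bra L i j h y)"
    by (subst xt) (use h t y k in \<open>simp add: bra_add_left wproj_add\<close>)
  also have "bra L i j h y = finsum (gr L (i + j)) (\<lambda>l. bra L i j (wproj L i l x) y) {1..<Suc k}"
    unfolding h_def head_def by (rule bra_finsum_left) (use x y in auto)
  also have "wproj L (i + j) k \<dots> = finsum (gr L (i + j)) (\<lambda>l. wproj L (i + j) k (bra L i j (wproj L i l x) y)) {1..<Suc k}"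
    by (rule wproj_finsum) (use x y k in auto)
  also have "\<dots> = finsum (gr L (i + j)) (\<lambda>l. if k \<le> l then \<zero>\<^bsub>gr L (i + j)\<^esub> else bra L i j (wproj L i l x) (wproj L j (k - l) y)) {1..<Suc k}"
    by (rule G.M.finsum_cong') (use x y k wproj_wt in \<open>auto simp: wproj_bra_homogeneous\<close>)
  also have "\<dots> = finsum (gr L (i + j)) (\<lambda>l. bra L i j (wproj L i l x) (wproj L j (k - l) y)) {1..<k}"
    by (rule G.M.add.finprod_mono_neutral_cong_right) (use x y in auto)
  finally show ?thesis .
qed

sublocale W: weight_components R \<delta> L "\<lambda>k. wt_module L 0 k" "\<lambda>k. wt_module L (- 1) k" "wproj L 0" "wproj L (- 1)"
  "\<lambda>_ _. bra L 0 0" "\<lambda>_ _. bra L 0 (- 1)" "\<lambda>_. dif L 0"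
proof (intro weight_components.intro weight_components_axioms.intro)
  show "comm_Q_algebra R" by (rule comm_Q_algebra_axioms)
  show "1 \<le> \<delta>" by (rule \<delta>_pos)
  show "Module.module R (gr L 0)" "Module.module R (gr L (- 1))" by (rule gr_module)+
  show "Module.module R (wt_module L 0 k)" "Module.module R (wt_module L (- 1) k)" if "1 \<le> k" for k
    using wt_module_module[OF that] by blast+
  show "wproj L 0 k x \<in> carrier (wt_module L 0 k)" if "1 \<le> k" "x \<in> carrier (gr L 0)" for k x
    using wproj_wt[OF that] by simp
  show "\<exists>x\<in>carrier (gr L 0). \<forall>k\<ge>1. wproj L 0 k x = f k" if "\<And>k. 1 \<le> k \<Longrightarrow> f k \<in> carrier (wt_module L 0 k)" for f
    by (rule wproj_surj) (use that in simp)
  show "wproj L (- 1) k \<in> lin_maps R (gr L (- 1)) (wt_module L (- 1) k)" if "1 \<le> k" for k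
    by (rule wproj_linear[OF that])
  show "\<exists>x\<in>carrier (gr L (- 1)). \<forall>k\<ge>1. wproj L (- 1) k x = f k"
    if "\<And>k. 1 \<le> k \<Longrightarrow> f k \<in> carrier (wt_module L (- 1) k)" for f
    by (rule wproj_surj) (use that in simp)
  show "x = y" if "x \<in> carrier (gr L (- 1))" "y \<in> carrier (gr L (- 1))"
    "\<And>k. 1 \<le> k \<Longrightarrow> wproj L (- 1) k x = wproj L (- 1) k y" for x y
    by (rule wproj_eqI[OF that])
  show "filt L n (- 1) = {x \<in> carrier (gr L (- 1)). \<forall>k. 1 \<le> k \<and> k < n \<longrightarrow> wproj L (- 1) k x = \<zero>\<^bsub>wt_module L (- 1) k\<^esub>}" for n
    by (simp add: filt_def)
  show "bra L 0 (- 1) x y \<in> carrier (gr L (- 1))" if "x \<in> carrier (gr L 0)" "y \<in> carrier (gr L (- 1))" for x y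
    using bra_closed[OF that] by simp
  show "wproj L (- 1) k (bra L 0 (- 1) x y) =
      finsum (wt_module L (- 1) k) (\<lambda>l. bra L 0 (- 1) (wproj L 0 l x) (wproj L (- 1) (k - l) y)) {1..<k}"
    if k: "1 \<le> k" and x: "x \<in> carrier (gr L 0)" and y: "y \<in> carrier (gr L (- 1))" for k x y
  proof -
    have "bra L 0 (- 1) (wproj L 0 l x) (wproj L (- 1) (k - l) y) \<in> wt L (- 1) k" if "l \<in> {1..<k}" for l
    proof -
      have l: "1 \<le> l" "1 \<le> k - l" "l + (k - l) = k" using that by auto
      show ?thesis
        using bra_wt[OF l(1,2) wproj_wt[OF l(1) x] wproj_wt[OF l(2) y]] l(3) by simp
    qed
    then show ?thesis
      using wproj_bra[OF x y k] wt_module_finsum[OF k, of "\<lambda>l. bra L 0 (- 1) (wproj L 0 l x) (wproj L (- 1) (k - l) y)" "{1..<k}" "- 1"]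
      by (simp add: Pi_def)
  qed
  show "dif L 0 x \<in> carrier (gr L (- 1))" if "x \<in> carrier (gr L 0)" for x
    using dif_closed[OF that] by simp
  show "wproj L (- 1) k (dif L 0 x) = (if k \<le> \<delta> then \<zero>\<^bsub>wt_module L (- 1) k\<^esub> else dif L 0 (wproj L 0 (k - \<delta>) x))"
    if "1 \<le> k" "x \<in> carrier (gr L 0)" for k x
    using wproj_dif[OF that(2,1)] by simp
  fix k l :: nat and x y assume k: "1 \<le> k" and l: "1 \<le> l" and x: "x \<in> carrier (wt_module L 0 k)"
  have xg: "x \<in> carrier (gr L 0)" using x k wt_carrier by auto
  show "bra L 0 0 x y \<in> carrier (wt_module L 0 (k + l))" if "y \<in> carrier (wt_module L 0 l)"
    using bra_wt[OF k l, of x 0 y 0] x that by simp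
  show "bra L 0 (- 1) x y \<in> carrier (wt_module L (- 1) (k + l))" if "y \<in> carrier (wt_module L (- 1) l)"
    using bra_wt[OF k l, of x 0 y "- 1"] x that by simp
  show "dif L 0 x \<in> carrier (wt_module L (- 1) (k + \<delta>))"
    using dif_wt[OF k, of x 0] x by simp
  show "dif L 0 (x \<oplus>\<^bsub>wt_module L 0 k\<^esub> y) = dif L 0 x \<oplus>\<^bsub>wt_module L (- 1) (k + \<delta>)\<^esub> dif L 0 y"
    if "y \<in> carrier (wt_module L 0 k)"
    using dif_add[OF xg, of y] that wt_carrier[OF k] by simp
  show "bra L 0 0 (x \<oplus>\<^bsub>wt_module L 0 k\<^esub> x') y = bra L 0 0 x y \<oplus>\<^bsub>wt_module L 0 (k + l)\<^esub> bra L 0 0 x' y"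
    if "x' \<in> carrier (wt_module L 0 k)" "y \<in> carrier (wt_module L 0 l)" for x'
    using bra_add_left[of y 0 x 0 x'] that wt_carrier k l xg by simp
  show "bra L 0 0 x (y \<oplus>\<^bsub>wt_module L 0 l\<^esub> y') = bra L 0 0 x y \<oplus>\<^bsub>wt_module L 0 (k + l)\<^esub> bra L 0 0 x y'"
    if "y \<in> carrier (wt_module L 0 l)" "y' \<in> carrier (wt_module L 0 l)" for y'
    using bra_add_right[of x 0 y 0 y'] that wt_carrier k l xg by simp
  show "bra L 0 (- 1) (x \<oplus>\<^bsub>wt_module L 0 k\<^esub> x') y =
      bra L 0 (- 1) x y \<oplus>\<^bsub>wt_module L (- 1) (k + l)\<^esub> bra L 0 (- 1) x' y"
    if "x' \<in> carrier (wt_module L 0 k)" "y \<in> carrier (wt_module L (- 1) l)" for x'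
    using bra_add_left[of y "- 1" x 0 x'] that wt_carrier k l xg by simp
  show "bra L 0 (- 1) x (y \<oplus>\<^bsub>wt_module L (- 1) l\<^esub> y') =
      bra L 0 (- 1) x y \<oplus>\<^bsub>wt_module L (- 1) (k + l)\<^esub> bra L 0 (- 1) x y'"
    if "y \<in> carrier (wt_module L (- 1) l)" "y' \<in> carrier (wt_module L (- 1) l)" for y'
    using bra_add_right[of x 0 y "- 1" y'] that wt_carrier k l xg by simp
  show "bra L 0 (- 1) x (bra L 0 (- 1) y z) = bra L 0 (- 1) (bra L 0 0 x y) z
      \<oplus>\<^bsub>wt_module L (- 1) (k + l + m)\<^esub> bra L 0 (- 1) y (bra L 0 (- 1) x z)"
    if "1 \<le> m" "y \<in> carrier (wt_module L 0 l)" "z \<in> carrier (wt_module L (- 1) m)" for m z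
    using jacobi[of x 0 y 0 z "- 1"] that wt_carrier k l xg by (simp add: koszul_def)
  show "dif L 0 (bra L 0 0 x y) = bra L 0 (- 1) x (dif L 0 y) \<ominus>\<^bsub>wt_module L (- 1) (k + l + \<delta>)\<^esub> bra L 0 (- 1) y (dif L 0 x)"
    if y: "y \<in> carrier (wt_module L 0 l)"
  proof -
    have yg: "y \<in> carrier (gr L 0)" using y wt_carrier[OF l] by simp
    have dx: "dif L 0 x \<in> carrier (gr L (- 1))" "dif L 0 y \<in> carrier (gr L (- 1))"
      using dif_closed[OF xg] dif_closed[OF yg] by simp_all
    have w: "bra L 0 (- 1) y (dif L 0 x) \<in> wt L (- 1) (l + (k + \<delta>))"
      using bra_wt[of l "k + \<delta>" y 0 "dif L 0 x" "- 1"] dif_wt[OF k, of x 0] x y k l by simp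
    have c: "bra L 0 (- 1) y (dif L 0 x) \<in> carrier (gr L (- 1))" "bra L 0 (- 1) x (dif L 0 y) \<in> carrier (gr L (- 1))"
      using bra_closed[OF yg dx(1)] bra_closed[OF xg dx(2)] by simp_all
    \<comment> \<open>For degrees -1 and 0 the exponent \<open>i * j + 1\<close> is odd, which gives
      the sign turning the Leibniz rule into a difference.\<close>
    have "bra L (- 1) 0 (dif L 0 x) y = \<ominus>\<^bsub>gr L (- 1)\<^esub> bra L 0 (- 1) y (dif L 0 x)"
      using bra_antisymmetric[OF dx(1) yg] by (simp add: koszul_def)
    then have "dif L 0 (bra L 0 0 x y) = \<ominus>\<^bsub>gr L (- 1)\<^esub> bra L 0 (- 1) y (dif L 0 x) \<oplus>\<^bsub>gr L (- 1)\<^esub> bra L 0 (- 1) x (dif L 0 y)"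
      using leibniz[OF xg yg] by (simp add: koszul_def)
    also have "\<dots> = bra L 0 (- 1) x (dif L 0 y) \<ominus>\<^bsub>gr L (- 1)\<^esub> bra L 0 (- 1) y (dif L 0 x)"
      using c by (simp add: a_minus_def G.M.a_comm)
    also have "\<dots> = bra L 0 (- 1) x (dif L 0 y) \<ominus>\<^bsub>wt_module L (- 1) (k + l + \<delta>)\<^esub> bra L 0 (- 1) y (dif L 0 x)"
      by (rule wt_module_minus[symmetric]) (use w k in \<open>simp_all add: ac_simps\<close>)
    finally show ?thesis .
  qed
qed

text \<open>Equations with rational coefficients are checked after this embedding, which is
  injective on the carrier and turns module identities into identities of a rational vector
  space.\<close>

abbreviation e :: "int \<Rightarrow> 'g \<Rightarrow> 'g \<Rightarrow>\<^sub>0 rat" where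
  "e i \<equiv> comm_Q_module.emb R (gr L i)"

lemma e_add_pow: "x \<in> carrier (gr L i) \<Longrightarrow> e i ([n] \<cdot>\<^bsub>gr L i\<^esub> x) = psc (of_nat n) (e i x)" for n :: nat
  by (simp add: add_pow_smult[OF gr_module] G.emb_rat_smult)

lemma e_minus: "x \<in> carrier (gr L i) \<Longrightarrow> e i (\<ominus>\<^bsub>gr L i\<^esub> x) = - e i x"
  using G.emb_diff[of "\<zero>\<^bsub>gr L i\<^esub>" i x] by (simp add: a_minus_def)

lemma e_eq_0_iff: "x \<in> carrier (gr L i) \<Longrightarrow> e i x = 0 \<longleftrightarrow> x = \<zero>\<^bsub>gr L i\<^esub>"
  using G.emb_eq_iff[of x i "\<zero>\<^bsub>gr L i\<^esub>"] by simp

lemma bra_0_1_closed [simp]: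
  "\<lbrakk>x \<in> carrier (gr L 0); y \<in> carrier (gr L (- 1))\<rbrakk> \<Longrightarrow> bra L 0 (- 1) x y \<in> carrier (gr L (- 1))"
  "\<lbrakk>x \<in> carrier (gr L (- 1)); y \<in> carrier (gr L 0)\<rbrakk> \<Longrightarrow> bra L (- 1) 0 x y \<in> carrier (gr L (- 1))"
  "x \<in> carrier (gr L 0) \<Longrightarrow> dif L 0 x \<in> carrier (gr L (- 1))"
  using bra_closed[of x 0 y "- 1"] bra_closed[of x "- 1" y 0] dif_closed[of x 0] by simp_all

lemma bra_1_0: "\<lbrakk>x \<in> carrier (gr L (- 1)); y \<in> carrier (gr L 0)\<rbrakk> \<Longrightarrow>
    bra L (- 1) 0 x y = \<ominus>\<^bsub>gr L (- 1)\<^esub> bra L 0 (- 1) y x"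
  using bra_antisymmetric[of x "- 1" y 0] by (simp add: koszul_def)

lemma e_residual:
  assumes u: "\<And>k. 1 \<le> k \<Longrightarrow> u k \<in> wt L 0 k" and f: "\<And>k. 1 \<le> k \<Longrightarrow> f k \<in> wt L (- 1) k" and k: "\<delta> < k"
  shows "W.residual u f k \<in> wt L (- 1) k"
    and "e (- 1) (W.residual u f k) = psc (of_nat (k - \<delta>)) (e (- 1) (f k)) - e (- 1) (dif L 0 (u (k - \<delta>)))
      + (\<Sum>l\<in>{1..<k}. e (- 1) (bra L 0 (- 1) (u l) (f (k - l))))"
proof -
  have k1: "1 \<le> k" "1 \<le> k - \<delta>" "k - \<delta> + \<delta> = k" using k by auto
  interpret V: Module.module R "wt_module L (- 1) k" by (rule wt_module_module[OF k1(1)])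
  have b: "bra L 0 (- 1) (u l) (f (k - l)) \<in> wt L (- 1) k" if "l \<in> {1..<k}" for l
  proof -
    have l: "1 \<le> l" "1 \<le> k - l" "l + (k - l) = k" using that by auto
    show ?thesis using bra_wt[OF l(1,2) u[OF l(1)] f[OF l(2)]] l(3) by simp
  qed
  have du: "dif L 0 (u (k - \<delta>)) \<in> wt L (- 1) k"
    using dif_wt[OF k1(2) u[OF k1(2)]] k1(3) by simp
  have fk: "f k \<in> wt L (- 1) k" by (rule f[OF k1(1)])
  note car = wt_carrier[OF k1(1)]
  have nf: "[(k - \<delta>)] \<cdot>\<^bsub>gr L (- 1)\<^esub> f k \<in> wt L (- 1) k"
    using V.M.add.nat_pow_closed[of "f k" "k - \<delta>"] fk by (simp add: wt_module_add_pow[OF k1(1)])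
  define F where "F = finsum (wt_module L (- 1) k) (\<lambda>l. bra L 0 (- 1) (u l) (f (k - l))) {1..<k}"
  have F: "F \<in> wt L (- 1) k"
    unfolding F_def using V.M.finsum_closed[of "\<lambda>l. bra L 0 (- 1) (u l) (f (k - l))" "{1..<k}"] b by auto
  have F': "F = finsum (gr L (- 1)) (\<lambda>l. bra L 0 (- 1) (u l) (f (k - l))) {1..<k}"
    unfolding F_def by (rule wt_module_finsum[OF k1(1)]) (use b in auto)
  have eF: "e (- 1) F = (\<Sum>l\<in>{1..<k}. e (- 1) (bra L 0 (- 1) (u l) (f (k - l))))"
    unfolding F' by (rule G.emb_finsum) (use b car in auto)
  have "W.residual u f k = [(k - \<delta>)] \<cdot>\<^bsub>wt_module L (- 1) k\<^esub> f k \<ominus>\<^bsub>wt_module L (- 1) k\<^esub> dif L 0 (u (k - \<delta>))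
      \<oplus>\<^bsub>wt_module L (- 1) k\<^esub> F"
    unfolding W.residual_def F_def ..
  moreover have "\<dots> \<in> carrier (wt_module L (- 1) k)"
    using nf du F by (intro V.M.add.m_closed V.M.minus_closed) (simp_all add: wt_module_add_pow[OF k1(1)])
  ultimately show "W.residual u f k \<in> wt L (- 1) k" by simp
  have "W.residual u f k = [(k - \<delta>)] \<cdot>\<^bsub>gr L (- 1)\<^esub> f k \<ominus>\<^bsub>gr L (- 1)\<^esub> dif L 0 (u (k - \<delta>)) \<oplus>\<^bsub>gr L (- 1)\<^esub> F"
    unfolding W.residual_def F_def[symmetric] using wt_module_minus[OF k1(1) du] by (simp add: wt_module_add_pow[OF k1(1)])
  then show "e (- 1) (W.residual u f k) = psc (of_nat (k - \<delta>)) (e (- 1) (f k)) - e (- 1) (dif L 0 (u (k - \<delta>)))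
      + (\<Sum>l\<in>{1..<k}. e (- 1) (bra L 0 (- 1) (u l) (f (k - l))))"
    using car[OF fk] car[OF du] car[OF F] car[OF nf] by (simp add: G.emb_add G.emb_diff e_add_pow eF)
qed

section \<open>The Kaledin class\<close>

lemma mem_prod_UNIV: "x \<in> carrier (prod_module UNIV (\<lambda>_. gr L i)) \<longleftrightarrow> (\<forall>n. x n \<in> carrier (gr L i))"
  by (auto simp: prod_module_def)

abbreviation "kaledin_d \<phi> \<equiv> dif (kaledin_complex L \<delta> \<phi>) 0"

lemma kaledin_gr: "gr (kaledin_complex L \<delta> \<phi>) i = prod_module UNIV (\<lambda>_. gr L i)"
  by (simp add: twist_def powser_def)

lemma kaledin_dif:
  "kaledin_d \<phi> v n = dif L 0 (v n) \<oplus>\<^bsub>gr L (- 1)\<^esub>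
     finsum (gr L (- 1)) (\<lambda>m. bra L (- 1) 0 (prismatic L \<delta> \<phi> m) (v (n - m))) {..n}"
  by (simp add: twist_def powser_def prod_module_def)

lemma prismatic_wt: "\<phi> \<in> carrier (gr L (- 1)) \<Longrightarrow> prismatic L \<delta> \<phi> m \<in> wt L (- 1) (\<delta> + m)"
  using \<delta>_pos by (simp add: prismatic_def wproj_wt)

lemma prismatic_closed: "\<phi> \<in> carrier (gr L (- 1)) \<Longrightarrow> prismatic L \<delta> \<phi> m \<in> carrier (gr L (- 1))"
  using \<delta>_pos by (simp add: prismatic_def)

lemma e_kaledin_dif:
  assumes \<phi>: "\<phi> \<in> carrier (gr L (- 1))" and v: "\<And>n. v n \<in> carrier (gr L 0)"
  shows "kaledin_d \<phi> v n \<in> carrier (gr L (- 1))"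
    and "e (- 1) (kaledin_d \<phi> v n) = e (- 1) (dif L 0 (v n)) -
      (\<Sum>m\<le>n. e (- 1) (bra L 0 (- 1) (v (n - m)) (prismatic L \<delta> \<phi> m)))"
proof -
  have b: "bra L (- 1) 0 (prismatic L \<delta> \<phi> m) (v (n - m)) \<in> carrier (gr L (- 1))" for m
    using prismatic_closed[OF \<phi>] v by simp
  then have F: "finsum (gr L (- 1)) (\<lambda>m. bra L (- 1) 0 (prismatic L \<delta> \<phi> m) (v (n - m))) {..n} \<in> carrier (gr L (- 1))"
    by (intro G.M.finsum_closed) auto
  then show "kaledin_d \<phi> v n \<in> carrier (gr L (- 1))"
    unfolding kaledin_dif using v by simp
  have "e (- 1) (finsum (gr L (- 1)) (\<lambda>m. bra L (- 1) 0 (prismatic L \<delta> \<phi> m) (v (n - m))) {..n}) =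
      (\<Sum>m\<le>n. e (- 1) (bra L (- 1) 0 (prismatic L \<delta> \<phi> m) (v (n - m))))"
    by (rule G.emb_finsum) (use b in auto)
  also have "\<dots> = - (\<Sum>m\<le>n. e (- 1) (bra L 0 (- 1) (v (n - m)) (prismatic L \<delta> \<phi> m)))"
    using prismatic_closed[OF \<phi>] v by (simp add: bra_1_0 e_minus sum_negf)
  finally show "e (- 1) (kaledin_d \<phi> v n) = e (- 1) (dif L 0 (v n)) -
      (\<Sum>m\<le>n. e (- 1) (bra L 0 (- 1) (v (n - m)) (prismatic L \<delta> \<phi> m)))"
    unfolding kaledin_dif using v F by (simp add: G.emb_add)
qed

lemma kaledin_dif_add:
  assumes \<phi>: "\<phi> \<in> carrier (gr L (- 1))" and v: "\<And>n. v n \<in> carrier (gr L 0)" and w: "\<And>n. w n \<in> carrier (gr L 0)"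
  shows "kaledin_d \<phi> (\<lambda>n. v n \<oplus>\<^bsub>gr L 0\<^esub> w n) n =
    kaledin_d \<phi> v n \<oplus>\<^bsub>gr L (- 1)\<^esub> kaledin_d \<phi> w n"
proof -
  have vw: "v n \<oplus>\<^bsub>gr L 0\<^esub> w n \<in> carrier (gr L 0)" for n using v w by simp
  note c = e_kaledin_dif[of \<phi> v, OF \<phi> v] e_kaledin_dif[of \<phi> w, OF \<phi> w] e_kaledin_dif[of \<phi> "\<lambda>n. v n \<oplus>\<^bsub>gr L 0\<^esub> w n", OF \<phi> vw]
  have "e (- 1) (kaledin_d \<phi> (\<lambda>n. v n \<oplus>\<^bsub>gr L 0\<^esub> w n) n) =
    e (- 1) (kaledin_d \<phi> v n \<oplus>\<^bsub>gr L (- 1)\<^esub> kaledin_d \<phi> w n)"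
    using prismatic_closed[OF \<phi>] v w dif_add[of "v n" 0 "w n"] bra_add_left[of _ "- 1" _ 0]
    by (simp add: c G.emb_add sum.distrib)
  then show ?thesis
    using c(1)[of n] c(3)[of n] c(5)[of n] by (simp only: G.emb_eq_iff G.M.add.m_closed)
qed

lemma homology_one: "\<one>\<^bsub>homology M i\<^esub> = boundaries M i"
  by (simp add: homology_def A_FactGroup_def FactGroup_def)

text \<open>The class is a coset of the boundaries, and by additivity of the twisted differential
  these absorb exactly their own elements.\<close>

lemma kaledin_class_zero_iff:
  assumes \<phi>: "\<phi> \<in> carrier (gr L (- 1))"
  shows "kaledin_class L \<delta> \<phi> = \<one>\<^bsub>homology (kaledin_complex L \<delta> \<phi>) (- 1)\<^esub> \<longleftrightarrow>
    (\<exists>v. (\<forall>n. v n \<in> carrier (gr L 0)) \<and>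
      (\<forall>n. powser_deriv L (- 1) (prismatic L \<delta> \<phi>) n = kaledin_d \<phi> v n))"
proof -
  let ?d = "kaledin_d \<phi>"
  let ?c = "powser_deriv L (- 1) (prismatic L \<delta> \<phi>)"
  define C where "C = {v :: nat \<Rightarrow> 'g. \<forall>n. v n \<in> carrier (gr L 0)}"
  have B: "boundaries (kaledin_complex L \<delta> \<phi>) (- 1) = ?d ` C"
    by (auto simp: boundaries_def kaledin_gr mem_prod_UNIV C_def)
  have K: "kaledin_class L \<delta> \<phi> = (\<lambda>v n. ?d v n \<oplus>\<^bsub>gr L (- 1)\<^esub> ?c n) ` C"
    unfolding kaledin_class_def homology_class_def B kaledin_gr
    by (auto simp: a_r_coset_def r_coset_def prod_module_def restrict_def)
  have c: "?c n \<in> carrier (gr L (- 1))" for n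
    using prismatic_closed[OF \<phi>] by (simp add: powser_deriv_def)
  have dc: "?d v n \<in> carrier (gr L (- 1))" if "v \<in> C" for v n
    by (rule e_kaledin_dif(1)[OF \<phi>]) (use that in \<open>simp add: C_def\<close>)
  have add: "?d (\<lambda>n. v n \<oplus>\<^bsub>gr L 0\<^esub> w n) n = ?d v n \<oplus>\<^bsub>gr L (- 1)\<^esub> ?d w n" if "v \<in> C" "w \<in> C" for v w n
    by (rule kaledin_dif_add[OF \<phi>]) (use that in \<open>simp_all add: C_def\<close>)
  have z: "(\<lambda>_. \<zero>\<^bsub>gr L 0\<^esub>) \<in> C" by (simp add: C_def)
  have dz: "?d (\<lambda>_. \<zero>\<^bsub>gr L 0\<^esub>) n = \<zero>\<^bsub>gr L (- 1)\<^esub>" for n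
    using add[OF z z, of n] dc[OF z, of n] by simp
  show ?thesis
    unfolding homology_one
  proof
    assume "kaledin_class L \<delta> \<phi> = boundaries (kaledin_complex L \<delta> \<phi>) (- 1)"
    moreover have "?c \<in> kaledin_class L \<delta> \<phi>"
      unfolding K by (rule image_eqI[OF _ z]) (auto simp: dz c)
    ultimately obtain v where "v \<in> C" "?c = ?d v" unfolding B by blast
    then show "\<exists>v. (\<forall>n. v n \<in> carrier (gr L 0)) \<and> (\<forall>n. ?c n = ?d v n)"
      by (auto simp: C_def)
  next
    assume "\<exists>v. (\<forall>n. v n \<in> carrier (gr L 0)) \<and> (\<forall>n. ?c n = ?d v n)"
    then obtain v where v: "v \<in> C" "\<And>n. ?c n = ?d v n" by (auto simp: C_def)
    show "kaledin_class L \<delta> \<phi> = boundaries (kaledin_complex L \<delta> \<phi>) (- 1)"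
      unfolding K B
    proof (intro equalityI image_subsetI)
      fix w assume w: "w \<in> C"
      show "(\<lambda>n. ?d w n \<oplus>\<^bsub>gr L (- 1)\<^esub> ?c n) \<in> ?d ` C"
        by (rule image_eqI[of _ _ "\<lambda>n. w n \<oplus>\<^bsub>gr L 0\<^esub> v n"]) (use w v add[OF w v(1)] in \<open>auto simp: C_def\<close>)
    next
      fix w assume w: "w \<in> C"
      define x where "x n = w n \<ominus>\<^bsub>gr L 0\<^esub> v n" for n
      have x: "x \<in> C" using w v(1) by (simp add: C_def x_def)
      have "(\<lambda>n. x n \<oplus>\<^bsub>gr L 0\<^esub> v n) = w"
        using w v(1) by (auto simp: C_def x_def a_minus_def G.M.a_assoc G.M.l_neg)
      then have "?d w = (\<lambda>n. ?d x n \<oplus>\<^bsub>gr L (- 1)\<^esub> ?c n)"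
        using add[OF x v(1)] v(2) by (simp add: fun_eq_iff)
      then show "?d w \<in> (\<lambda>v n. ?d v n \<oplus>\<^bsub>gr L (- 1)\<^esub> ?c n) ` C"
        using x by blast
    qed
  qed
qed

text \<open>Put \<open>u (Suc n)\<close> as the coefficient of \<hbar>^n. The coefficient of
  \<hbar>^n in the derivative of the prismatic decomposition carries the factor n + 1, which is k -
  \<delta> for k = \<delta> + n + 1. So the residual in that weight is the difference of the two
  coefficients compared on the right.\<close>

lemma residual_kaledin:
  assumes \<phi>: "\<phi> \<in> filt L \<delta> (- 1)" and u: "\<And>k. 1 \<le> k \<Longrightarrow> u k \<in> wt L 0 k"
  shows "W.residual u (\<lambda>k. wproj L (- 1) k \<phi>) (\<delta> + Suc n) = \<zero>\<^bsub>gr L (- 1)\<^esub> \<longleftrightarrow>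
    powser_deriv L (- 1) (prismatic L \<delta> \<phi>) n = kaledin_d \<phi> (\<lambda>n. u (Suc n)) n"
proof -
  have \<phi>c: "\<phi> \<in> carrier (gr L (- 1))" using \<phi> by (simp add: filt_def)
  have uc: "u (Suc n) \<in> carrier (gr L 0)" for n using wt_carrier[OF _ u, of "Suc n"] by simp
  have f: "wproj L (- 1) k \<phi> \<in> wt L (- 1) k" if "1 \<le> k" for k
    using wproj_wt[OF that \<phi>c] .
  note res = e_residual[where u = u and f = "\<lambda>k. wproj L (- 1) k \<phi>", OF u f]
  let ?k = "\<delta> + Suc n"
  let ?R = "W.residual u (\<lambda>k. wproj L (- 1) k \<phi>) ?k"
  have Rc: "?R \<in> carrier (gr L (- 1))"
    using wt_carrier[OF _ res(1)[of ?k]] by simp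
  \<comment> \<open>For \<open>l > Suc n\<close> the partner of \<open>u l\<close> has weight below
    \<delta> and vanishes.\<close>
  have "(\<Sum>l\<in>{1..<?k}. e (- 1) (bra L 0 (- 1) (u l) (wproj L (- 1) (?k - l) \<phi>))) =
      (\<Sum>l\<in>{1..Suc n}. e (- 1) (bra L 0 (- 1) (u l) (wproj L (- 1) (?k - l) \<phi>)))"
  proof (rule sum.mono_neutral_right)
    show "\<forall>l\<in>{1..<?k} - {1..Suc n}. e (- 1) (bra L 0 (- 1) (u l) (wproj L (- 1) (?k - l) \<phi>)) = 0"
    proof
      fix l assume l: "l \<in> {1..<?k} - {1..Suc n}"
      then have z: "wproj L (- 1) (?k - l) \<phi> = \<zero>\<^bsub>gr L (- 1)\<^esub>"
        by (intro filt_wproj[OF \<phi>]) auto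
      have "u l \<in> carrier (gr L 0)" using wt_carrier[OF _ u] l by auto
      then show "e (- 1) (bra L 0 (- 1) (u l) (wproj L (- 1) (?k - l) \<phi>)) = 0"
        unfolding z using bra_zero_right[of "u l" 0 "- 1"] by simp
    qed
  qed (use \<delta>_pos in auto)
  also have "\<dots> = (\<Sum>m\<le>n. e (- 1) (bra L 0 (- 1) (u (Suc (n - m))) (prismatic L \<delta> \<phi> m)))"
    by (rule sum.reindex_bij_witness[where i = "\<lambda>m. Suc (n - m)" and j = "\<lambda>l. Suc n - l"])
      (auto simp: prismatic_def Suc_diff_le)
  finally have "e (- 1) ?R = psc (of_nat (Suc n)) (e (- 1) (wproj L (- 1) ?k \<phi>)) - e (- 1) (dif L 0 (u (Suc n)))
      + (\<Sum>m\<le>n. e (- 1) (bra L 0 (- 1) (u (Suc (n - m))) (prismatic L \<delta> \<phi> m)))"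
    using res(2)[of ?k] by simp
  moreover have "e (- 1) (powser_deriv L (- 1) (prismatic L \<delta> \<phi>) n) = psc (of_nat (Suc n)) (e (- 1) (wproj L (- 1) ?k \<phi>))"
    unfolding powser_deriv_def prismatic_def using \<phi>c by (subst e_add_pow) auto
  ultimately have "e (- 1) ?R = e (- 1) (powser_deriv L (- 1) (prismatic L \<delta> \<phi>) n) - e (- 1) (kaledin_d \<phi> (\<lambda>n. u (Suc n)) n)"
    using e_kaledin_dif(2)[of \<phi> "\<lambda>n. u (Suc n)", OF \<phi>c uc] by simp
  moreover have "powser_deriv L (- 1) (prismatic L \<delta> \<phi>) n \<in> carrier (gr L (- 1))"
    using prismatic_closed[OF \<phi>c] by (simp add: powser_deriv_def)
  ultimately show ?thesis
    using e_eq_0_iff[OF Rc] e_kaledin_dif(1)[of \<phi> "\<lambda>n. u (Suc n)", OF \<phi>c uc] by (simp add: G.emb_eq_iff)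
qed

text \<open>The coefficient of \<hbar>^m in the prismatic decomposition is homogeneous of weight
  \<delta> + m. Hence the twisted differential maps the diagonal part, weight n + 1 at \<hbar>^n, to
  weight \<delta> + n + 1 at \<hbar>^n.\<close>

lemma wproj_kaledin_dif:
  assumes \<phi>: "\<phi> \<in> carrier (gr L (- 1))" and v: "\<And>n. v n \<in> carrier (gr L 0)"
  shows "wproj L (- 1) (\<delta> + Suc n) (kaledin_d \<phi> v n) =
    kaledin_d \<phi> (\<lambda>n. wproj L 0 (Suc n) (v n)) n"
proof -
  let ?k = "\<delta> + Suc n"
  have b: "bra L (- 1) 0 (prismatic L \<delta> \<phi> m) (v (n - m)) \<in> carrier (gr L (- 1))" for m
    using prismatic_closed[OF \<phi>] v by simp
  then have F: "finsum (gr L (- 1)) (\<lambda>m. bra L (- 1) 0 (prismatic L \<delta> \<phi> m) (v (n - m))) {..n} \<in> carrier (gr L (- 1))"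
    by (intro G.M.finsum_closed) auto
  have "wproj L (- 1) ?k (dif L 0 (v n)) = dif L 0 (wproj L 0 (Suc n) (v n))"
    using wproj_dif[OF v, of ?k n] by simp
  moreover have "wproj L (- 1) ?k (finsum (gr L (- 1)) (\<lambda>m. bra L (- 1) 0 (prismatic L \<delta> \<phi> m) (v (n - m))) {..n}) =
      finsum (gr L (- 1)) (\<lambda>m. wproj L (- 1) ?k (bra L (- 1) 0 (prismatic L \<delta> \<phi> m) (v (n - m)))) {..n}"
    by (rule wproj_finsum) (use b in auto)
  moreover have "\<dots> = finsum (gr L (- 1)) (\<lambda>m. bra L (- 1) 0 (prismatic L \<delta> \<phi> m) (wproj L 0 (Suc (n - m)) (v (n - m)))) {..n}"
  proof (rule G.M.finsum_cong')
    fix m assume "m \<in> {..n}"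
    then show "wproj L (- 1) ?k (bra L (- 1) 0 (prismatic L \<delta> \<phi> m) (v (n - m))) =
        bra L (- 1) 0 (prismatic L \<delta> \<phi> m) (wproj L 0 (Suc (n - m)) (v (n - m)))"
      using wproj_bra_homogeneous[of "\<delta> + m" "prismatic L \<delta> \<phi> m" "- 1" "v (n - m)" 0 ?k]
        prismatic_wt[OF \<phi>] v \<delta>_pos by (simp add: Suc_diff_le)
  qed (use prismatic_closed[OF \<phi>] v in auto)
  ultimately show ?thesis
    unfolding kaledin_dif using F v by (simp add: wproj_add)
qed

text \<open>A primitive of the Kaledin cycle is a power series whose coefficients may have
  components in every weight. The cycle itself is diagonal, so projecting both sides cuts the
  primitive down to its diagonal part, which is a solution.\<close>

theorem kaledin_class_zero_iff_solution:
  assumes \<phi>: "\<phi> \<in> filt L \<delta> (- 1)"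
  shows "kaledin_class L \<delta> \<phi> = \<one>\<^bsub>homology (kaledin_complex L \<delta> \<phi>) (- 1)\<^esub> \<longleftrightarrow> (\<exists>u. W.solution \<phi> u)"
proof -
  have \<phi>c: "\<phi> \<in> carrier (gr L (- 1))" using \<phi> by (simp add: filt_def)
  let ?c = "powser_deriv L (- 1) (prismatic L \<delta> \<phi>)"
  have sol: "W.solution \<phi> u \<longleftrightarrow> (\<forall>k\<ge>1. u k \<in> wt L 0 k) \<and>
      (\<forall>n. ?c n = kaledin_d \<phi> (\<lambda>n. u (Suc n)) n)" for u
  proof -
    have "(\<forall>k>\<delta>. W.residual u (\<lambda>k. wproj L (- 1) k \<phi>) k = \<zero>\<^bsub>gr L (- 1)\<^esub>) \<longleftrightarrow>
        (\<forall>n. W.residual u (\<lambda>k. wproj L (- 1) k \<phi>) (\<delta> + Suc n) = \<zero>\<^bsub>gr L (- 1)\<^esub>)"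
      by (metis less_add_Suc1 less_imp_Suc_add add_Suc_right)
    then show ?thesis
      unfolding W.solution_def using residual_kaledin[OF \<phi>, of u] by auto
  qed
  show ?thesis
    unfolding kaledin_class_zero_iff[OF \<phi>c]
  proof
    assume "\<exists>u. W.solution \<phi> u"
    then obtain u where u: "\<And>k. 1 \<le> k \<Longrightarrow> u k \<in> wt L 0 k" "\<forall>n. ?c n = kaledin_d \<phi> (\<lambda>n. u (Suc n)) n"
      unfolding sol by blast
    have "u (Suc n) \<in> carrier (gr L 0)" for n using wt_carrier[OF _ u(1), of "Suc n"] by simp
    with u(2) show "\<exists>v. (\<forall>n. v n \<in> carrier (gr L 0)) \<and> (\<forall>n. ?c n = kaledin_d \<phi> v n)"
      by (intro exI[of _ "\<lambda>n. u (Suc n)"]) simp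
  next
    assume "\<exists>v. (\<forall>n. v n \<in> carrier (gr L 0)) \<and> (\<forall>n. ?c n = kaledin_d \<phi> v n)"
    then obtain v where v: "\<And>n. v n \<in> carrier (gr L 0)" "\<And>n. ?c n = kaledin_d \<phi> v n" by blast
    have "?c n = kaledin_d \<phi> (\<lambda>n. wproj L 0 (Suc n) (v n)) n" for n
    proof -
      interpret V: Module.module R "wt_module L (- 1) (\<delta> + Suc n)" by (rule wt_module_module) simp
      have "?c n \<in> wt L (- 1) (\<delta> + Suc n)"
        using V.M.add.nat_pow_closed[of "prismatic L \<delta> \<phi> (Suc n)" "Suc n"] prismatic_wt[OF \<phi>c, of "Suc n"]
        by (simp add: powser_deriv_def wt_module_add_pow del: add_Suc_right)
      then have "?c n = wproj L (- 1) (\<delta> + Suc n) (?c n)"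
        by (intro wproj_same[symmetric]) auto
      also have "\<dots> = wproj L (- 1) (\<delta> + Suc n) (kaledin_d \<phi> v n)"
        by (simp only: v(2))
      also have "\<dots> = kaledin_d \<phi> (\<lambda>n. wproj L 0 (Suc n) (v n)) n"
        by (rule wproj_kaledin_dif[OF \<phi>c v(1)])
      finally show ?thesis .
    qed
    \<comment> \<open>Weights start at 1 and exponents at 0, hence the shift.\<close>
    moreover have "wproj L 0 k (v (k - 1)) \<in> wt L 0 k" if "1 \<le> k" for k
      using wproj_wt[OF that v(1)] .
    ultimately show "\<exists>u. W.solution \<phi> u"
      unfolding sol by (intro exI[of _ "\<lambda>k. wproj L 0 k (v (k - 1))"]) simp
  qed
qed

lemma wproj_lead:
  assumes "\<phi> \<in> carrier (gr L (- 1))" "1 \<le> k"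
  shows "wproj L (- 1) k (wproj L (- 1) \<delta> \<phi>) = (if k = \<delta> then wproj L (- 1) k \<phi> else \<zero>\<^bsub>wt_module L (- 1) k\<^esub>)"
  using assms \<delta>_pos by (auto simp: wproj_wproj)

theorem kaledin_class_zero_iff_gauge:
  assumes \<phi>: "\<phi> \<in> filt L \<delta> (- 1)"
  shows "kaledin_class L \<delta> \<phi> = \<one>\<^bsub>homology (kaledin_complex L \<delta> \<phi>) (- 1)\<^esub> \<longleftrightarrow>
    (\<exists>l\<in>carrier (gr L 0). gauge R L l \<phi> = wproj L (- 1) \<delta> \<phi>)"
proof -
  have \<phi>c: "\<phi> \<in> carrier (gr L (- 1))" using \<phi> by (simp add: filt_def)
  show ?thesis
    unfolding kaledin_class_zero_iff_solution[OF \<phi>]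
    by (rule W.gauge_solution_iff[symmetric, OF \<phi>c])
      (use \<phi>c \<delta>_pos filt_wproj[OF \<phi>] wproj_lead[OF \<phi>c] in auto)
qed

text \<open>Gauge equivalence allows either element as the source, and a gauge in either direction
  yields a solution.\<close>

theorem gauge_equiv_lead_iff:
  assumes \<phi>: "\<phi> \<in> filt L \<delta> (- 1)"
  shows "gauge_equiv R L \<phi> (wproj L (- 1) \<delta> \<phi>) \<longleftrightarrow> (\<exists>u. W.solution \<phi> u)"
proof -
  have \<phi>c: "\<phi> \<in> carrier (gr L (- 1))" using \<phi> by (simp add: filt_def)
  have pc: "wproj L (- 1) \<delta> \<phi> \<in> carrier (gr L (- 1))" using \<phi>c \<delta>_pos by simp
  have low: "wproj L (- 1) k \<phi> = \<zero>\<^bsub>wt_module L (- 1) k\<^esub>" if "1 \<le> k" "k < \<delta>" for k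
    using filt_wproj[OF \<phi> that] by simp
  show ?thesis
    using W.gauge_solution_iff[OF \<phi>c low pc wproj_lead[OF \<phi>c]]
      W.solution_if_gauge_from_lead[OF \<phi>c low pc wproj_lead[OF \<phi>c]]
    unfolding gauge_equiv_def by blast
qed

section \<open>Rigidity\<close>

lemma gr_2_closed [simp]:
  "x \<in> carrier (gr L (- 1)) \<Longrightarrow> dif L (- 1) x \<in> carrier (gr L (- 2))"
  "\<lbrakk>x \<in> carrier (gr L (- 1)); y \<in> carrier (gr L (- 1))\<rbrakk> \<Longrightarrow> bra L (- 1) (- 1) x y \<in> carrier (gr L (- 2))"
  "\<lbrakk>x \<in> carrier (gr L 0); z \<in> carrier (gr L (- 2))\<rbrakk> \<Longrightarrow> bra L 0 (- 2) x z \<in> carrier (gr L (- 2))"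
  using dif_closed[of x "- 1"] bra_closed[of x "- 1" y "- 1"] bra_closed[of x 0 z "- 2"] by simp_all

lemma bra_1_1_commute:
  "\<lbrakk>x \<in> carrier (gr L (- 1)); y \<in> carrier (gr L (- 1))\<rbrakk> \<Longrightarrow> bra L (- 1) (- 1) x y = bra L (- 1) (- 1) y x"
  using bra_antisymmetric[of x "- 1" y "- 1"] by (simp add: koszul_def)

text \<open>The coset of the cycle \<open>z\<close> must equal the group of boundaries, and
  \<open>z\<close> belongs to its own coset because 0 is a boundary.\<close>

lemma exact_if_trivial_homology:
  assumes triv: "trivial_group (homology (twist L \<psi>) (- 1))" and \<psi>: "\<psi> \<in> carrier (gr L (- 1))"
    and z: "z \<in> carrier (gr L (- 1))"
    and cycle: "dif L (- 1) z \<oplus>\<^bsub>gr L (- 2)\<^esub> bra L (- 1) (- 1) \<psi> z = \<zero>\<^bsub>gr L (- 2)\<^esub>"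
  shows "\<exists>w\<in>carrier (gr L 0). z = dif L 0 w \<oplus>\<^bsub>gr L (- 1)\<^esub> bra L (- 1) 0 \<psi> w"
proof -
  define B where "B = boundaries (twist L \<psi>) (- 1)"
  have B: "B = (\<lambda>w. dif L 0 w \<oplus>\<^bsub>gr L (- 1)\<^esub> bra L (- 1) 0 \<psi> w) ` carrier (gr L 0)"
    by (simp add: B_def boundaries_def twist_def)
  have "\<zero>\<^bsub>gr L (- 1)\<^esub> \<in> B"
    unfolding B by (rule image_eqI[of _ _ "\<zero>\<^bsub>gr L 0\<^esub>"])
      (use dif_zero[of 0] bra_zero_right[OF \<psi>, of 0] in simp_all)
  have "z \<in> cycles (twist L \<psi>) (- 1)"
    using z cycle by (simp add: cycles_def twist_def)
  then have "B +>\<^bsub>gr L (- 1)\<^esub> z \<in> carrier (homology (twist L \<psi>) (- 1))"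
    by (auto simp: homology_def A_FactGroup_def FactGroup_def RCOSETS_def r_coset_def a_r_coset_def B_def twist_def)
  then have "B +>\<^bsub>gr L (- 1)\<^esub> z = B"
    using triv by (simp add: trivial_group_def homology_one B_def)
  moreover have "z \<in> B +>\<^bsub>gr L (- 1)\<^esub> z"
    using \<open>\<zero>\<^bsub>gr L (- 1)\<^esub> \<in> B\<close> z by (force simp: a_r_coset_def r_coset_def)
  ultimately show ?thesis unfolding B by auto
qed

section \<open>The residual of a Maurer--Cartan element as a twisted cycle\<close>

context
  fixes \<chi> assumes MC: "\<chi> \<in> MC_filt R L \<delta>"
begin

lemma \<chi>_filt: "\<chi> \<in> filt L \<delta> (- 1)" and \<chi>_closed: "\<chi> \<in> carrier (gr L (- 1))"
  using MC by (auto simp: MC_filt_def MC_def)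

lemma e_MC: "e (- 2) (dif L (- 1) \<chi>) = - psc (1 / 2) (e (- 2) (bra L (- 1) (- 1) \<chi> \<chi>))"
proof -
  have "inv_nat R 2 = rat_map (1 / 2)" by (simp add: inv_nat_eq)
  then have "e (- 2) (dif L (- 1) \<chi> \<oplus>\<^bsub>gr L (- 2)\<^esub> rat_map (1 / 2) \<odot>\<^bsub>gr L (- 2)\<^esub> bra L (- 1) (- 1) \<chi> \<chi>) = 0"
    using MC by (simp add: MC_filt_def MC_def)
  then show ?thesis
    using \<chi>_closed by (simp add: G.emb_add G.emb_rat_smult add_eq_0_iff)
qed

text \<open>The differential twisted by \<chi> on degree -1, with values encoded in the rational
  vector space.\<close>

definition twisted where
  "twisted x = e (- 2) (dif L (- 1) x) + e (- 2) (bra L (- 1) (- 1) \<chi> x)"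

lemma twisted_add: "\<lbrakk>x \<in> carrier (gr L (- 1)); y \<in> carrier (gr L (- 1))\<rbrakk> \<Longrightarrow>
    twisted (x \<oplus>\<^bsub>gr L (- 1)\<^esub> y) = twisted x + twisted y"
  using dif_add[of x "- 1" y] bra_add_right[OF \<chi>_closed, of x "- 1" y]
  by (simp add: twisted_def G.emb_add \<chi>_closed)

lemma twisted_minus: "x \<in> carrier (gr L (- 1)) \<Longrightarrow> twisted (\<ominus>\<^bsub>gr L (- 1)\<^esub> x) = - twisted x"
  using dif_minus[of x "- 1"] bra_minus_right[OF \<chi>_closed, of x "- 1"]
  by (simp add: twisted_def e_minus \<chi>_closed)

lemma twisted_add_pow: "x \<in> carrier (gr L (- 1)) \<Longrightarrow> twisted ([n] \<cdot>\<^bsub>gr L (- 1)\<^esub> x) = psc (of_nat n) (twisted x)" for n :: nat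
proof (induction n)
  case 0
  have "twisted \<zero>\<^bsub>gr L (- 1)\<^esub> = 0"
    using twisted_add[of "\<zero>\<^bsub>gr L (- 1)\<^esub>" "\<zero>\<^bsub>gr L (- 1)\<^esub>"] by simp
  then show ?case by simp
next
  case (Suc n)
  then show ?case
    by (simp add: G.M.add.nat_pow_Suc twisted_add psc.scale_left_distrib)
qed

text \<open>By the Maurer--Cartan equation [u, d\<chi>] is -1/2 [u, [\<chi>, \<chi>]]. Jacobi and
  the symmetry of the bracket in degree -1 turn [u, [\<chi>, \<chi>]] into twice [\<chi>,
  [u, \<chi>]].\<close>

lemma e_bra_right_MC:
  assumes u: "u \<in> carrier (gr L 0)"
  shows "e (- 2) (bra L 0 (- 2) u (dif L (- 1) \<chi>)) = - e (- 2) (bra L (- 1) (- 1) \<chi> (bra L 0 (- 1) u \<chi>))"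
proof -
  define b where "b = bra L (- 1) (- 1) \<chi> (bra L 0 (- 1) u \<chi>)"
  define Q where "Q = bra L (- 1) (- 1) \<chi> \<chi>"
  have c: "b \<in> carrier (gr L (- 2))" "Q \<in> carrier (gr L (- 2))" "bra L 0 (- 2) u Q \<in> carrier (gr L (- 2))"
    using u \<chi>_closed by (simp_all add: b_def Q_def)
  have "bra L 0 (- 2) u Q = b \<oplus>\<^bsub>gr L (- 2)\<^esub> b"
    using jacobi[OF u \<chi>_closed \<chi>_closed] bra_1_1_commute[of "bra L 0 (- 1) u \<chi>" \<chi>] u \<chi>_closed
    by (simp add: koszul_def b_def Q_def)
  then have J: "e (- 2) (bra L 0 (- 2) u Q) = psc 2 (e (- 2) b)"
    using c psc.scale_left_distrib[of 1 1 "e (- 2) b"] by (simp add: G.emb_add)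
  have "e (- 2) (rat_map (- 1 / 2) \<odot>\<^bsub>gr L (- 2)\<^esub> Q) = e (- 2) (dif L (- 1) \<chi>)"
    using c(2) unfolding e_MC by (simp add: G.emb_rat_smult Q_def)
  then have "dif L (- 1) \<chi> = rat_map (- 1 / 2) \<odot>\<^bsub>gr L (- 2)\<^esub> Q"
    using c(2) \<chi>_closed by (simp only: G.emb_eq_iff G.smult_closed rat_map_closed gr_2_closed)
  then have "bra L 0 (- 2) u (dif L (- 1) \<chi>) = rat_map (- 1 / 2) \<odot>\<^bsub>gr L (- 2)\<^esub> bra L 0 (- 2) u Q"
    using bra_linear_right[OF u, of "- 2"] c(2) by (simp add: lin_maps_def)
  then show ?thesis
    using c by (simp add: G.emb_rat_smult J b_def)
qed

text \<open>The twisted differential of \<open>u\<close> is du - [u, \<chi>]; the lemma is the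
  vanishing of the square of the twisted differential on \<open>u\<close>.\<close>

lemma twisted_dif_bra:
  assumes u: "u \<in> carrier (gr L 0)"
  shows "twisted (bra L 0 (- 1) u \<chi>) = twisted (dif L 0 u)"
proof -
  have du: "dif L 0 u \<in> carrier (gr L (- 1))" "dif L (- 1) \<chi> \<in> carrier (gr L (- 2))"
    using u \<chi>_closed by simp_all
  have "dif L (- 1) (bra L 0 (- 1) u \<chi>) =
      bra L (- 1) (- 1) \<chi> (dif L 0 u) \<oplus>\<^bsub>gr L (- 2)\<^esub> bra L 0 (- 2) u (dif L (- 1) \<chi>)"
    using leibniz[OF u \<chi>_closed] bra_1_1_commute[OF du(1) \<chi>_closed] by (simp add: koszul_def)
  then have "e (- 2) (dif L (- 1) (bra L 0 (- 1) u \<chi>)) =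
      e (- 2) (bra L (- 1) (- 1) \<chi> (dif L 0 u)) + e (- 2) (bra L 0 (- 2) u (dif L (- 1) \<chi>))"
    using du u \<chi>_closed by (simp add: G.emb_add)
  moreover have "dif L (- 1) (dif L 0 u) = \<zero>\<^bsub>gr L (- 2)\<^esub>"
    using dif_dif[OF u] by simp
  ultimately show ?thesis
    unfolding twisted_def e_bra_right_MC[OF u] by simp
qed

lemma e_wproj_dif:
  assumes "x \<in> carrier (gr L (- 1))" "1 \<le> k"
  shows "e (- 2) (wproj L (- 2) k (dif L (- 1) x)) = (if k \<le> \<delta> then 0 else e (- 2) (dif L (- 1) (wproj L (- 1) (k - \<delta>) x)))"
  using wproj_dif[OF assms] by simp

lemma e_wproj_bra:
  assumes "x \<in> carrier (gr L (- 1))" "y \<in> carrier (gr L (- 1))" "1 \<le> k"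
  shows "e (- 2) (wproj L (- 2) k (bra L (- 1) (- 1) x y)) =
    (\<Sum>l\<in>{1..<k}. e (- 2) (bra L (- 1) (- 1) (wproj L (- 1) l x) (wproj L (- 1) (k - l) y)))"
proof -
  have "wproj L (- 2) k (bra L (- 1) (- 1) x y) =
      finsum (gr L (- 2)) (\<lambda>l. bra L (- 1) (- 1) (wproj L (- 1) l x) (wproj L (- 1) (k - l) y)) {1..<k}"
    using wproj_bra[OF assms] by simp
  also have "e (- 2) \<dots> = (\<Sum>l\<in>{1..<k}. e (- 2) (bra L (- 1) (- 1) (wproj L (- 1) l x) (wproj L (- 1) (k - l) y)))"
    by (rule G.emb_finsum) (use assms in auto)
  finally show ?thesis .
qed

text \<open>The derivation property $[E, d + \chi]$ of the Maurer--Cartan equation, with \<open>c\<close> in the role of $E\chi$.\<close>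

lemma twisted_weighted:
  assumes c: "c \<in> carrier (gr L (- 1))" "\<And>k. 1 \<le> k \<Longrightarrow> wproj L (- 1) k c = [k] \<cdot>\<^bsub>gr L (- 1)\<^esub> wproj L (- 1) k \<chi>"
  shows "twisted c = psc (of_nat \<delta>) (twisted \<chi>)"
proof -
  \<comment> \<open>The two sides are formed as elements of degree -2, because weight projections
    apply to these and not to encoded vectors.\<close>
  define X where "X = dif L (- 1) c \<oplus>\<^bsub>gr L (- 2)\<^esub> bra L (- 1) (- 1) \<chi> c"
  define Y where "Y = rat_map (of_nat \<delta>) \<odot>\<^bsub>gr L (- 2)\<^esub> (dif L (- 1) \<chi> \<oplus>\<^bsub>gr L (- 2)\<^esub> bra L (- 1) (- 1) \<chi> \<chi>)"
  have XY: "X \<in> carrier (gr L (- 2))" "Y \<in> carrier (gr L (- 2))"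
    using c(1) \<chi>_closed by (simp_all add: X_def Y_def)
  have "X = Y"
  proof (rule wproj_eqI[OF XY])
    fix k :: nat assume k: "1 \<le> k"
    define q where "q l = e (- 2) (bra L (- 1) (- 1) (wproj L (- 1) l \<chi>) (wproj L (- 1) (k - l) \<chi>))" for l
    define Q where "Q = (\<Sum>l\<in>{1..<k}. q l)"
    define a where "a = e (- 2) (wproj L (- 2) k (dif L (- 1) \<chi>))"
    have \<chi>k: "wproj L (- 1) j \<chi> \<in> carrier (gr L (- 1))" if "1 \<le> j" for j
      using that \<chi>_closed by simp
    have Qk: "e (- 2) (wproj L (- 2) k (bra L (- 1) (- 1) \<chi> \<chi>)) = Q"
      unfolding Q_def q_def by (rule e_wproj_bra[OF \<chi>_closed \<chi>_closed k])
    have wlin: "e (- 2) (wproj L (- 2) k (rat_map r \<odot>\<^bsub>gr L (- 2)\<^esub> x)) = psc r (e (- 2) (wproj L (- 2) k x))"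
      if "x \<in> carrier (gr L (- 2))" for r x
      using wproj_gr_linear[OF k, of "- 2"] that k by (simp add: lin_maps_def G.emb_rat_smult)
    have "inv_nat R 2 = rat_map (1 / 2)" by (simp add: inv_nat_eq)
    then have "dif L (- 1) \<chi> \<oplus>\<^bsub>gr L (- 2)\<^esub> rat_map (1 / 2) \<odot>\<^bsub>gr L (- 2)\<^esub> bra L (- 1) (- 1) \<chi> \<chi> = \<zero>\<^bsub>gr L (- 2)\<^esub>"
      using MC by (simp add: MC_filt_def MC_def)
    then have "e (- 2) (wproj L (- 2) k (dif L (- 1) \<chi> \<oplus>\<^bsub>gr L (- 2)\<^esub> rat_map (1 / 2) \<odot>\<^bsub>gr L (- 2)\<^esub> bra L (- 1) (- 1) \<chi> \<chi>)) = 0"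
      using wproj_zero[OF k] by simp
    then have aQ: "a = - psc (1 / 2) Q"
      using k \<chi>_closed by (simp add: wproj_add G.emb_add wlin Qk a_def add_eq_0_iff)
    have q_sym: "q l = q (k - l)" if "l \<in> {1..<k}" for l
    proof -
      have l: "1 \<le> l" "1 \<le> k - l" "k - (k - l) = l" using that by auto
      show ?thesis using bra_1_1_commute[OF \<chi>k[OF l(1)] \<chi>k[OF l(2)]] by (simp add: q_def l(3))
    qed
    have wk: "e (- 2) (wproj L (- 2) k (bra L (- 1) (- 1) \<chi> c)) = (\<Sum>l\<in>{1..<k}. psc (of_nat (k - l)) (q l))"
      unfolding e_wproj_bra[OF \<chi>_closed c(1) k]
    proof (rule sum.cong[OF refl])
      fix l assume "l \<in> {1..<k}"
      then have l: "1 \<le> l" "1 \<le> k - l" by auto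
      have "bra L (- 1) (- 1) (wproj L (- 1) l \<chi>) (wproj L (- 1) (k - l) c) =
          rat_map (of_nat (k - l)) \<odot>\<^bsub>gr L (- 2)\<^esub> bra L (- 1) (- 1) (wproj L (- 1) l \<chi>) (wproj L (- 1) (k - l) \<chi>)"
        using bra_linear_right[OF \<chi>k[OF l(1)], of "- 1"] \<chi>k[OF l(2)]
        by (simp add: c(2)[OF l(2)] add_pow_smult[OF gr_module] lin_maps_def)
      then show "e (- 2) (bra L (- 1) (- 1) (wproj L (- 1) l \<chi>) (wproj L (- 1) (k - l) c)) = psc (of_nat (k - l)) (q l)"
        using \<chi>k l by (simp add: G.emb_rat_smult q_def)
    qed
    define A where "A = (\<Sum>l\<in>{1..<k}. psc (of_nat (k - l)) (q l))"
    define A' where "A' = (\<Sum>l\<in>{1..<k}. psc (of_nat l) (q l))"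
    note wk = wk[folded A_def]
    \<comment> \<open>The sum weighted by the second weight equals the one weighted by the first, by
      symmetry of the bracket; together they give \<open>k\<close> times \<open>Q\<close>, so each
      is half of that.\<close>
    have "A = A'"
      unfolding A_def A'_def
      by (rule sum.reindex_bij_witness[where i = "\<lambda>l. k - l" and j = "\<lambda>l. k - l"]) (auto simp: q_sym)
    moreover have "A + A' = psc (of_nat k) Q"
      unfolding A_def A'_def Q_def psc.scale_sum_right sum.distrib[symmetric]
      by (rule sum.cong) (auto simp: of_nat_diff simp flip: psc.scale_left_distrib)
    ultimately have "psc (1 / 2 + 1 / 2) A = psc (1 / 2) (psc (of_nat k) Q)"
      unfolding psc.scale_left_distrib by (simp only: psc.scale_right_distrib[symmetric])
    then have half: "A = psc (of_nat k / 2) Q"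
      by simp
    \<comment> \<open>Weight \<open>k\<close> of the differential comes from weight k - \<delta>,
      whence this factor instead of \<open>k\<close>.\<close>
    have wd: "e (- 2) (wproj L (- 2) k (dif L (- 1) c)) = psc (of_nat k - of_nat \<delta>) a"
    proof (cases "k \<le> \<delta>")
      case True
      then show ?thesis using e_wproj_dif[OF c(1) k] e_wproj_dif[OF \<chi>_closed k] by (simp add: a_def)
    next
      case False
      then have k': "1 \<le> k - \<delta>" by simp
      have "dif L (- 1) (wproj L (- 1) (k - \<delta>) c) =
          rat_map (of_nat (k - \<delta>)) \<odot>\<^bsub>gr L (- 2)\<^esub> dif L (- 1) (wproj L (- 1) (k - \<delta>) \<chi>)"
        using dif_linear[of "- 1"] \<chi>k[OF k'] by (simp add: c(2)[OF k'] add_pow_smult[OF gr_module] lin_maps_def)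
      then show ?thesis
        using False e_wproj_dif[OF c(1) k] e_wproj_dif[OF \<chi>_closed k] \<chi>k[OF k']
        by (simp add: a_def G.emb_rat_smult of_nat_diff)
    qed
    have "e (- 2) (wproj L (- 2) k X) = psc (of_nat k - of_nat \<delta>) a + psc (of_nat k / 2) Q"
      unfolding X_def using k c(1) \<chi>_closed by (simp add: wproj_add G.emb_add wd wk half[symmetric])
    \<comment> \<open>With a = -Q/2, both sides are \<delta>/2 times \<open>Q\<close>.\<close>
    also have "\<dots> = psc (of_nat \<delta>) (a + Q)"
    proof -
      have r: "psc r a = psc (- (r / 2)) Q" for r unfolding aQ by simp
      have "psc (of_nat k - of_nat \<delta>) a + psc (of_nat k / 2) Q = psc (- ((of_nat k - of_nat \<delta>) / 2) + of_nat k / 2) Q"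
        by (simp only: r psc.scale_left_distrib)
      also have "- ((of_nat k - of_nat \<delta>) / 2) + of_nat k / 2 = (- (of_nat \<delta> / 2) + of_nat \<delta> :: rat)"
        by (simp add: field_simps)
      also have "psc (- (of_nat \<delta> / 2) + of_nat \<delta>) Q = psc (of_nat \<delta>) (a + Q)"
        by (simp only: r psc.scale_left_distrib psc.scale_right_distrib)
      finally show ?thesis .
    qed
    also have "\<dots> = e (- 2) (wproj L (- 2) k Y)"
      unfolding Y_def using k \<chi>_closed by (simp add: wlin wproj_add G.emb_add Qk a_def)
    finally show "wproj L (- 2) k X = wproj L (- 2) k Y"
      using XY k by (simp add: G.emb_eq_iff)
  qed
  then have "e (- 2) X = e (- 2) Y" by simp
  then show ?thesis
    using c(1) \<chi>_closed by (simp add: X_def Y_def twisted_def G.emb_add G.emb_rat_smult)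
qed

text \<open>The full residual r = E\<chi> - \<delta>\<chi> - dU + [U, \<chi>] is a cycle for the
  differential twisted by \<chi>: the first two terms cancel by \<open>twisted_weighted\<close>, the
  last two by \<open>twisted_dif_bra\<close>. Its lowest component is \<open>z\<close>, and the
  lowest component of the cycle equation is the claim about \<open>z\<close>.\<close>

lemma leading_residual_cycle:
  assumes u: "\<And>k. 1 \<le> k \<Longrightarrow> u k \<in> wt L 0 k" and n: "1 \<le> n"
    and res: "\<And>k. \<lbrakk>\<delta> < k; k < n + \<delta>\<rbrakk> \<Longrightarrow> W.residual u (\<lambda>k. wproj L (- 1) k \<chi>) k = \<zero>\<^bsub>gr L (- 1)\<^esub>"
  defines "z \<equiv> W.residual u (\<lambda>k. wproj L (- 1) k \<chi>) (n + \<delta>)"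
  shows "z \<in> wt L (- 1) (n + \<delta>)"
    and "dif L (- 1) z \<oplus>\<^bsub>gr L (- 2)\<^esub> bra L (- 1) (- 1) (wproj L (- 1) \<delta> \<chi>) z = \<zero>\<^bsub>gr L (- 2)\<^esub>"
proof -
  have f: "wproj L (- 1) k \<chi> \<in> wt L (- 1) k" if "1 \<le> k" for k
    using wproj_wt[OF that \<chi>_closed] .
  note er = e_residual[where u = u and f = "\<lambda>k. wproj L (- 1) k \<chi>", OF u f]
  show zw: "z \<in> wt L (- 1) (n + \<delta>)"
    unfolding z_def using er(1)[of "n + \<delta>"] n by simp
  obtain U where U: "U \<in> carrier (gr L 0)" "\<forall>k\<ge>1. wproj L 0 k U = u k"
    using wproj_surj[of u 0] u by blast
  \<comment> \<open>\<open>c\<close> is E\<chi>, prescribed through its components.\<close>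
  obtain c where c: "c \<in> carrier (gr L (- 1))" "\<forall>k\<ge>1. wproj L (- 1) k c = [k] \<cdot>\<^bsub>gr L (- 1)\<^esub> wproj L (- 1) k \<chi>"
  proof -
    have "[k] \<cdot>\<^bsub>gr L (- 1)\<^esub> wproj L (- 1) k \<chi> \<in> wt L (- 1) k" if "1 \<le> k" for k
    proof -
      interpret V: Module.module R "wt_module L (- 1) k" by (rule wt_module_module[OF that])
      show ?thesis
        using V.M.add.nat_pow_closed[of "wproj L (- 1) k \<chi>" k] f[OF that] by (simp add: wt_module_add_pow[OF that])
    qed
    then show thesis using that wproj_surj[of "\<lambda>k. [k] \<cdot>\<^bsub>gr L (- 1)\<^esub> wproj L (- 1) k \<chi>" "- 1"] by blast
  qed
  define r where "r = c \<oplus>\<^bsub>gr L (- 1)\<^esub> \<ominus>\<^bsub>gr L (- 1)\<^esub> ([\<delta>] \<cdot>\<^bsub>gr L (- 1)\<^esub> \<chi>) \<oplus>\<^bsub>gr L (- 1)\<^esub>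
    \<ominus>\<^bsub>gr L (- 1)\<^esub> dif L 0 U \<oplus>\<^bsub>gr L (- 1)\<^esub> bra L 0 (- 1) U \<chi>"
  have closed: "[\<delta>] \<cdot>\<^bsub>gr L (- 1)\<^esub> \<chi> \<in> carrier (gr L (- 1))" "dif L 0 U \<in> carrier (gr L (- 1))"
    "bra L 0 (- 1) U \<chi> \<in> carrier (gr L (- 1))"
    using U \<chi>_closed by simp_all
  have rc: "r \<in> carrier (gr L (- 1))" using c closed by (simp add: r_def)
  have "twisted r = 0"
    using c closed twisted_weighted[OF c(1)] twisted_dif_bra[OF U(1)] \<chi>_closed
    by (simp add: r_def twisted_add twisted_minus twisted_add_pow)
  then have "e (- 2) (dif L (- 1) r \<oplus>\<^bsub>gr L (- 2)\<^esub> bra L (- 1) (- 1) \<chi> r) = 0"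
    using rc \<chi>_closed by (simp add: twisted_def G.emb_add)
  then have cycle: "dif L (- 1) r \<oplus>\<^bsub>gr L (- 2)\<^esub> bra L (- 1) (- 1) \<chi> r = \<zero>\<^bsub>gr L (- 2)\<^esub>"
    using rc \<chi>_closed by (subst (asm) e_eq_0_iff) simp_all
  have e_wproj_r: "e (- 1) (wproj L (- 1) k r) = psc (of_nat k - of_nat \<delta>) (e (- 1) (wproj L (- 1) k \<chi>)) -
      e (- 1) (wproj L (- 1) k (dif L 0 U)) + e (- 1) (wproj L (- 1) k (bra L 0 (- 1) U \<chi>))" if k: "1 \<le> k" for k
  proof -
    have "wproj L (- 1) k ([\<delta>] \<cdot>\<^bsub>gr L (- 1)\<^esub> \<chi>) = rat_map (of_nat \<delta>) \<odot>\<^bsub>gr L (- 1)\<^esub> wproj L (- 1) k \<chi>"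
      using wproj_gr_linear[OF k, of "- 1"] \<chi>_closed by (simp add: add_pow_smult[OF gr_module] lin_maps_def)
    moreover have "wproj L (- 1) k c = rat_map (of_nat k) \<odot>\<^bsub>gr L (- 1)\<^esub> wproj L (- 1) k \<chi>"
      using c k \<chi>_closed by (simp add: add_pow_smult[OF gr_module])
    ultimately show ?thesis
      using k c closed \<chi>_closed
      by (simp add: r_def wproj_add wproj_minus G.emb_add e_minus G.emb_rat_smult psc.scale_left_diff_distrib)
  qed
  have wbra: "e (- 1) (wproj L (- 1) k (bra L 0 (- 1) U \<chi>)) =
      (\<Sum>l\<in>{1..<k}. e (- 1) (bra L 0 (- 1) (u l) (wproj L (- 1) (k - l) \<chi>)))" if k: "1 \<le> k" for k
  proof -
    have "wproj L (- 1) k (bra L 0 (- 1) U \<chi>) =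
        finsum (gr L (- 1)) (\<lambda>l. bra L 0 (- 1) (wproj L 0 l U) (wproj L (- 1) (k - l) \<chi>)) {1..<k}"
      using wproj_bra[OF U(1) \<chi>_closed k] by simp
    also have "e (- 1) \<dots> = (\<Sum>l\<in>{1..<k}. e (- 1) (bra L 0 (- 1) (wproj L 0 l U) (wproj L (- 1) (k - l) \<chi>)))"
      by (rule G.emb_finsum) (use U(1) \<chi>_closed in auto)
    finally show ?thesis using U(2) by simp
  qed
  have r_high: "wproj L (- 1) k r = W.residual u (\<lambda>k. wproj L (- 1) k \<chi>) k" if k: "\<delta> < k" for k
  proof -
    have k1: "1 \<le> k" "1 \<le> k - \<delta>" using k by auto
    have "e (- 1) (wproj L (- 1) k r) = e (- 1) (W.residual u (\<lambda>k. wproj L (- 1) k \<chi>) k)"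
      unfolding er(2)[OF _ _ k, simplified] e_wproj_r[OF k1(1)] wbra[OF k1(1)]
      using wproj_dif[OF U(1) k1(1)] k U(2) by (simp add: of_nat_diff)
    then show ?thesis
      using wt_carrier[OF k1(1) er(1)[OF _ _ k]] rc k1 by (simp add: G.emb_eq_iff)
  qed
  \<comment> \<open>Up to weight \<delta> the residual vanishes by itself: dU and [U, \<chi>] start
    above \<delta>, and the factor k - \<delta> removes the leading component of \<chi>.\<close>
  have r_low: "wproj L (- 1) k r = \<zero>\<^bsub>gr L (- 1)\<^esub>" if k: "1 \<le> k" "k \<le> \<delta>" for k
  proof -
    have "e (- 1) (wproj L (- 1) k (bra L 0 (- 1) U \<chi>)) = 0"
      unfolding wbra[OF k(1)]
    proof (rule sum.neutral, intro ballI)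
      fix l assume l: "l \<in> {1..<k}"
      then have "wproj L (- 1) (k - l) \<chi> = \<zero>\<^bsub>gr L (- 1)\<^esub>"
        using k by (intro filt_wproj[OF \<chi>_filt]) auto
      then show "e (- 1) (bra L 0 (- 1) (u l) (wproj L (- 1) (k - l) \<chi>)) = 0"
        using bra_zero_right[of "u l" 0 "- 1"] wt_carrier[OF _ u, of l] l by simp
    qed
    moreover have "psc (of_nat k - of_nat \<delta>) (e (- 1) (wproj L (- 1) k \<chi>)) = 0"
      using filt_wproj[OF \<chi>_filt k(1)] k by (cases "k = \<delta>") auto
    ultimately have "e (- 1) (wproj L (- 1) k r) = 0"
      unfolding e_wproj_r[OF k(1)] using wproj_dif[OF U(1) k(1)] k by simp
    then show ?thesis using e_eq_0_iff[of "wproj L (- 1) k r" "- 1"] rc k by simp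
  qed
  have r0: "wproj L (- 1) k r = \<zero>\<^bsub>gr L (- 1)\<^esub>" if "1 \<le> k" "k < n + \<delta>" for k
    using r_low[OF that(1)] r_high[of k] res[of k] that by (cases "k \<le> \<delta>") auto
  have rz: "wproj L (- 1) (n + \<delta>) r = z" unfolding z_def using r_high[of "n + \<delta>"] n by simp
  \<comment> \<open>The lowest weight of \<open>r\<close> is n + \<delta>, and both the differential
    and the bracket with the leading component of \<chi> add \<delta>. Larger weights of \<chi>
    would meet components of \<open>r\<close> below n + \<delta>, which are zero.\<close>
  let ?k = "n + \<delta> + \<delta>"
  have k: "1 \<le> ?k" "\<not> ?k \<le> \<delta>" using n by auto
  have \<psi>c: "wproj L (- 1) \<delta> \<chi> \<in> carrier (gr L (- 1))" "z \<in> carrier (gr L (- 1))"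
    using \<chi>_closed \<delta>_pos wt_carrier[OF _ zw] by auto
  have "wproj L (- 2) ?k (bra L (- 1) (- 1) \<chi> r) =
      finsum (gr L (- 2)) (\<lambda>l. bra L (- 1) (- 1) (wproj L (- 1) l \<chi>) (wproj L (- 1) (?k - l) r)) {1..<?k}"
    using wproj_bra[OF \<chi>_closed rc k(1)] by simp
  also have "\<dots> = finsum (gr L (- 2)) (\<lambda>l. if \<delta> = l then bra L (- 1) (- 1) (wproj L (- 1) \<delta> \<chi>) z else \<zero>\<^bsub>gr L (- 2)\<^esub>) {1..<?k}"
  proof (rule G.M.finsum_cong')
    fix l assume l: "l \<in> {1..<?k}"
    consider "l < \<delta>" | "l = \<delta>" | "\<delta> < l" by linarith
    then show "bra L (- 1) (- 1) (wproj L (- 1) l \<chi>) (wproj L (- 1) (?k - l) r) =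
        (if \<delta> = l then bra L (- 1) (- 1) (wproj L (- 1) \<delta> \<chi>) z else \<zero>\<^bsub>gr L (- 2)\<^esub>)"
    proof cases
      case 1
      then have "wproj L (- 1) l \<chi> = \<zero>\<^bsub>gr L (- 1)\<^esub>" using l by (intro filt_wproj[OF \<chi>_filt]) auto
      moreover have "1 \<le> ?k - l" using l by auto
      then have "wproj L (- 1) (?k - l) r \<in> carrier (gr L (- 1))" using rc by (intro wproj_closed)
      ultimately show ?thesis using 1 bra_zero_left[of "wproj L (- 1) (?k - l) r" "- 1" "- 1"] by simp
    next
      case 2
      then show ?thesis using rz by simp
    next
      case 3
      then have "wproj L (- 1) (?k - l) r = \<zero>\<^bsub>gr L (- 1)\<^esub>" using l by (intro r0) auto
      moreover have "wproj L (- 1) l \<chi> \<in> carrier (gr L (- 1))" using \<chi>_closed l by simp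
      ultimately show ?thesis using 3 bra_zero_right[of "wproj L (- 1) l \<chi>" "- 1" "- 1"] by simp
    qed
  qed (use \<psi>c in auto)
  also have "\<dots> = bra L (- 1) (- 1) (wproj L (- 1) \<delta> \<chi>) z"
    by (rule G.M.finsum_singleton) (use \<psi>c n \<delta>_pos in auto)
  finally have wb: "wproj L (- 2) ?k (bra L (- 1) (- 1) \<chi> r) = bra L (- 1) (- 1) (wproj L (- 1) \<delta> \<chi>) z" .
  have wd: "wproj L (- 2) ?k (dif L (- 1) r) = dif L (- 1) z"
    using wproj_dif[OF rc k(1)] n rz by simp
  have "wproj L (- 2) ?k (dif L (- 1) r \<oplus>\<^bsub>gr L (- 2)\<^esub> bra L (- 1) (- 1) \<chi> r) = \<zero>\<^bsub>gr L (- 2)\<^esub>"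
    unfolding cycle by (rule wproj_zero[OF k(1)])
  then show "dif L (- 1) z \<oplus>\<^bsub>gr L (- 2)\<^esub> bra L (- 1) (- 1) (wproj L (- 1) \<delta> \<chi>) z = \<zero>\<^bsub>gr L (- 2)\<^esub>"
    using rc \<chi>_closed k(1) by (simp add: wproj_add wb wd)
qed

theorem rigid_if_trivial_homology:
  assumes triv: "trivial_group (homology (twist L (wproj L (- 1) \<delta> \<chi>)) (- 1))"
  shows "gauge_equiv R L \<chi> (wproj L (- 1) \<delta> \<chi>)"
  unfolding gauge_equiv_lead_iff[OF \<chi>_filt]
proof (rule W.solution_stepwise[OF \<chi>_closed])
  show "wproj L (- 1) k \<chi> = \<zero>\<^bsub>wt_module L (- 1) k\<^esub>" if "1 \<le> k" "k < \<delta>" for k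
    using filt_wproj[OF \<chi>_filt that] by simp
  fix n u assume n: "1 \<le> n" and "\<And>k. 1 \<le> k \<Longrightarrow> u k \<in> carrier (wt_module L 0 k)"
    and "\<And>k. \<lbrakk>\<delta> < k; k < n + \<delta>\<rbrakk> \<Longrightarrow> W.residual u (\<lambda>k. wproj L (- 1) k \<chi>) k = \<zero>\<^bsub>wt_module L (- 1) k\<^esub>"
  then have u: "\<And>k. 1 \<le> k \<Longrightarrow> u k \<in> wt L 0 k"
    and res: "\<And>k. \<lbrakk>\<delta> < k; k < n + \<delta>\<rbrakk> \<Longrightarrow> W.residual u (\<lambda>k. wproj L (- 1) k \<chi>) k = \<zero>\<^bsub>gr L (- 1)\<^esub>"
    by simp_all
  define z where "z = W.residual u (\<lambda>k. wproj L (- 1) k \<chi>) (n + \<delta>)"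
  note z = leading_residual_cycle[of u n, OF u n res, folded z_def]
  have k: "1 \<le> n + \<delta>" using n by simp
  have \<psi>: "wproj L (- 1) \<delta> \<chi> \<in> carrier (gr L (- 1))" "wproj L (- 1) \<delta> \<chi> \<in> wt L (- 1) \<delta>"
    using \<chi>_closed \<delta>_pos wproj_wt by auto
  obtain w where w: "w \<in> carrier (gr L 0)" "z = dif L 0 w \<oplus>\<^bsub>gr L (- 1)\<^esub> bra L (- 1) 0 (wproj L (- 1) \<delta> \<chi>) w"
    using exact_if_trivial_homology[OF triv \<psi>(1) wt_carrier[OF k z(1)] z(2)] by auto
  \<comment> \<open>Vanishing homology gives a primitive \<open>w\<close> with components in all
    weights. Since \<open>z\<close> and \<psi> are homogeneous, projecting to weight n + \<delta>
    keeps only the component of \<open>w\<close> in weight \<open>n\<close>.\<close>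
  define v where "v = wproj L 0 n w"
  have v: "v \<in> wt L 0 n" "v \<in> carrier (gr L 0)" using wproj_wt[OF n w(1)] wt_carrier n by (auto simp: v_def)
  have "z = wproj L (- 1) (n + \<delta>) z" using wproj_same[OF k z(1)] by simp
  also have "\<dots> = wproj L (- 1) (n + \<delta>) (dif L 0 w) \<oplus>\<^bsub>gr L (- 1)\<^esub> wproj L (- 1) (n + \<delta>) (bra L (- 1) 0 (wproj L (- 1) \<delta> \<chi>) w)"
    unfolding w(2) using w(1) \<psi> k by (simp add: wproj_add)
  also have "wproj L (- 1) (n + \<delta>) (dif L 0 w) = dif L 0 v"
    using wproj_dif[OF w(1) k] n by (simp add: v_def)
  also have "wproj L (- 1) (n + \<delta>) (bra L (- 1) 0 (wproj L (- 1) \<delta> \<chi>) w) = bra L (- 1) 0 (wproj L (- 1) \<delta> \<chi>) v"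
    using wproj_bra_homogeneous[OF \<delta>_pos \<psi>(2) w(1) k] n by (simp add: v_def)
  also have "\<dots> = \<ominus>\<^bsub>gr L (- 1)\<^esub> bra L 0 (- 1) v (wproj L (- 1) \<delta> \<chi>)"
    by (rule bra_1_0[OF \<psi>(1) v(2)])
  finally have "z = dif L 0 v \<ominus>\<^bsub>gr L (- 1)\<^esub> bra L 0 (- 1) v (wproj L (- 1) \<delta> \<chi>)"
    by (simp add: a_minus_def)
  also have "\<dots> = dif L 0 v \<ominus>\<^bsub>wt_module L (- 1) (n + \<delta>)\<^esub> bra L 0 (- 1) v (wproj L (- 1) \<delta> \<chi>)"
    by (rule wt_module_minus[symmetric, OF k]) (use bra_wt[OF n \<delta>_pos v(1) \<psi>(2)] in simp)
  finally show "\<exists>v\<in>carrier (wt_module L 0 n). W.residual u (\<lambda>k. wproj L (- 1) k \<chi>) (n + \<delta>) =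
      dif L 0 v \<ominus>\<^bsub>wt_module L (- 1) (n + \<delta>)\<^esub> bra L 0 (- 1) v (wproj L (- 1) \<delta> \<chi>)"
    using v(1) unfolding z_def by auto
qed

end

end

section \<open>Tensor products and base change\<close>

locale tensor_pair = M: Module.module R M + N: Module.module R N
  for R :: "'r ring" and M :: "('r, 'm) module" and N :: "('r, 'n) module"
begin

abbreviation "null \<equiv> tensor_null R M N"
abbreviation "coset \<equiv> tensor_coset R M N"
abbreviation "pure \<equiv> pure_tensor R M N"
abbreviation "T \<equiv> tensor R M N"

lemma free_group: "group (tensor_free M N)"
  by (simp add: tensor_free_def)

lemma rels_carrier: "tensor_rels R M N \<subseteq> carrier (tensor_free M N)"
  unfolding tensor_rels_def tensor_free_def
  by (auto dest!: subsetD[OF keys_diff] split: if_splits)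

lemma null_subgroup: "subgroup null (tensor_free M N)"
  unfolding tensor_null_def by (rule group.generate_is_subgroup[OF free_group rels_carrier])

lemma null_keys: "c \<in> null \<Longrightarrow> Poly_Mapping.keys c \<subseteq> carrier M \<times> carrier N"
  using subgroup.subset[OF null_subgroup] by (auto simp: tensor_free_def free_Abelian_group_def)

lemma null_0: "0 \<in> null"
  using subgroup.one_closed[OF null_subgroup] by (simp add: tensor_free_def)

lemma null_add: "\<lbrakk>c \<in> null; c' \<in> null\<rbrakk> \<Longrightarrow> c + c' \<in> null"
  using subgroup.m_closed[OF null_subgroup, of c c'] by (simp add: tensor_free_def)

lemma null_minus: "c \<in> null \<Longrightarrow> - c \<in> null"
  using subgroup.m_inv_closed[OF null_subgroup, of c] null_keys[of c] by (simp add: tensor_free_def)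

lemma null_diff: "\<lbrakk>c \<in> null; c' \<in> null\<rbrakk> \<Longrightarrow> c - c' \<in> null"
  using null_add[OF _ null_minus] by fastforce

lemma null_rel: "c \<in> tensor_rels R M N \<Longrightarrow> c \<in> null"
  unfolding tensor_null_def by (rule generate.incl)

text \<open>A set containing 0 and closed under differences is a subgroup, so an additive map is
  controlled on \<open>null\<close> by its values on the bilinearity relations.\<close>

lemma null_image:
  assumes diff: "\<And>a b. F (a - b) = F a - (F b :: 'c::ab_group_add)"
    and rel: "\<And>c. c \<in> tensor_rels R M N \<Longrightarrow> F c \<in> K"
    and K: "0 \<in> K" "\<And>a b. \<lbrakk>a \<in> K; b \<in> K\<rbrakk> \<Longrightarrow> a - b \<in> K"
    and c: "c \<in> null"
  shows "F c \<in> K"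
proof -
  have F0: "F 0 = 0" using diff[of 0 0] by simp
  have Km: "- a \<in> K" if "a \<in> K" for a using K(2)[OF K(1) that] by simp
  have Fm: "F (- a) = - F a" for a using diff[of 0 a] F0 by simp
  have Fa: "F (a + b) = F a + F b" for a b using diff[of a "- b"] Fm by simp
  show ?thesis
    using c unfolding tensor_null_def
  proof (induction rule: generate.induct)
    case one
    then show ?case by (simp add: tensor_free_def F0 K)
  next
    case (incl h)
    then show ?case by (rule rel)
  next
    case (inv h)
    then have "inv\<^bsub>tensor_free M N\<^esub> h = - h"
      using rels_carrier by (auto simp: tensor_free_def)
    then show ?case using Km[OF rel[OF inv]] by (simp add: Fm)
  next
    case (eng h1 h2)
    then show ?case using K(2)[OF eng.IH(1) Km[OF eng.IH(2)]] by (simp add: tensor_free_def Fa)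
  qed
qed

lemma mem_coset: "x \<in> coset c \<longleftrightarrow> x - c \<in> null"
  unfolding tensor_coset_def r_coset_def by (auto simp: tensor_free_def) (metis diff_add_cancel)

lemma coset_eq_iff: "coset c = coset c' \<longleftrightarrow> c - c' \<in> null"
proof
  assume "coset c = coset c'"
  then show "c - c' \<in> null" using mem_coset[of c c] mem_coset[of c c'] null_0 by simp
next
  assume *: "c - c' \<in> null"
  show "coset c = coset c'"
  proof (rule Set.set_eqI)
    fix x
    have "x - c \<in> null \<longleftrightarrow> x - c' \<in> null"
      using null_add[OF _ *, of "x - c"] null_diff[OF _ *, of "x - c'"] by auto
    then show "x \<in> coset c \<longleftrightarrow> x \<in> coset c'" by (simp add: mem_coset)
  qed
qed

lemma null_eq_coset: "null = coset 0"
  by (auto simp: mem_coset)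

lemma T_carrier: "carrier T = coset ` {c. Poly_Mapping.keys c \<subseteq> carrier M \<times> carrier N}"
  by (auto simp: tensor_def FactGroup_def RCOSETS_def tensor_coset_def tensor_free_def free_Abelian_group_def)

lemma T_one: "\<one>\<^bsub>T\<^esub> = coset 0"
  by (simp add: tensor_def FactGroup_def null_eq_coset[symmetric])

lemma T_mult: "coset c \<otimes>\<^bsub>T\<^esub> coset c' = coset (c + c')"
proof (rule Set.set_eqI)
  fix x
  have "coset c \<otimes>\<^bsub>T\<^esub> coset c' = {a + b | a b. a \<in> coset c \<and> b \<in> coset c'}"
    by (auto simp: tensor_def FactGroup_def set_mult_def tensor_free_def)
  moreover have "x - (c + c') \<in> null" if "x = a + b" "a - c \<in> null" "b - c' \<in> null" for a b
    using null_add[OF that(2,3)] that(1) by (simp add: algebra_simps)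
  moreover have "\<exists>a b. x = a + b \<and> a - c \<in> null \<and> b - c' \<in> null" if "x - (c + c') \<in> null"
    by (rule exI[of _ "x - c'"], rule exI[of _ c']) (use that null_0 in \<open>simp add: algebra_simps\<close>)
  ultimately show "x \<in> coset c \<otimes>\<^bsub>T\<^esub> coset c' \<longleftrightarrow> x \<in> coset (c + c')"
    by (auto simp: mem_coset)
qed

lemma T_comm_group: "comm_group T"
proof -
  have keys: "Poly_Mapping.keys (a + b) \<subseteq> X" if "Poly_Mapping.keys a \<subseteq> X" "Poly_Mapping.keys b \<subseteq> X" for a b :: "'m \<times> 'n \<Rightarrow>\<^sub>0 int" and X
    using that keys_add[of a b] by blast
  show ?thesis
  proof (rule comm_groupI)
    fix x assume "x \<in> carrier T"
    then obtain c where c: "Poly_Mapping.keys c \<subseteq> carrier M \<times> carrier N" "x = coset c" by (auto simp: T_carrier)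
    then show "\<exists>y\<in>carrier T. y \<otimes>\<^bsub>T\<^esub> x = \<one>\<^bsub>T\<^esub>"
      by (intro bexI[of _ "coset (- c)"]) (auto simp: T_carrier T_mult T_one)
  qed (auto simp: T_carrier T_mult T_one keys add_ac)
qed

lemma pure_closed: "\<lbrakk>x \<in> carrier M; y \<in> carrier N\<rbrakk> \<Longrightarrow> pure x y \<in> carrier T"
  by (auto simp: T_carrier pure_tensor_def)

lemma pure_add_left: "\<lbrakk>x \<in> carrier M; x' \<in> carrier M; y \<in> carrier N\<rbrakk> \<Longrightarrow>
    pure (x \<oplus>\<^bsub>M\<^esub> x') y = pure x y \<otimes>\<^bsub>T\<^esub> pure x' y"
  unfolding pure_tensor_def T_mult coset_eq_iff
  by (rule null_rel) (auto simp: tensor_rels_def diff_diff_eq[symmetric])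

lemma pure_add_right: "\<lbrakk>x \<in> carrier M; y \<in> carrier N; y' \<in> carrier N\<rbrakk> \<Longrightarrow>
    pure x (y \<oplus>\<^bsub>N\<^esub> y') = pure x y \<otimes>\<^bsub>T\<^esub> pure x y'"
  unfolding pure_tensor_def T_mult coset_eq_iff
  by (rule null_rel) (auto simp: tensor_rels_def diff_diff_eq[symmetric])

lemma pure_balanced: "\<lbrakk>a \<in> carrier R; x \<in> carrier M; y \<in> carrier N\<rbrakk> \<Longrightarrow>
    pure (a \<odot>\<^bsub>M\<^esub> x) y = pure x (a \<odot>\<^bsub>N\<^esub> y)"
  unfolding pure_tensor_def coset_eq_iff by (rule null_rel) (auto simp: tensor_rels_def)

lemma pure_zero_left: "y \<in> carrier N \<Longrightarrow> pure \<zero>\<^bsub>M\<^esub> y = \<one>\<^bsub>T\<^esub>"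
proof -
  assume y: "y \<in> carrier N"
  interpret T: comm_group T by (rule T_comm_group)
  show ?thesis
    using pure_add_left[of "\<zero>\<^bsub>M\<^esub>" "\<zero>\<^bsub>M\<^esub>" y] pure_closed[of "\<zero>\<^bsub>M\<^esub>" y] y by simp
qed

lemma pure_minus_left: "\<lbrakk>x \<in> carrier M; y \<in> carrier N\<rbrakk> \<Longrightarrow> pure (\<ominus>\<^bsub>M\<^esub> x) y = coset (- frag_of (x, y))"
proof -
  assume xy: "x \<in> carrier M" "y \<in> carrier N"
  have "coset (frag_of (\<ominus>\<^bsub>M\<^esub> x, y) + frag_of (x, y)) = coset 0"
    using pure_add_left[of "\<ominus>\<^bsub>M\<^esub> x" x y] pure_zero_left[of y] xy
    by (simp add: M.M.l_neg pure_tensor_def T_mult T_one)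
  then show ?thesis by (simp add: pure_tensor_def coset_eq_iff)
qed

text \<open>The negative of a pure tensor is the pure tensor of -x and y, so integer combinations of
  generators are sums of pure tensors.\<close>

lemma tensor_induct [consumes 1, case_names pure mult]:
  assumes t: "t \<in> carrier T"
    and pure: "\<And>x y. \<lbrakk>x \<in> carrier M; y \<in> carrier N\<rbrakk> \<Longrightarrow> P (pure x y)"
    and mult: "\<And>a b. \<lbrakk>a \<in> carrier T; b \<in> carrier T; P a; P b\<rbrakk> \<Longrightarrow> P (a \<otimes>\<^bsub>T\<^esub> b)"
  shows "P t"
proof -
  obtain c where c: "Poly_Mapping.keys c \<subseteq> carrier M \<times> carrier N" "t = coset c"
    using t by (auto simp: T_carrier)
  \<comment> \<open>Induction on the free abelian group proceeds by differences; claiming both signs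
    at once turns them into sums.\<close>
  have "P (coset c) \<and> P (coset (- c))"
    using c(1)
  proof (induction c rule: free_Abelian_group_induct[consumes 1, case_names 1 2 3])
    case 1
    then show ?case using pure[of "\<zero>\<^bsub>M\<^esub>" "\<zero>\<^bsub>N\<^esub>"] pure_zero_left[of "\<zero>\<^bsub>N\<^esub>"] by (simp add: T_one)
  next
    case (2 x y)
    have c: "coset x \<in> carrier T" "coset y \<in> carrier T" "coset (- x) \<in> carrier T" "coset (- y) \<in> carrier T"
      using 2 by (auto simp: T_carrier)
    show ?case
      using mult[of "coset x" "coset (- y)"] mult[of "coset y" "coset (- x)"] c 2 by (simp add: T_mult)
  next
    case (3 a)
    then show ?case
      using pure[of "fst a" "snd a"] pure[of "\<ominus>\<^bsub>M\<^esub> fst a" "snd a"] pure_minus_left[of "fst a" "snd a"]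
      by (auto simp: pure_tensor_def)
  qed
  then show ?thesis using c by simp
qed

end

lemma the_elem_constant: "\<lbrakk>c \<in> C; \<And>x. x \<in> C \<Longrightarrow> F x = F c\<rbrakk> \<Longrightarrow> the_elem (F ` C) = F c"
  by (metis (no_types, lifting) image_cong image_constant the_elem_eq)

lemma lin_rels:
  assumes f: "f \<in> lin_maps R M M'" and g: "g \<in> lin_maps R N N'" and c: "c \<in> tensor_rels R M N"
  shows "frag_extend (\<lambda>(x, y). frag_of (f x, g y)) c \<in> tensor_rels R M' N'"
proof -
  from c consider
    (left) x x' y where "c = frag_of (x \<oplus>\<^bsub>M\<^esub> x', y) - frag_of (x, y) - frag_of (x', y)" "x \<in> carrier M" "x' \<in> carrier M" "y \<in> carrier N"
    | (right) x y y' where "c = frag_of (x, y \<oplus>\<^bsub>N\<^esub> y') - frag_of (x, y) - frag_of (x, y')" "x \<in> carrier M" "y \<in> carrier N" "y' \<in> carrier N"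
    | (bal) a x y where "c = frag_of (a \<odot>\<^bsub>M\<^esub> x, y) - frag_of (x, a \<odot>\<^bsub>N\<^esub> y)" "a \<in> carrier R" "x \<in> carrier M" "y \<in> carrier N"
    unfolding tensor_rels_def by blast
  then show ?thesis
  proof cases
    case left
    then have "f x \<in> carrier M'" "f x' \<in> carrier M'" "g y \<in> carrier N'" "f (x \<oplus>\<^bsub>M\<^esub> x') = f x \<oplus>\<^bsub>M'\<^esub> f x'"
      using f g by (auto simp: lin_maps_def)
    with left show ?thesis by (auto simp: frag_extend_diff tensor_rels_def)
  next
    case right
    then have "f x \<in> carrier M'" "g y \<in> carrier N'" "g y' \<in> carrier N'" "g (y \<oplus>\<^bsub>N\<^esub> y') = g y \<oplus>\<^bsub>N'\<^esub> g y'"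
      using f g by (auto simp: lin_maps_def)
    with right show ?thesis by (auto simp: frag_extend_diff tensor_rels_def)
  next
    case bal
    then have "f x \<in> carrier M'" "g y \<in> carrier N'" "f (a \<odot>\<^bsub>M\<^esub> x) = a \<odot>\<^bsub>M'\<^esub> f x" "g (a \<odot>\<^bsub>N\<^esub> y) = a \<odot>\<^bsub>N'\<^esub> g y"
      using f g by (auto simp: lin_maps_def)
    with bal show ?thesis by (auto simp: frag_extend_diff tensor_rels_def)
  qed
qed

lemma keys_frag_extend_subset:
  assumes "\<And>x. x \<in> Poly_Mapping.keys c \<Longrightarrow> Poly_Mapping.keys (F x) \<subseteq> X"
  shows "Poly_Mapping.keys (frag_extend F c) \<subseteq> X"
  using keys_frag_extend[of F c] assms by blast

locale tensor_lin = MN: tensor_pair R M N + MN': tensor_pair R M' N'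
  for R :: "'r ring" and M :: "('r, 'm) module" and N :: "('r, 'n) module"
    and M' :: "('r, 'p) module" and N' :: "('r, 'q) module" +
  fixes f g
  assumes f: "f \<in> lin_maps R M M'" and g: "g \<in> lin_maps R N N'"
begin

abbreviation "ext \<equiv> frag_extend (\<lambda>(x, y). frag_of (f x, g y))"

lemma ext_null: "c \<in> MN.null \<Longrightarrow> ext c \<in> MN'.null"
  by (rule MN.null_image[where F = ext])
    (auto simp: frag_extend_diff MN'.null_0 MN'.null_diff intro!: MN'.null_rel lin_rels[OF f g])

lemma map_coset: "tensor_map R M' N' f g (MN.coset c) = MN'.coset (ext c)"
  unfolding tensor_map_def
proof (rule the_elem_constant)
  show "c \<in> MN.coset c" by (simp add: MN.mem_coset MN.null_0)
  fix x assume "x \<in> MN.coset c"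
  then have "ext (x - c) \<in> MN'.null" by (intro ext_null) (simp add: MN.mem_coset)
  then show "MN'.coset (ext x) = MN'.coset (ext c)"
    by (simp add: MN'.coset_eq_iff frag_extend_diff)
qed

lemma map_pure: "tensor_map R M' N' f g (MN.pure x y) = MN'.pure (f x) (g y)"
  by (simp add: pure_tensor_def map_coset)

lemma map_closed: "t \<in> carrier MN.T \<Longrightarrow> tensor_map R M' N' f g t \<in> carrier MN'.T"
proof -
  assume "t \<in> carrier MN.T"
  then obtain c where c: "Poly_Mapping.keys c \<subseteq> carrier M \<times> carrier N" "t = MN.coset c" by (auto simp: MN.T_carrier)
  have "Poly_Mapping.keys (ext c) \<subseteq> carrier M' \<times> carrier N'"
    by (rule keys_frag_extend_subset) (use c f g in \<open>auto simp: lin_maps_def\<close>)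
  then show ?thesis using c by (auto simp: map_coset MN'.T_carrier)
qed

lemma map_mult: "\<lbrakk>s \<in> carrier MN.T; t \<in> carrier MN.T\<rbrakk> \<Longrightarrow>
    tensor_map R M' N' f g (s \<otimes>\<^bsub>MN.T\<^esub> t) = tensor_map R M' N' f g s \<otimes>\<^bsub>MN'.T\<^esub> tensor_map R M' N' f g t"
  by (auto simp: MN.T_carrier MN.T_mult map_coset MN'.T_mult frag_extend_add)

end

locale tensor_bilin = A: tensor_pair R M N + B: tensor_pair R M2 N2 + C: tensor_pair R P Q
  for R :: "'r ring" and M :: "('r, 'm) module" and N :: "('r, 'n) module"
    and M2 :: "('r, 'm2) module" and N2 :: "('r, 'n2) module"
    and P :: "('r, 'p) module" and Q :: "('r, 'q) module" +
  fixes f g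
  assumes f: "f \<in> bilin_maps R M M2 P" and g: "g \<in> bilin_maps R N N2 Q"
begin

abbreviation "ext2 d \<equiv> frag_extend (\<lambda>(x, y). frag_extend (\<lambda>(x', y'). frag_of (f x x', g y y')) d)"

lemma ext_left: "ext2 d (c + c') = ext2 d c + ext2 d c'" "ext2 d (c - c') = ext2 d c - ext2 d c'"
  by (simp_all add: frag_extend_add frag_extend_diff)

text \<open>\<open>ext2 d c\<close> is additive in \<open>c\<close> by construction; additivity in
  \<open>d\<close> has to be derived generator by generator of \<open>c\<close>.\<close>

lemma ext_right: "ext2 (d - d') c = ext2 d c - ext2 d' c"
proof (induction c rule: frag_induction[where S = UNIV, OF subset_UNIV, case_names zero one diff])
  case (one x)
  then show ?case by (cases x) (simp add: frag_extend_diff)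
next
  case (diff a b)
  then show ?case by (simp add: frag_extend_diff)
qed simp_all

lemma ext_right_add: "ext2 (d + d') c = ext2 d c + ext2 d' c"
  using ext_right[of "d + d'" d' c] by (simp add: algebra_simps)

text \<open>Freezing a generator of the second factor makes \<open>f\<close> and \<open>g\<close>
  linear, so \<open>tensor_lin.ext_null\<close> applies; additivity in \<open>d\<close> does the
  rest.\<close>

lemma ext_null_left:
  assumes "c \<in> A.null" "Poly_Mapping.keys d \<subseteq> carrier M2 \<times> carrier N2"
  shows "ext2 d c \<in> C.null"
  using assms(2)
proof (induction d rule: free_Abelian_group_induct[consumes 1, case_names 1 2 3])
  case 1
  have "ext2 0 c = 0" using ext_right[of 0 0 c] by simp
  show ?case unfolding \<open>ext2 0 c = 0\<close> by (rule C.null_0)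
next
  case (2 x y)
  then show ?case by (simp add: ext_right C.null_diff)
next
  case (3 a)
  then obtain x' y' where a: "a = (x', y')" "x' \<in> carrier M2" "y' \<in> carrier N2" by auto
  interpret l: tensor_lin R M N P Q "\<lambda>x. f x x'" "\<lambda>y. g y y'"
    by unfold_locales (use f g a in \<open>auto simp: bilin_maps_def\<close>)
  show ?case using l.ext_null[OF assms(1)] by (simp add: a)
qed

lemma ext_null_right:
  assumes "d \<in> B.null" "Poly_Mapping.keys c \<subseteq> carrier M \<times> carrier N"
  shows "ext2 d c \<in> C.null"
  using assms(2)
proof (induction c rule: free_Abelian_group_induct[consumes 1, case_names 1 2 3])
  case 1
  then show ?case by (simp add: C.null_0)
next
  case (2 x y)
  then show ?case by (simp add: ext_left C.null_diff)
next
  case (3 a)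
  then obtain x y where a: "a = (x, y)" "x \<in> carrier M" "y \<in> carrier N" by auto
  interpret l: tensor_lin R M2 N2 P Q "f x" "g y"
    by unfold_locales (use f g a in \<open>auto simp: bilin_maps_def\<close>)
  show ?case using l.ext_null[OF assms(1)] by (simp add: a)
qed

lemma map2_coset:
  assumes c: "Poly_Mapping.keys c \<subseteq> carrier M \<times> carrier N" and d: "Poly_Mapping.keys d \<subseteq> carrier M2 \<times> carrier N2"
  shows "tensor_map2 R P Q f g (A.coset c) (B.coset d) = C.coset (ext2 d c)"
proof -
  have "the_elem ((\<lambda>(c, d). C.coset (ext2 d c)) ` (A.coset c \<times> B.coset d)) = (\<lambda>(c, d). C.coset (ext2 d c)) (c, d)"
  proof (rule the_elem_constant)
    show "(c, d) \<in> A.coset c \<times> B.coset d" by (simp add: A.mem_coset B.mem_coset A.null_0 B.null_0)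
    fix x assume "x \<in> A.coset c \<times> B.coset d"
    then obtain c' d' where x: "x = (c', d')" "c' - c \<in> A.null" "d' - d \<in> B.null"
      by (auto simp: A.mem_coset B.mem_coset)
    have d': "Poly_Mapping.keys d' \<subseteq> carrier M2 \<times> carrier N2"
      using keys_add[of "d' - d" d] B.null_keys[OF x(3)] d by auto
    \<comment> \<open>The representatives are exchanged one argument at a time; the mixed terms
      telescope.\<close>
    have "ext2 d' (c' - c) + ext2 (d' - d) c \<in> C.null"
      using ext_null_left[OF x(2) d'] ext_null_right[OF x(3) c] by (rule C.null_add)
    then have "ext2 d' c' - ext2 d c \<in> C.null"
      by (simp add: ext_left ext_right)
    then show "(\<lambda>(c, d). C.coset (ext2 d c)) x = (\<lambda>(c, d). C.coset (ext2 d c)) (c, d)"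
      by (simp add: x C.coset_eq_iff)
  qed
  then show ?thesis unfolding tensor_map2_def by simp
qed

lemma map2_pure:
  "\<lbrakk>x \<in> carrier M; y \<in> carrier N; x' \<in> carrier M2; y' \<in> carrier N2\<rbrakk> \<Longrightarrow>
    tensor_map2 R P Q f g (A.pure x y) (B.pure x' y') = C.pure (f x x') (g y y')"
  by (simp add: pure_tensor_def map2_coset)

lemma map2_closed:
  assumes "s \<in> carrier A.T" "t \<in> carrier B.T"
  shows "tensor_map2 R P Q f g s t \<in> carrier C.T"
proof -
  obtain c d where c: "Poly_Mapping.keys c \<subseteq> carrier M \<times> carrier N" "s = A.coset c"
    and d: "Poly_Mapping.keys d \<subseteq> carrier M2 \<times> carrier N2" "t = B.coset d"
    using assms by (auto simp: A.T_carrier B.T_carrier)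
  have "Poly_Mapping.keys (ext2 d c) \<subseteq> carrier P \<times> carrier Q"
  proof (rule keys_frag_extend_subset)
    fix x assume "x \<in> Poly_Mapping.keys c"
    then have x: "fst x \<in> carrier M" "snd x \<in> carrier N" using c by auto
    have "Poly_Mapping.keys (frag_extend (\<lambda>(x', y'). frag_of (f (fst x) x', g (snd x) y')) d) \<subseteq> carrier P \<times> carrier Q"
      by (rule keys_frag_extend_subset) (use x d f g in \<open>auto simp: bilin_maps_def lin_maps_def Pi_def\<close>)
    then show "Poly_Mapping.keys (case x of (x, y) \<Rightarrow> frag_extend (\<lambda>(x', y'). frag_of (f x x', g y y')) d) \<subseteq> carrier P \<times> carrier Q"
      by (simp add: case_prod_unfold)
  qed
  then show ?thesis by (auto simp: c d map2_coset C.T_carrier)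
qed

lemma map2_mult_left:
  assumes "s \<in> carrier A.T" "s' \<in> carrier A.T" "t \<in> carrier B.T"
  shows "tensor_map2 R P Q f g (s \<otimes>\<^bsub>A.T\<^esub> s') t = tensor_map2 R P Q f g s t \<otimes>\<^bsub>C.T\<^esub> tensor_map2 R P Q f g s' t"
proof -
  obtain c c' d where cd: "Poly_Mapping.keys c \<subseteq> carrier M \<times> carrier N" "s = A.coset c"
    "Poly_Mapping.keys c' \<subseteq> carrier M \<times> carrier N" "s' = A.coset c'"
    "Poly_Mapping.keys d \<subseteq> carrier M2 \<times> carrier N2" "t = B.coset d"
    using assms by (auto simp: A.T_carrier B.T_carrier)
  then have "Poly_Mapping.keys (c + c') \<subseteq> carrier M \<times> carrier N"
    using keys_add[of c c'] by blast
  then show ?thesis using cd by (simp add: A.T_mult map2_coset C.T_mult ext_left)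
qed

lemma map2_mult_right:
  assumes "s \<in> carrier A.T" "t \<in> carrier B.T" "t' \<in> carrier B.T"
  shows "tensor_map2 R P Q f g s (t \<otimes>\<^bsub>B.T\<^esub> t') = tensor_map2 R P Q f g s t \<otimes>\<^bsub>C.T\<^esub> tensor_map2 R P Q f g s t'"
proof -
  obtain c d d' where cd: "Poly_Mapping.keys c \<subseteq> carrier M \<times> carrier N" "s = A.coset c"
    "Poly_Mapping.keys d \<subseteq> carrier M2 \<times> carrier N2" "t = B.coset d"
    "Poly_Mapping.keys d' \<subseteq> carrier M2 \<times> carrier N2" "t' = B.coset d'"
    using assms by (auto simp: A.T_carrier B.T_carrier)
  then have "Poly_Mapping.keys (d + d') \<subseteq> carrier M2 \<times> carrier N2"
    using keys_add[of d d'] by blast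
  then show ?thesis using cd by (simp add: B.T_mult map2_coset C.T_mult ext_right_add)
qed

end

section \<open>Extension of scalars along a ring homomorphism\<close>

locale base_ring_change = R: cring R + S: cring S for R :: "'r ring" and S :: "'s ring" +
  fixes h assumes h: "h \<in> ring_hom R S"
begin

abbreviation "N \<equiv> restrict_scalars S h"

lemma N_simps [simp]: "carrier N = carrier S" "x \<oplus>\<^bsub>N\<^esub> y = x \<oplus>\<^bsub>S\<^esub> y" "\<zero>\<^bsub>N\<^esub> = \<zero>\<^bsub>S\<^esub>"
  "a \<odot>\<^bsub>N\<^esub> x = h a \<otimes>\<^bsub>S\<^esub> x"
  by (simp_all add: restrict_scalars_def)

lemma N_module: "Module.module R N"
proof (rule moduleI)
  show "cring R" by (rule R.is_cring)
  show "abelian_group N"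
  proof (rule abelian_groupI)
    show "\<exists>y\<in>carrier N. y \<oplus>\<^bsub>N\<^esub> x = \<zero>\<^bsub>N\<^esub>" if "x \<in> carrier N" for x
      using that by (intro bexI[of _ "\<ominus>\<^bsub>S\<^esub> x"]) (simp_all add: S.l_neg)
  qed (simp_all add: S.a_ac)
qed (use ring_hom_closed[OF h] ring_hom_add[OF h] ring_hom_mult[OF h] ring_hom_one[OF h] in
    \<open>auto simp: S.l_distr S.r_distr S.m_assoc\<close>)

lemma mult_bilinear: "monoid.mult S \<in> bilin_maps R N N N"
  using ring_hom_closed[OF h] by (auto simp: bilin_maps_def lin_maps_def S.l_distr S.r_distr S.m_assoc S.m_lcomm)

lemma mult_linear: "s \<in> carrier S \<Longrightarrow> monoid.mult S s \<in> lin_maps R N N"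
  using mult_bilinear by (auto simp: bilin_maps_def)

lemma id_linear: "id \<in> lin_maps R M M"
  by (auto simp: lin_maps_def)

abbreviation "E M \<equiv> extend_scalars R S h M"

lemma E_simps:
  "carrier (E M) = carrier (tensor R M N)" "x \<oplus>\<^bsub>E M\<^esub> y = x \<otimes>\<^bsub>tensor R M N\<^esub> y" "\<zero>\<^bsub>E M\<^esub> = \<one>\<^bsub>tensor R M N\<^esub>"
  "s \<odot>\<^bsub>E M\<^esub> x = tensor_map R M N id (\<lambda>t. s \<otimes>\<^bsub>S\<^esub> t) x"
  by (simp_all add: extend_scalars_def)

lemma pair: "Module.module R M \<Longrightarrow> tensor_pair R M N"
  using N_module by (simp add: tensor_pair_def)

lemma E_abelian_group:
  assumes "Module.module R M"
  shows "abelian_group (E M)"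
proof -
  interpret T: comm_group "tensor R M N" by (rule tensor_pair.T_comm_group[OF pair[OF assms]])
  show ?thesis
  proof (rule abelian_groupI)
    show "\<exists>y\<in>carrier (E M). y \<oplus>\<^bsub>E M\<^esub> x = \<zero>\<^bsub>E M\<^esub>" if "x \<in> carrier (E M)" for x
      using that by (intro bexI[of _ "inv\<^bsub>tensor R M N\<^esub> x"]) (simp_all add: E_simps)
  qed (simp_all add: E_simps T.m_ac)
qed

lemma E_induct [consumes 2, case_names pure add]:
  assumes M: "Module.module R M" and t: "t \<in> carrier (E M)"
    and "\<And>x y. \<lbrakk>x \<in> carrier M; y \<in> carrier S\<rbrakk> \<Longrightarrow> P (pure_tensor R M N x y)"
    and "\<And>a b. \<lbrakk>a \<in> carrier (E M); b \<in> carrier (E M); P a; P b\<rbrakk> \<Longrightarrow> P (a \<oplus>\<^bsub>E M\<^esub> b)"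
  shows "P t"
proof (rule tensor_pair.tensor_induct[OF pair[OF M]])
  show "t \<in> carrier (tensor R M N)" using t by (simp add: E_simps)
qed (use assms(3,4) in \<open>simp_all add: E_simps\<close>)

lemma pure_E:
  assumes M: "Module.module R M"
  shows pure_E_closed: "\<lbrakk>x \<in> carrier M; y \<in> carrier S\<rbrakk> \<Longrightarrow> pure_tensor R M N x y \<in> carrier (E M)"
    and pure_E_add_left: "\<lbrakk>x \<in> carrier M; x' \<in> carrier M; y \<in> carrier S\<rbrakk> \<Longrightarrow>
      pure_tensor R M N (x \<oplus>\<^bsub>M\<^esub> x') y = pure_tensor R M N x y \<oplus>\<^bsub>E M\<^esub> pure_tensor R M N x' y"
    and pure_E_add_right: "\<lbrakk>x \<in> carrier M; y \<in> carrier S; y' \<in> carrier S\<rbrakk> \<Longrightarrow>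
      pure_tensor R M N x (y \<oplus>\<^bsub>S\<^esub> y') = pure_tensor R M N x y \<oplus>\<^bsub>E M\<^esub> pure_tensor R M N x y'"
    and pure_E_zero_left: "y \<in> carrier S \<Longrightarrow> pure_tensor R M N \<zero>\<^bsub>M\<^esub> y = \<zero>\<^bsub>E M\<^esub>"
  using tensor_pair.pure_closed[OF pair[OF M]] tensor_pair.pure_add_left[OF pair[OF M]]
    tensor_pair.pure_add_right[OF pair[OF M]] tensor_pair.pure_zero_left[OF pair[OF M]]
  by (simp_all add: E_simps)

lemma tensor_lin_E:
  "\<lbrakk>Module.module R M; Module.module R M'; f \<in> lin_maps R M M'; g \<in> lin_maps R N N\<rbrakk> \<Longrightarrow> tensor_lin R M N M' N f g"
  by (simp add: tensor_lin_def tensor_lin_axioms_def pair)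

lemma lin_E:
  assumes M: "Module.module R M" and M': "Module.module R M'" and f: "f \<in> lin_maps R M M'" and g: "g \<in> lin_maps R N N"
  shows map_E_closed: "t \<in> carrier (E M) \<Longrightarrow> tensor_map R M' N f g t \<in> carrier (E M')"
    and map_E_add: "\<lbrakk>s \<in> carrier (E M); t \<in> carrier (E M)\<rbrakk> \<Longrightarrow>
      tensor_map R M' N f g (s \<oplus>\<^bsub>E M\<^esub> t) = tensor_map R M' N f g s \<oplus>\<^bsub>E M'\<^esub> tensor_map R M' N f g t"
    and map_E_pure: "tensor_map R M' N f g (pure_tensor R M N x y) = pure_tensor R M' N (f x) (g y)"
  using tensor_lin.map_closed[OF tensor_lin_E[OF assms]] tensor_lin.map_mult[OF tensor_lin_E[OF assms]]
    tensor_lin.map_pure[OF tensor_lin_E[OF assms]]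
  by (simp_all add: E_simps)

lemma tensor_bilin_E:
  "\<lbrakk>Module.module R M; Module.module R M2; Module.module R P; f \<in> bilin_maps R M M2 P\<rbrakk> \<Longrightarrow>
    tensor_bilin R M N M2 N P N f (monoid.mult S)"
  by (simp add: tensor_bilin_def tensor_bilin_axioms_def pair mult_bilinear)

lemma bilin_E:
  assumes M: "Module.module R M" and M2: "Module.module R M2" and P: "Module.module R P" and f: "f \<in> bilin_maps R M M2 P"
  defines "b \<equiv> tensor_map2 R P N f (monoid.mult S)"
  shows map2_E_closed: "\<lbrakk>s \<in> carrier (E M); t \<in> carrier (E M2)\<rbrakk> \<Longrightarrow> b s t \<in> carrier (E P)"
    and map2_E_add_left: "\<lbrakk>s \<in> carrier (E M); s' \<in> carrier (E M); t \<in> carrier (E M2)\<rbrakk> \<Longrightarrow>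
      b (s \<oplus>\<^bsub>E M\<^esub> s') t = b s t \<oplus>\<^bsub>E P\<^esub> b s' t"
    and map2_E_add_right: "\<lbrakk>s \<in> carrier (E M); t \<in> carrier (E M2); t' \<in> carrier (E M2)\<rbrakk> \<Longrightarrow>
      b s (t \<oplus>\<^bsub>E M2\<^esub> t') = b s t \<oplus>\<^bsub>E P\<^esub> b s t'"
    and map2_E_pure: "\<lbrakk>x \<in> carrier M; y \<in> carrier S; x' \<in> carrier M2; y' \<in> carrier S\<rbrakk> \<Longrightarrow>
      b (pure_tensor R M N x y) (pure_tensor R M2 N x' y') = pure_tensor R P N (f x x') (y \<otimes>\<^bsub>S\<^esub> y')"
  using tensor_bilin.map2_closed[OF tensor_bilin_E[OF M M2 P f]] tensor_bilin.map2_mult_left[OF tensor_bilin_E[OF M M2 P f]]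
    tensor_bilin.map2_mult_right[OF tensor_bilin_E[OF M M2 P f]] tensor_bilin.map2_pure[OF tensor_bilin_E[OF M M2 P f]]
  by (simp_all add: E_simps b_def)

text \<open>The laws that involve a single tensor are additive in it, so they are checked on pure
  tensors.\<close>

lemma E_module:
  assumes M: "Module.module R M"
  shows "Module.module S (E M)"
proof (rule moduleI)
  show "cring S" by (rule S.is_cring)
  show "abelian_group (E M)" by (rule E_abelian_group[OF M])
  then interpret E: abelian_group "E M" .
  note lin = lin_E[OF M M id_linear mult_linear]
  have cl: "a \<odot>\<^bsub>E M\<^esub> x \<in> carrier (E M)" if "a \<in> carrier S" "x \<in> carrier (E M)" for a x
    using lin(1)[OF that] by (simp add: E_simps)
  have radd: "a \<odot>\<^bsub>E M\<^esub> (x \<oplus>\<^bsub>E M\<^esub> y) = a \<odot>\<^bsub>E M\<^esub> x \<oplus>\<^bsub>E M\<^esub> a \<odot>\<^bsub>E M\<^esub> y"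
    if "a \<in> carrier S" "x \<in> carrier (E M)" "y \<in> carrier (E M)" for a x y
    using lin(2)[OF that] by (simp add: E_simps)
  have smult_pure: "a \<odot>\<^bsub>E M\<^esub> pure_tensor R M N x y = pure_tensor R M N x (a \<otimes>\<^bsub>S\<^esub> y)" if "a \<in> carrier S" for a x y
    using lin(3)[OF that] by (simp add: E_simps)
  show "a \<odot>\<^bsub>E M\<^esub> x \<in> carrier (E M)" if "a \<in> carrier S" "x \<in> carrier (E M)" for a x
    by (rule cl[OF that])
  show "a \<odot>\<^bsub>E M\<^esub> (x \<oplus>\<^bsub>E M\<^esub> y) = a \<odot>\<^bsub>E M\<^esub> x \<oplus>\<^bsub>E M\<^esub> a \<odot>\<^bsub>E M\<^esub> y"
    if "a \<in> carrier S" "x \<in> carrier (E M)" "y \<in> carrier (E M)" for a x y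
    by (rule radd[OF that])
  show "(a \<oplus>\<^bsub>S\<^esub> b) \<odot>\<^bsub>E M\<^esub> x = a \<odot>\<^bsub>E M\<^esub> x \<oplus>\<^bsub>E M\<^esub> b \<odot>\<^bsub>E M\<^esub> x"
    if a: "a \<in> carrier S" and b: "b \<in> carrier S" and x: "x \<in> carrier (E M)" for a b x
    using M x
  proof (induction rule: E_induct)
    case (pure x y)
    then show ?case using a b pure_E_add_right[OF M] by (simp add: smult_pure S.l_distr)
  next
    case (add x y)
    then show ?case using a b by (simp add: radd cl E.a_ac)
  qed
  show "(a \<otimes>\<^bsub>S\<^esub> b) \<odot>\<^bsub>E M\<^esub> x = a \<odot>\<^bsub>E M\<^esub> (b \<odot>\<^bsub>E M\<^esub> x)"
    if a: "a \<in> carrier S" and b: "b \<in> carrier S" and x: "x \<in> carrier (E M)" for a b x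
    using M x
  proof (induction rule: E_induct)
    case (pure x y)
    then show ?case using a b by (simp add: smult_pure S.m_assoc)
  next
    case (add x y)
    then show ?case using a b by (simp add: radd cl)
  qed
  show "\<one>\<^bsub>S\<^esub> \<odot>\<^bsub>E M\<^esub> x = x" if x: "x \<in> carrier (E M)" for x
    using M x
  proof (induction rule: E_induct)
    case (pure x y)
    then show ?case by (simp add: smult_pure)
  next
    case (add x y)
    then show ?case by (simp add: radd)
  qed
qed

end

lemma prod_module_module:
  assumes R: "cring R" and M: "\<And>i. i \<in> I \<Longrightarrow> Module.module R (M i)"
  shows "Module.module R (prod_module I M)"
proof (rule moduleI)
  note simps = prod_module_def
  have ag: "abelian_group (M i)" if "i \<in> I" for i
    using M[OF that] by (rule Module.module.axioms(2))
  note am = ag[THEN abelian_group.axioms(1)]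
  note [simp] = abelian_monoid.zero_closed[OF am] abelian_monoid.a_closed[OF am] abelian_group.a_inv_closed[OF ag]
    abelian_monoid.l_zero[OF am] abelian_group.l_neg[OF ag]
  show "cring R" by (rule R)
  show "abelian_group (prod_module I M)"
  proof (rule abelian_groupI)
    show "\<exists>y\<in>carrier (prod_module I M). y \<oplus>\<^bsub>prod_module I M\<^esub> x = \<zero>\<^bsub>prod_module I M\<^esub>"
      if "x \<in> carrier (prod_module I M)" for x
      by (rule bexI[of _ "\<lambda>i\<in>I. \<ominus>\<^bsub>M i\<^esub> x i"]) (use that in \<open>auto simp: simps PiE_iff fun_eq_iff\<close>)
    show "\<zero>\<^bsub>prod_module I M\<^esub> \<in> carrier (prod_module I M)"
      by (auto simp: simps)
    show "\<zero>\<^bsub>prod_module I M\<^esub> \<oplus>\<^bsub>prod_module I M\<^esub> x = x" if "x \<in> carrier (prod_module I M)" for x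
      using that by (auto simp: simps restrict_def fun_eq_iff PiE_iff extensional_def)
    show "x \<oplus>\<^bsub>prod_module I M\<^esub> y \<oplus>\<^bsub>prod_module I M\<^esub> z = x \<oplus>\<^bsub>prod_module I M\<^esub> (y \<oplus>\<^bsub>prod_module I M\<^esub> z)"
      if "x \<in> carrier (prod_module I M)" "y \<in> carrier (prod_module I M)" "z \<in> carrier (prod_module I M)" for x y z
      using that abelian_monoid.a_assoc[OF am] by (auto simp: simps restrict_def fun_eq_iff PiE_iff)
    show "x \<oplus>\<^bsub>prod_module I M\<^esub> y = y \<oplus>\<^bsub>prod_module I M\<^esub> x"
      if "x \<in> carrier (prod_module I M)" "y \<in> carrier (prod_module I M)" for x y
      using that abelian_monoid.a_comm[OF am] by (auto simp: simps restrict_def fun_eq_iff PiE_iff)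
  qed (auto simp: simps PiE_iff)
  have xi: "x i \<in> carrier (M i)" if "x \<in> carrier (prod_module I M)" "i \<in> I" for x i
    using that by (auto simp: simps)
  show "a \<odot>\<^bsub>prod_module I M\<^esub> x \<in> carrier (prod_module I M)" if "a \<in> carrier R" "x \<in> carrier (prod_module I M)" for a x
    using that Module.module.smult_closed[OF M] by (auto simp: simps)
  show "(a \<oplus>\<^bsub>R\<^esub> b) \<odot>\<^bsub>prod_module I M\<^esub> x = a \<odot>\<^bsub>prod_module I M\<^esub> x \<oplus>\<^bsub>prod_module I M\<^esub> b \<odot>\<^bsub>prod_module I M\<^esub> x"
    if "a \<in> carrier R" "b \<in> carrier R" "x \<in> carrier (prod_module I M)" for a b x
    using that(1,2) xi[OF that(3)] Module.module.smult_l_distr[OF M] by (auto simp: simps restrict_def fun_eq_iff)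
  show "(a \<otimes>\<^bsub>R\<^esub> b) \<odot>\<^bsub>prod_module I M\<^esub> x = a \<odot>\<^bsub>prod_module I M\<^esub> (b \<odot>\<^bsub>prod_module I M\<^esub> x)"
    if "a \<in> carrier R" "b \<in> carrier R" "x \<in> carrier (prod_module I M)" for a b x
    using that(1,2) xi[OF that(3)] Module.module.smult_assoc1[OF M] by (auto simp: simps restrict_def fun_eq_iff)
  show "\<one>\<^bsub>R\<^esub> \<odot>\<^bsub>prod_module I M\<^esub> x = x" if "x \<in> carrier (prod_module I M)" for x
    using that Module.module.smult_one[OF M] by (auto simp: simps restrict_def fun_eq_iff PiE_def extensional_def)
  show "a \<odot>\<^bsub>prod_module I M\<^esub> (x \<oplus>\<^bsub>prod_module I M\<^esub> y) = a \<odot>\<^bsub>prod_module I M\<^esub> x \<oplus>\<^bsub>prod_module I M\<^esub> a \<odot>\<^bsub>prod_module I M\<^esub> y"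
    if "a \<in> carrier R" "x \<in> carrier (prod_module I M)" "y \<in> carrier (prod_module I M)" for a x y
    using that(1) xi[OF that(2)] xi[OF that(3)] Module.module.smult_r_distr[OF M]
    by (auto simp: simps restrict_def fun_eq_iff)
qed

context base_ring_change
begin

lemma lin_id_E:
  assumes "Module.module R M" and "Module.module R M'" and "f \<in> lin_maps R M M'"
  shows map_id_E_closed: "t \<in> carrier (E M) \<Longrightarrow> tensor_map R M' N f id t \<in> carrier (E M')"
    and map_id_E_add: "\<lbrakk>s \<in> carrier (E M); t \<in> carrier (E M)\<rbrakk> \<Longrightarrow>
      tensor_map R M' N f id (s \<oplus>\<^bsub>E M\<^esub> t) = tensor_map R M' N f id s \<oplus>\<^bsub>E M'\<^esub> tensor_map R M' N f id t"
    and map_id_E_pure: "tensor_map R M' N f id (pure_tensor R M N x y) = pure_tensor R M' N (f x) y"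
  using lin_E[OF assms id_linear] by (simp_all del: id_apply) simp

text \<open>Both sides are additive in each of the three tensors. On pure tensors the claim is
  \<open>eq\<close> in the first factor, with the products in \<open>S\<close> rearranged in the
  second. The weight parts are different modules, hence the separate names.\<close>

lemma act_E:
  assumes mods: "Module.module R M1" "Module.module R M2" "Module.module R M3" "Module.module R M12"
      "Module.module R M13" "Module.module R M23" "Module.module R P"
    and f1: "f1 \<in> bilin_maps R M1 M23 P" and f2: "f2 \<in> bilin_maps R M2 M3 M23"
    and f3: "f3 \<in> bilin_maps R M12 M3 P" and f4: "f4 \<in> bilin_maps R M1 M2 M12"
    and f5: "f5 \<in> bilin_maps R M2 M13 P" and f6: "f6 \<in> bilin_maps R M1 M3 M13"
    and eq: "\<And>x y z. \<lbrakk>x \<in> carrier M1; y \<in> carrier M2; z \<in> carrier M3\<rbrakk> \<Longrightarrow>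
      f1 x (f2 y z) = f3 (f4 x y) z \<oplus>\<^bsub>P\<^esub> f5 y (f6 x z)"
    and x: "x \<in> carrier (E M1)" and y: "y \<in> carrier (E M2)" and z: "z \<in> carrier (E M3)"
  shows "tensor_map2 R P N f1 (monoid.mult S) x (tensor_map2 R M23 N f2 (monoid.mult S) y z) =
    tensor_map2 R P N f3 (monoid.mult S) (tensor_map2 R M12 N f4 (monoid.mult S) x y) z \<oplus>\<^bsub>E P\<^esub>
    tensor_map2 R P N f5 (monoid.mult S) y (tensor_map2 R M13 N f6 (monoid.mult S) x z)"
proof -
  interpret EP: Module.module S "E P" by (rule E_module[OF mods(7)])
  note b1 = bilin_E[OF mods(1,6,7) f1] and b2 = bilin_E[OF mods(2,3,6) f2] and b3 = bilin_E[OF mods(4,3,7) f3]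
    and b4 = bilin_E[OF mods(1,2,4) f4] and b5 = bilin_E[OF mods(2,5,7) f5] and b6 = bilin_E[OF mods(1,3,5) f6]
  note closed = b1(1) b2(1) b3(1) b4(1) b5(1) b6(1)
  note adds = b1(2,3) b2(2,3) b3(2,3) b4(2,3) b5(2,3) b6(2,3)
  show ?thesis
    using mods(1) x
  proof (induction rule: E_induct)
    case (pure x s)
    note px = pure_E_closed[OF mods(1) pure]
    show ?case
      using mods(2) y
    proof (induction rule: E_induct)
      case (pure y t)
      note py = pure_E_closed[OF mods(2) pure]
      show ?case
        using mods(3) z
      proof (induction rule: E_induct)
        case (pure z w)
        have c: "f2 y z \<in> carrier M23" "f4 x y \<in> carrier M12" "f6 x z \<in> carrier M13"
          "f3 (f4 x y) z \<in> carrier P" "f5 y (f6 x z) \<in> carrier P"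
          using f2 f3 f4 f5 f6 \<open>x \<in> carrier M1\<close> \<open>y \<in> carrier M2\<close> \<open>z \<in> carrier M3\<close>
          by (auto simp: bilin_maps_def lin_maps_def Pi_def)
        show ?case
          using c \<open>x \<in> carrier M1\<close> \<open>y \<in> carrier M2\<close> \<open>z \<in> carrier M3\<close> \<open>s \<in> carrier S\<close> \<open>t \<in> carrier S\<close> \<open>w \<in> carrier S\<close>
          by (simp add: b1(4) b2(4) b3(4) b4(4) b5(4) b6(4) eq pure_E_add_left[OF mods(7)] S.m_ac)
      next
        case (add a b)
        then show ?case using px py by (simp add: adds closed EP.M.a_ac)
      qed
    next
      case (add a b)
      then show ?case using px z by (simp add: adds closed EP.M.a_ac)
    qed
  next
    case (add a b)
    then show ?case using y z by (simp add: adds closed EP.M.a_ac)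
  qed
qed

lemma derivation_E:
  assumes mods: "Module.module R M1" "Module.module R M2" "Module.module R M12"
      "Module.module R N1" "Module.module R N2" "Module.module R P"
    and f0: "f0 \<in> bilin_maps R M1 M2 M12" and g: "g \<in> lin_maps R M12 P"
    and d1: "d1 \<in> lin_maps R M1 N1" and d2: "d2 \<in> lin_maps R M2 N2"
    and f1: "f1 \<in> bilin_maps R M1 N2 P" and f2: "f2 \<in> bilin_maps R M2 N1 P"
    and eq: "\<And>x y. \<lbrakk>x \<in> carrier M1; y \<in> carrier M2\<rbrakk> \<Longrightarrow> g (f0 x y) = f1 x (d2 y) \<ominus>\<^bsub>P\<^esub> f2 y (d1 x)"
    and x: "x \<in> carrier (E M1)" and y: "y \<in> carrier (E M2)"
  shows "tensor_map R P N g id (tensor_map2 R M12 N f0 (monoid.mult S) x y) =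
    tensor_map2 R P N f1 (monoid.mult S) x (tensor_map R N2 N d2 id y) \<ominus>\<^bsub>E P\<^esub>
    tensor_map2 R P N f2 (monoid.mult S) y (tensor_map R N1 N d1 id x)"
proof -
  interpret P: Module.module R P by (rule mods(6))
  interpret EP: Module.module S "E P" by (rule E_module[OF mods(6)])
  note b0 = bilin_E[OF mods(1,2,3) f0] and bg = lin_id_E[OF mods(3,6) g]
    and l1 = lin_id_E[OF mods(1,4) d1] and l2 = lin_id_E[OF mods(2,5) d2]
    and b1 = bilin_E[OF mods(1,5,6) f1] and b2 = bilin_E[OF mods(2,4,6) f2]
  note closed = b0(1) bg(1) l1(1) l2(1) b1(1) b2(1)
  note adds = b0(2,3) bg(2) l1(2) l2(2) b1(2,3) b2(2,3)
  \<comment> \<open>The difference is moved to the other side, so that the induction on tensors only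
    has to rearrange sums.\<close>
  have "tensor_map R P N g id (tensor_map2 R M12 N f0 (monoid.mult S) x y) \<oplus>\<^bsub>E P\<^esub>
      tensor_map2 R P N f2 (monoid.mult S) y (tensor_map R N1 N d1 id x) =
    tensor_map2 R P N f1 (monoid.mult S) x (tensor_map R N2 N d2 id y)"
    using mods(1) x
  proof (induction rule: E_induct)
    case (pure x s)
    note px = pure_E_closed[OF mods(1) pure]
    show ?case
      using mods(2) y
    proof (induction rule: E_induct)
      case (pure y t)
      have c: "f0 x y \<in> carrier M12" "d1 x \<in> carrier N1" "d2 y \<in> carrier N2"
        "g (f0 x y) \<in> carrier P" "f2 y (d1 x) \<in> carrier P" "f1 x (d2 y) \<in> carrier P"
        using f0 f1 f2 d1 d2 g \<open>x \<in> carrier M1\<close> \<open>y \<in> carrier M2\<close>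
        by (auto simp: bilin_maps_def lin_maps_def Pi_def)
      have "g (f0 x y) \<oplus>\<^bsub>P\<^esub> f2 y (d1 x) = f1 x (d2 y)"
        using c eq[OF \<open>x \<in> carrier M1\<close> \<open>y \<in> carrier M2\<close>] by (simp add: a_minus_def P.M.a_assoc P.M.l_neg)
      then show ?case
        using c \<open>x \<in> carrier M1\<close> \<open>y \<in> carrier M2\<close> \<open>s \<in> carrier S\<close> \<open>t \<in> carrier S\<close>
          pure_E_add_left[OF mods(6) c(4,5), of "s \<otimes>\<^bsub>S\<^esub> t"]
        by (simp add: b0(4) bg(3) l1(3) l2(3) b1(4) b2(4) S.m_comm del: id_apply)
    next
      case (add a b)
      show ?case
        using px add.hyps by (simp add: adds closed add.IH[symmetric] EP.M.a_ac del: id_apply)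
    qed
  next
    case (add a b)
    show ?case
      using y add.hyps by (simp add: adds closed add.IH[symmetric] EP.M.a_ac del: id_apply)
  qed
  note sum = this
  show ?thesis
    unfolding sum[symmetric] a_minus_def
    using bg(1)[OF b0(1)[OF x y]] b2(1)[OF y l1(1)[OF x]] by (simp add: EP.M.a_assoc EP.M.r_neg del: id_apply)
qed

end

text \<open>Transport of structure along \<open>q\<close> with operations computed on
  representatives. An injective \<open>q\<close> gives a copy of the module in another type, a
  \<open>q\<close> whose fibres are cosets gives the quotient.\<close>

definition image_module :: "('r, 'm) module \<Rightarrow> ('m \<Rightarrow> 'u) \<Rightarrow> ('r, 'u) module" where
  "image_module M q = (let r = inv_into (carrier M) q in
    \<lparr>carrier = q ` carrier M, monoid.mult = (\<lambda>_ _. undefined), one = undefined,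
     ring.zero = q \<zero>\<^bsub>M\<^esub>, add = (\<lambda>a b. q (r a \<oplus>\<^bsub>M\<^esub> r b)), smult = (\<lambda>c a. q (c \<odot>\<^bsub>M\<^esub> r a))\<rparr>)"

locale module_image = Module.module R M for R :: "'r ring" and M :: "('r, 'm) module" +
  fixes q :: "'m \<Rightarrow> 'u"
  assumes q_add: "\<lbrakk>x \<in> carrier M; x' \<in> carrier M; y \<in> carrier M; y' \<in> carrier M; q x = q x'; q y = q y'\<rbrakk> \<Longrightarrow>
      q (x \<oplus>\<^bsub>M\<^esub> y) = q (x' \<oplus>\<^bsub>M\<^esub> y')"
    and q_smult: "\<lbrakk>a \<in> carrier R; x \<in> carrier M; x' \<in> carrier M; q x = q x'\<rbrakk> \<Longrightarrow> q (a \<odot>\<^bsub>M\<^esub> x) = q (a \<odot>\<^bsub>M\<^esub> x')"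
begin

abbreviation "Q \<equiv> image_module M q"

lemma rep: "x \<in> carrier M \<Longrightarrow> inv_into (carrier M) q (q x) \<in> carrier M"
  "x \<in> carrier M \<Longrightarrow> q (inv_into (carrier M) q (q x)) = q x"
  by (auto intro: inv_into_into f_inv_into_f)

lemma Q_carrier: "carrier Q = q ` carrier M" and Q_zero: "\<zero>\<^bsub>Q\<^esub> = q \<zero>\<^bsub>M\<^esub>"
  by (simp_all add: image_module_def Let_def)

lemma Q_add: "\<lbrakk>x \<in> carrier M; y \<in> carrier M\<rbrakk> \<Longrightarrow> q x \<oplus>\<^bsub>Q\<^esub> q y = q (x \<oplus>\<^bsub>M\<^esub> y)"
  by (simp add: image_module_def Let_def) (rule q_add; simp add: rep)

lemma Q_smult: "\<lbrakk>a \<in> carrier R; x \<in> carrier M\<rbrakk> \<Longrightarrow> a \<odot>\<^bsub>Q\<^esub> q x = q (a \<odot>\<^bsub>M\<^esub> x)"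
  by (simp add: image_module_def Let_def) (rule q_smult; simp add: rep)

lemma Q_module: "Module.module R Q"
proof (rule moduleI)
  show "cring R" by (rule R.is_cring)
  show "abelian_group Q"
  proof (rule abelian_groupI)
    show "\<exists>y\<in>carrier Q. y \<oplus>\<^bsub>Q\<^esub> x = \<zero>\<^bsub>Q\<^esub>" if x: "x \<in> carrier Q" for x
    proof -
      from x obtain m where m: "m \<in> carrier M" "x = q m" by (auto simp: Q_carrier)
      then show ?thesis
        by (intro bexI[of _ "q (\<ominus>\<^bsub>M\<^esub> m)"]) (auto simp: Q_carrier Q_add Q_zero M.l_neg)
    qed
  qed (auto simp: Q_carrier Q_zero Q_add M.a_ac)
qed (auto simp: Q_carrier Q_add Q_smult smult_l_distr smult_r_distr smult_assoc1)

lemma q_linear: "q \<in> lin_maps R M Q"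
  by (auto simp: lin_maps_def Q_carrier Q_add Q_smult)

end

text \<open>If $y \otimes 1$ lies in the image of $f \otimes S$, then the map from $R$ to the cokernel of $f$
  given by the class of $y$ becomes zero after tensoring with $S$, so it is zero. Faithful flatness is only
  available for modules with elements of a prescribed type, in which \<open>embR\<close> encodes $R$ and \<open>q\<close> the
  cokernel.\<close>

lemma (in base_ring_change) solvable_over_base:
  fixes M :: "('r, 'm) module" and M' :: "('r, 'g) module"
  assumes ff: "faithfully_flat TYPE((nat \<Rightarrow> 'r \<times> 'g) set) R N"
    and M: "Module.module R M" and M': "Module.module R M'" and f: "f \<in> lin_maps R M M'"
    and y: "y \<in> carrier M'" and z: "z \<in> carrier (E M)"
    and eq: "tensor_map R M' N f id z = pure_tensor R M' N y \<one>\<^bsub>S\<^esub>"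
  shows "\<exists>x\<in>carrier M. f x = y"
proof -
  interpret M: Module.module R M by (rule M)
  interpret M': Module.module R M' by (rule M')
  define I where "I = f ` carrier M"
  \<comment> \<open>Ring and cokernel must have elements of the one type on which faithful flatness
    is tested. A scalar becomes the singleton of a constant function, a coset of \<open>I\<close>
    the set of constant functions with values in it; \<open>undefined\<close> fills the idle
    coordinate.\<close>
  define embR :: "'r \<Rightarrow> (nat \<Rightarrow> 'r \<times> 'g) set" where "embR a = {\<lambda>_. (a, undefined)}" for a
  define q :: "'g \<Rightarrow> (nat \<Rightarrow> 'r \<times> 'g) set" where
    "q m = {\<lambda>_. (undefined, m \<oplus>\<^bsub>M'\<^esub> i) | i. i \<in> I}" for m
  \<comment> \<open>The ring as a module over itself: restriction of scalars along the
    identity.\<close>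
  define RR where "RR = restrict_scalars R (\<lambda>a. a)"
  have I_sub: "I \<subseteq> carrier M'" using f by (auto simp: I_def lin_maps_def)
  have I0: "\<zero>\<^bsub>M'\<^esub> \<in> I" unfolding I_def
    by (rule image_eqI[of _ _ "\<zero>\<^bsub>M\<^esub>"]) (simp_all add: lin_maps_zero[OF f M M'])
  have I_add: "i \<oplus>\<^bsub>M'\<^esub> j \<in> I" if "i \<in> I" "j \<in> I" for i j
  proof -
    from that obtain a b where "a \<in> carrier M" "b \<in> carrier M" "i = f a" "j = f b" by (auto simp: I_def)
    then show ?thesis unfolding I_def by (intro image_eqI[of _ _ "a \<oplus>\<^bsub>M\<^esub> b"]) (simp_all add: lin_maps_add[OF f M M'])
  qed
  have I_minus: "\<ominus>\<^bsub>M'\<^esub> i \<in> I" if "i \<in> I" for i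
  proof -
    from that obtain a where "a \<in> carrier M" "i = f a" by (auto simp: I_def)
    then show ?thesis unfolding I_def by (intro image_eqI[of _ _ "\<ominus>\<^bsub>M\<^esub> a"]) (simp_all add: lin_maps_minus[OF f M M'])
  qed
  have I_smult: "a \<odot>\<^bsub>M'\<^esub> i \<in> I" if "a \<in> carrier R" "i \<in> I" for a i
  proof -
    from that obtain b where "b \<in> carrier M" "i = f b" by (auto simp: I_def)
    then show ?thesis unfolding I_def using f that(1)
      by (intro image_eqI[of _ _ "a \<odot>\<^bsub>M\<^esub> b"]) (simp_all add: lin_maps_def)
  qed
  have q_eq: "q m = q m' \<longleftrightarrow> (\<exists>i\<in>I. m = m' \<oplus>\<^bsub>M'\<^esub> i)" if m: "m \<in> carrier M'" "m' \<in> carrier M'" for m m'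
  proof
    assume *: "q m = q m'"
    have "(\<lambda>_. (undefined, m)) \<in> q m" unfolding q_def using I0 m by force
    with * have "(\<lambda>_. (undefined, m)) \<in> q m'" by simp
    then show "\<exists>i\<in>I. m = m' \<oplus>\<^bsub>M'\<^esub> i" unfolding q_def by (auto dest: fun_cong)
  next
    assume "\<exists>i\<in>I. m = m' \<oplus>\<^bsub>M'\<^esub> i"
    then obtain i where i: "i \<in> I" "m = m' \<oplus>\<^bsub>M'\<^esub> i" by blast
    have 1: "m \<oplus>\<^bsub>M'\<^esub> j = m' \<oplus>\<^bsub>M'\<^esub> (i \<oplus>\<^bsub>M'\<^esub> j)" if "j \<in> I" for j
      using i m that subsetD[OF I_sub] by (simp add: M'.M.a_assoc)
    have 2: "m' \<oplus>\<^bsub>M'\<^esub> j = m \<oplus>\<^bsub>M'\<^esub> (\<ominus>\<^bsub>M'\<^esub> i \<oplus>\<^bsub>M'\<^esub> j)" if "j \<in> I" for j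
    proof -
      have c: "i \<in> carrier M'" "j \<in> carrier M'" using i that I_sub by auto
      have "m \<oplus>\<^bsub>M'\<^esub> (\<ominus>\<^bsub>M'\<^esub> i \<oplus>\<^bsub>M'\<^esub> j) = m' \<oplus>\<^bsub>M'\<^esub> (i \<oplus>\<^bsub>M'\<^esub> \<ominus>\<^bsub>M'\<^esub> i) \<oplus>\<^bsub>M'\<^esub> j"
        using c m unfolding i(2) by (simp add: M'.M.a_assoc del: M'.M.r_neg)
      then show ?thesis using c m by (simp add: M'.M.r_neg)
    qed
    show "q m = q m'"
    proof (intro equalityI subsetI)
      fix x assume "x \<in> q m"
      then obtain j where "j \<in> I" "x = (\<lambda>_. (undefined, m \<oplus>\<^bsub>M'\<^esub> j))" unfolding q_def by blast
      then show "x \<in> q m'" unfolding q_def using 1[of j] I_add[OF i(1), of j] by auto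
    next
      fix x assume "x \<in> q m'"
      then obtain j where "j \<in> I" "x = (\<lambda>_. (undefined, m' \<oplus>\<^bsub>M'\<^esub> j))" unfolding q_def by blast
      then show "x \<in> q m" unfolding q_def using 2[of j] I_add[OF I_minus[OF i(1)], of j] by auto
    qed
  qed
  have RR: "base_ring_change R R (\<lambda>a. a)"
    by unfold_locales (auto simp: ring_hom_def)
  interpret RU: module_image R RR embR
  proof (rule module_image.intro)
    show "Module.module R RR" unfolding RR_def by (rule base_ring_change.N_module[OF RR])
  qed (unfold_locales, auto simp: embR_def dest: fun_cong)
  interpret C: module_image R M' q
  proof unfold_locales
    fix x x' y y' assume c: "x \<in> carrier M'" "x' \<in> carrier M'" "y \<in> carrier M'" "y' \<in> carrier M'" and "q x = q x'" "q y = q y'"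
    then obtain i j where ij: "i \<in> I" "x = x' \<oplus>\<^bsub>M'\<^esub> i" "j \<in> I" "y = y' \<oplus>\<^bsub>M'\<^esub> j" by (auto simp: q_eq)
    then have "x \<oplus>\<^bsub>M'\<^esub> y = (x' \<oplus>\<^bsub>M'\<^esub> y') \<oplus>\<^bsub>M'\<^esub> (i \<oplus>\<^bsub>M'\<^esub> j)"
      using c subsetD[OF I_sub] by (simp add: M'.M.a_ac)
    then show "q (x \<oplus>\<^bsub>M'\<^esub> y) = q (x' \<oplus>\<^bsub>M'\<^esub> y')"
      by (intro q_eq[THEN iffD2] bexI[OF _ I_add[OF ij(1,3)]] M'.M.add.m_closed c)
  next
    fix a x x' assume c: "a \<in> carrier R" "x \<in> carrier M'" "x' \<in> carrier M'" and "q x = q x'"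
    then obtain i where i: "i \<in> I" "x = x' \<oplus>\<^bsub>M'\<^esub> i" by (auto simp: q_eq)
    then have "a \<odot>\<^bsub>M'\<^esub> x = a \<odot>\<^bsub>M'\<^esub> x' \<oplus>\<^bsub>M'\<^esub> a \<odot>\<^bsub>M'\<^esub> i"
      using c I_sub by (auto simp: M'.smult_r_distr)
    then show "q (a \<odot>\<^bsub>M'\<^esub> x) = q (a \<odot>\<^bsub>M'\<^esub> x')"
      by (intro q_eq[THEN iffD2] bexI[OF _ I_smult[OF c(1) i(1)]] M'.smult_closed c)
  qed
  interpret EC: Module.module S "E C.Q" by (rule E_module[OF C.Q_module])
  have RR_simps: "carrier RR = carrier R" "x \<oplus>\<^bsub>RR\<^esub> y = x \<oplus>\<^bsub>R\<^esub> y" "a \<odot>\<^bsub>RR\<^esub> x = a \<otimes>\<^bsub>R\<^esub> x" for a x y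
    by (simp_all add: RR_def restrict_scalars_def)
  define un where "un A = fst (the_elem A (0::nat))" for A :: "(nat \<Rightarrow> 'r \<times> 'g) set"
  have un: "un (embR a) = a" for a by (simp add: un_def embR_def)
  define g where "g A = q (un A \<odot>\<^bsub>M'\<^esub> y)" for A
  have g: "g \<in> lin_maps R RU.Q C.Q"
    using y by (auto simp: lin_maps_def RU.Q_carrier RU.Q_add RU.Q_smult C.Q_carrier C.Q_add C.Q_smult g_def un RR_simps
        M'.smult_l_distr M'.smult_assoc1)
  have qf: "tensor_map R C.Q N q id (tensor_map R M' N f id w) = \<zero>\<^bsub>E C.Q\<^esub>" if "w \<in> carrier (E M)" for w
    using M that
  proof (induction rule: E_induct)
    case (pure x s)
    have fx: "f x \<in> carrier M'" using f pure by (auto simp: lin_maps_def)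
    then have "\<exists>i\<in>I. f x = \<zero>\<^bsub>M'\<^esub> \<oplus>\<^bsub>M'\<^esub> i"
      using pure(1) by (intro bexI[of _ "f x"]) (simp_all add: I_def)
    then have "q (f x) = \<zero>\<^bsub>C.Q\<^esub>"
      unfolding C.Q_zero using q_eq[OF fx M'.M.zero_closed] by blast
    then show ?case
      using pure pure_E_zero_left[OF C.Q_module]
      by (simp add: lin_id_E[OF M M' f] lin_id_E[OF M' C.Q_module C.q_linear] del: id_apply)
  next
    case (add a b)
    then show ?case
      by (simp add: lin_id_E[OF M M' f] lin_id_E[OF M' C.Q_module C.q_linear] del: id_apply)
  qed
  have y1: "pure_tensor R C.Q N (q y) \<one>\<^bsub>S\<^esub> = \<zero>\<^bsub>E C.Q\<^esub>"
    using qf[OF z] unfolding eq by (simp add: lin_id_E[OF M' C.Q_module C.q_linear] del: id_apply)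
  have ys: "pure_tensor R C.Q N (q y) s = \<zero>\<^bsub>E C.Q\<^esub>" if s: "s \<in> carrier S" for s
  proof -
    have "pure_tensor R C.Q N (q y) s = s \<odot>\<^bsub>E C.Q\<^esub> pure_tensor R C.Q N (q y) \<one>\<^bsub>S\<^esub>"
      using s lin_E(3)[OF C.Q_module C.Q_module id_linear mult_linear[OF s]] by (simp add: E_simps)
    then show ?thesis using s by (simp add: y1)
  qed
  have kill: "tensor_map R C.Q N g id w = \<zero>\<^bsub>E C.Q\<^esub>" if "w \<in> carrier (E RU.Q)" for w
    using RU.Q_module that
  proof (induction rule: E_induct)
    case (pure A s)
    then obtain a where a: "a \<in> carrier R" "A = embR a" by (auto simp: RU.Q_carrier RR_simps)
    have qy: "q y \<in> carrier C.Q" using y by (simp add: C.Q_carrier)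
    have "tensor_map R C.Q N g id (pure_tensor R RU.Q N A s) = pure_tensor R C.Q N (a \<odot>\<^bsub>C.Q\<^esub> q y) s"
      using a y by (simp add: lin_id_E[OF RU.Q_module C.Q_module g] g_def un C.Q_smult del: id_apply)
    also have "\<dots> = pure_tensor R C.Q N (q y) (h a \<otimes>\<^bsub>S\<^esub> s)"
      using tensor_pair.pure_balanced[OF pair[OF C.Q_module] a(1) qy, of s] pure(2) by simp
    also have "\<dots> = \<zero>\<^bsub>E C.Q\<^esub>"
      using ys[of "h a \<otimes>\<^bsub>S\<^esub> s"] ring_hom_closed[OF h a(1)] pure(2) by simp
    finally show ?case .
  next
    case (add a b)
    then show ?case by (simp add: lin_id_E[OF RU.Q_module C.Q_module g] del: id_apply)
  qed
  have ident: "tensor_map R RU.Q N id id w = w" if "w \<in> carrier (E RU.Q)" for w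
    using RU.Q_module that
    by (induction rule: E_induct) (simp_all add: lin_id_E[OF RU.Q_module RU.Q_module id_linear] del: id_apply, simp)
  \<comment> \<open>Faithful flatness is used on R \<rightarrow> R \<rightarrow> coker f with the
    identity as first map. After tensoring, \<open>g\<close> is zero and the identity is onto, so
    this sequence is exact; hence it was exact before, and \<open>g\<close> kills the unit.\<close>
  have "tensor_map R RU.Q N id id ` carrier (tensor R RU.Q N) =
      kernel (tensor R RU.Q N) (tensor R C.Q N) (tensor_map R C.Q N g id)"
    using ident kill by (force simp: kernel_def E_simps)
  then have "id ` carrier RU.Q = a_kernel RU.Q C.Q g"
    using ff RU.Q_module C.Q_module g id_linear[of RU.Q] unfolding faithfully_flat_def by blast
  then have "embR \<one>\<^bsub>R\<^esub> \<in> a_kernel RU.Q C.Q g"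
    by (auto simp: RU.Q_carrier RR_simps)
  then have "g (embR \<one>\<^bsub>R\<^esub>) = \<zero>\<^bsub>C.Q\<^esub>"
    by (simp add: a_kernel_def kernel_def)
  then have "q y = q \<zero>\<^bsub>M'\<^esub>"
    using y by (simp add: g_def un C.Q_zero)
  then obtain i where "i \<in> I" "y = \<zero>\<^bsub>M'\<^esub> \<oplus>\<^bsub>M'\<^esub> i"
    using q_eq[OF y] by auto
  then show ?thesis using subsetD[OF I_sub, of i] by (auto simp: I_def)
qed

section \<open>Descent along faithfully flat base change\<close>

locale weight_graded_base_change = weight_graded_Q R \<delta> L + BC: base_ring_change R S h
  for R :: "'r ring" and \<delta> :: nat and L :: "('r, 'g) wdgla" and S :: "'s ring" and h
begin

abbreviation "N \<equiv> BC.N"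
abbreviation "B i k \<equiv> BC.E (wt_module L i k)"
abbreviation "LS \<equiv> base_change R S h \<delta> L"
abbreviation "bb0 k l \<equiv> tensor_map2 R (wt_module L 0 (k + l)) N (bra L 0 0) (monoid.mult S)"
abbreviation "bb1 k l \<equiv> tensor_map2 R (wt_module L (- 1) (k + l)) N (bra L 0 (- 1)) (monoid.mult S)"
abbreviation "dd k \<equiv> tensor_map R (wt_module L (- 1) (k + \<delta>)) N (dif L 0) id"

lemma S_Q_algebra: "comm_Q_algebra S"
proof (rule comm_Q_algebra.intro)
  show "cring S" by (rule BC.S.is_cring)
  show "comm_Q_algebra_axioms S"
  proof
    have "(\<lambda>a. h (rat_map a)) \<in> ring_hom rat_ring S"
      using rat_map_hom BC.h by (auto simp: ring_hom_def rat_ring_def)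
    then show "\<exists>\<iota>. \<iota> \<in> ring_hom rat_ring S" by blast
  qed
qed

lemma LS_simps:
  "gr LS i = prod_module {1..} (B i)"
  "bra LS i j x y = (\<lambda>k\<in>{1..}. finsum (B (i + j) k)
     (\<lambda>l. tensor_map2 R (wt_module L (i + j) k) N (bra L i j) (monoid.mult S) (x l) (y (k - l))) {1..<k})"
  "dif LS i x = (\<lambda>k\<in>{1..}. if k \<le> \<delta> then \<zero>\<^bsub>B (i - 1) k\<^esub>
     else tensor_map R (wt_module L (i - 1) k) N (dif L i) id (x (k - \<delta>)))"
  "wproj LS i k x = (\<lambda>l\<in>{1..}. if l = k then x k else \<zero>\<^bsub>B i l\<^esub>)"
  by (simp_all add: base_change_def wt_base_change_def[abs_def] Let_def)

lemma B_module: "1 \<le> k \<Longrightarrow> Module.module S (B i k)"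
  by (rule BC.E_module[OF wt_module_module])

lemma gr_LS_module: "Module.module S (gr LS i)"
  unfolding LS_simps by (rule prod_module_module) (simp_all add: BC.S.is_cring B_module)

lemma mem_gr_LS: "x \<in> carrier (gr LS i) \<longleftrightarrow> x \<in> (\<Pi>\<^sub>E k\<in>{1..}. carrier (B i k))"
  by (simp add: LS_simps prod_module_def)

lemma gr_LS_component: "\<lbrakk>x \<in> carrier (gr LS i); 1 \<le> k\<rbrakk> \<Longrightarrow> x k \<in> carrier (B i k)"
  by (auto simp: mem_gr_LS)

lemma dif_wt_linear: "1 \<le> k \<Longrightarrow> dif L i \<in> lin_maps R (wt_module L i k) (wt_module L (i - 1) (k + \<delta>))"
  using dif_linear[of i] dif_wt[of k] wt_carrier[of k] by (auto simp: lin_maps_def)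

lemma bra_wt_bilinear: "\<lbrakk>1 \<le> k; 1 \<le> l\<rbrakk> \<Longrightarrow>
    bra L i j \<in> bilin_maps R (wt_module L i k) (wt_module L j l) (wt_module L (i + j) (k + l))"
  using bra_bilinear[of i j] bra_wt[of k l] wt_carrier[of k] wt_carrier[of l]
  by (auto simp: bilin_maps_def lin_maps_def)

lemma dif_wt_linear_0: "1 \<le> k \<Longrightarrow> dif L 0 \<in> lin_maps R (wt_module L 0 k) (wt_module L (- 1) (k + \<delta>))"
  using dif_wt_linear[of k 0] by simp

lemma bra_wt_bilinear_0:
  "\<lbrakk>1 \<le> k; 1 \<le> l\<rbrakk> \<Longrightarrow> bra L 0 0 \<in> bilin_maps R (wt_module L 0 k) (wt_module L 0 l) (wt_module L 0 (k + l))"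
  "\<lbrakk>1 \<le> k; 1 \<le> l\<rbrakk> \<Longrightarrow> bra L 0 (- 1) \<in> bilin_maps R (wt_module L 0 k) (wt_module L (- 1) l) (wt_module L (- 1) (k + l))"
  using bra_wt_bilinear[of k l 0 0] bra_wt_bilinear[of k l 0 "- 1"] by simp_all

lemmas bb0 = BC.bilin_E[OF wt_module_module wt_module_module wt_module_module bra_wt_bilinear_0(1)]
lemmas bb1 = BC.bilin_E[OF wt_module_module wt_module_module wt_module_module bra_wt_bilinear_0(2)]
lemmas dd = BC.lin_id_E[OF wt_module_module wt_module_module dif_wt_linear_0]

lemma bb1_closed_component:
  assumes x: "x \<in> carrier (gr LS 0)" and y: "y \<in> carrier (gr LS (- 1))" and l: "l \<in> {1..<k}"
  shows "bb1 l (k - l) (x l) (y (k - l)) \<in> carrier (B (- 1) k)"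
proof -
  have l': "1 \<le> l" "1 \<le> k - l" "1 \<le> l + (k - l)" "l + (k - l) = k" using l by auto
  show ?thesis
    using bb1(1)[OF l'(1-3,1,2) gr_LS_component[OF x l'(1)] gr_LS_component[OF y l'(2)]] l'(4) by simp
qed

text \<open>An element of the base change is the family of its components, so evaluation at
  \<open>k\<close> serves as component map; the identities between operations come from those over
  \<open>R\<close> by \<open>act_E\<close> and \<open>derivation_E\<close>.\<close>

sublocale BW: weight_components S \<delta> LS "B 0" "B (- 1)" "\<lambda>k x. x k" "\<lambda>k x. x k" bb0 bb1 dd
proof (intro weight_components.intro weight_components_axioms.intro)
  show "comm_Q_algebra S" by (rule S_Q_algebra)
  show "1 \<le> \<delta>" by (rule \<delta>_pos)
  show "Module.module S (gr LS 0)" "Module.module S (gr LS (- 1))" by (rule gr_LS_module)+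
  show "Module.module S (B 0 k)" "Module.module S (B (- 1) k)" if "1 \<le> k" for k
    by (rule B_module[OF that])+
  show "x k \<in> carrier (B 0 k)" if "1 \<le> k" "x \<in> carrier (gr LS 0)" for k x
    by (rule gr_LS_component[OF that(2,1)])
  show "\<exists>x\<in>carrier (gr LS 0). \<forall>k\<ge>1. x k = f k" if "\<And>k. 1 \<le> k \<Longrightarrow> f k \<in> carrier (B 0 k)" for f
    by (rule bexI[of _ "restrict f {1..}"]) (use that in \<open>auto simp: mem_gr_LS\<close>)
  show "\<exists>x\<in>carrier (gr LS (- 1)). \<forall>k\<ge>1. x k = f k" if "\<And>k. 1 \<le> k \<Longrightarrow> f k \<in> carrier (B (- 1) k)" for f
    by (rule bexI[of _ "restrict f {1..}"]) (use that in \<open>auto simp: mem_gr_LS\<close>)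
  show "(\<lambda>x. x k) \<in> lin_maps S (gr LS (- 1)) (B (- 1) k)" if "1 \<le> k" for k
    using that by (auto simp: lin_maps_def LS_simps prod_module_def)
  show "x = y" if "x \<in> carrier (gr LS (- 1))" "y \<in> carrier (gr LS (- 1))" "\<And>k. 1 \<le> k \<Longrightarrow> x k = y k" for x y
    using that unfolding mem_gr_LS by (intro PiE_ext) auto
  show "filt LS n (- 1) = {x \<in> carrier (gr LS (- 1)). \<forall>k. 1 \<le> k \<and> k < n \<longrightarrow> x k = \<zero>\<^bsub>B (- 1) k\<^esub>}" for n
    by (auto simp: filt_def LS_simps prod_module_def fun_eq_iff restrict_def split: if_splits)
  show "bra LS 0 (- 1) x y \<in> carrier (gr LS (- 1))"
    if x: "x \<in> carrier (gr LS 0)" and y: "y \<in> carrier (gr LS (- 1))" for x y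
    unfolding mem_gr_LS
  proof (rule PiE_I)
    fix k :: nat assume k: "k \<in> {1..}"
    then interpret Bk: Module.module S "B (- 1) k" by (intro B_module) simp
    have "tensor_map2 R (wt_module L (- 1) k) N (bra L 0 (- 1)) (monoid.mult S) (x l) (y (k - l)) \<in> carrier (B (- 1) k)"
      if "l \<in> {1..<k}" for l
      using bb1_closed_component[OF x y that] that by simp
    then show "bra LS 0 (- 1) x y k \<in> carrier (B (- 1) k)"
      using k by (auto simp: LS_simps intro!: Bk.M.finsum_closed)
  qed (simp add: LS_simps)
  show "bra LS 0 (- 1) x y k = finsum (B (- 1) k) (\<lambda>l. bb1 l (k - l) (x l) (y (k - l))) {1..<k}"
    if k: "1 \<le> k" and x: "x \<in> carrier (gr LS 0)" and y: "y \<in> carrier (gr LS (- 1))" for k x y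
  proof -
    interpret Bk: Module.module S "B (- 1) k" by (rule B_module[OF k])
    have "finsum (B (- 1) k) (\<lambda>l. tensor_map2 R (wt_module L (- 1) k) N (bra L 0 (- 1)) (monoid.mult S) (x l) (y (k - l))) {1..<k} =
        finsum (B (- 1) k) (\<lambda>l. bb1 l (k - l) (x l) (y (k - l))) {1..<k}"
      by (rule Bk.M.finsum_cong') (use bb1_closed_component[OF x y] in auto)
    then show ?thesis using k by (simp add: LS_simps)
  qed
  show "dif LS 0 x \<in> carrier (gr LS (- 1))" if x: "x \<in> carrier (gr LS 0)" for x
    unfolding mem_gr_LS
  proof (rule PiE_I)
    fix k :: nat assume k: "k \<in> {1..}"
    then interpret Bk: Module.module S "B (- 1) k" by (intro B_module) simp
    show "dif LS 0 x k \<in> carrier (B (- 1) k)"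
      using k dd(1)[of "k - \<delta>" "x (k - \<delta>)"] gr_LS_component[OF x, of "k - \<delta>"] by (auto simp: LS_simps)
  qed (simp add: LS_simps)
  show "dif LS 0 x k = (if k \<le> \<delta> then \<zero>\<^bsub>B (- 1) k\<^esub> else dd (k - \<delta>) (x (k - \<delta>)))" if "1 \<le> k" for k x
    using that by (simp add: LS_simps)
  fix k l :: nat assume k: "1 \<le> k" and l: "1 \<le> l"
  have kl: "1 \<le> k + l" using k by simp
  show "bb0 k l x y \<in> carrier (B 0 (k + l))" if "x \<in> carrier (B 0 k)" "y \<in> carrier (B 0 l)" for x y
    by (rule bb0(1)[OF k l kl k l that])
  show "bb0 k l (x \<oplus>\<^bsub>B 0 k\<^esub> x') y = bb0 k l x y \<oplus>\<^bsub>B 0 (k + l)\<^esub> bb0 k l x' y"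
    if "x \<in> carrier (B 0 k)" "x' \<in> carrier (B 0 k)" "y \<in> carrier (B 0 l)" for x x' y
    by (rule bb0(2)[OF k l kl k l that])
  show "bb0 k l x (y \<oplus>\<^bsub>B 0 l\<^esub> y') = bb0 k l x y \<oplus>\<^bsub>B 0 (k + l)\<^esub> bb0 k l x y'"
    if "x \<in> carrier (B 0 k)" "y \<in> carrier (B 0 l)" "y' \<in> carrier (B 0 l)" for x y y'
    by (rule bb0(3)[OF k l kl k l that])
  show "bb1 k l x y \<in> carrier (B (- 1) (k + l))" if "x \<in> carrier (B 0 k)" "y \<in> carrier (B (- 1) l)" for x y
    by (rule bb1(1)[OF k l kl k l that])
  show "bb1 k l (x \<oplus>\<^bsub>B 0 k\<^esub> x') y = bb1 k l x y \<oplus>\<^bsub>B (- 1) (k + l)\<^esub> bb1 k l x' y"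
    if "x \<in> carrier (B 0 k)" "x' \<in> carrier (B 0 k)" "y \<in> carrier (B (- 1) l)" for x x' y
    by (rule bb1(2)[OF k l kl k l that])
  show "bb1 k l x (y \<oplus>\<^bsub>B (- 1) l\<^esub> y') = bb1 k l x y \<oplus>\<^bsub>B (- 1) (k + l)\<^esub> bb1 k l x y'"
    if "x \<in> carrier (B 0 k)" "y \<in> carrier (B (- 1) l)" "y' \<in> carrier (B (- 1) l)" for x y y'
    by (rule bb1(3)[OF k l kl k l that])
  have kd: "1 \<le> k + \<delta>" using k by simp
  show "dd k x \<in> carrier (B (- 1) (k + \<delta>))" if "x \<in> carrier (B 0 k)" for x
    by (rule dd(1)[OF k kd k that])
  show "dd k (x \<oplus>\<^bsub>B 0 k\<^esub> y) = dd k x \<oplus>\<^bsub>B (- 1) (k + \<delta>)\<^esub> dd k y" if "x \<in> carrier (B 0 k)" "y \<in> carrier (B 0 k)" for x y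
    by (rule dd(2)[OF k kd k that])
  show "bb1 k (l + m) x (bb1 l m y z) = bb1 (k + l) m (bb0 k l x y) z \<oplus>\<^bsub>B (- 1) (k + l + m)\<^esub> bb1 l (k + m) y (bb1 k m x z)"
    if m: "1 \<le> m" and xyz: "x \<in> carrier (B 0 k)" "y \<in> carrier (B 0 l)" "z \<in> carrier (B (- 1) m)" for m x y z
  proof -
    have e: "k + (l + m) = k + l + m" "l + (k + m) = k + l + m" by simp_all
    have pos: "1 \<le> l + m" "1 \<le> k + m" "1 \<le> k + l + m" using k l by simp_all
    show ?thesis
      unfolding e
      by (rule BC.act_E[OF wt_module_module[OF k] wt_module_module[OF l] wt_module_module[OF m]
            wt_module_module[OF kl] wt_module_module[OF pos(2)] wt_module_module[OF pos(1)] wt_module_module[OF pos(3)]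
            bra_wt_bilinear_0(2)[OF k pos(1), unfolded e] bra_wt_bilinear_0(2)[OF l m] bra_wt_bilinear_0(2)[OF kl m]
            bra_wt_bilinear_0(1)[OF k l] bra_wt_bilinear_0(2)[OF l pos(2), unfolded e] bra_wt_bilinear_0(2)[OF k m]
            W.act[OF k l m] xyz])
  qed
  show "dd (k + l) (bb0 k l x y) = bb1 k (l + \<delta>) x (dd l y) \<ominus>\<^bsub>B (- 1) (k + l + \<delta>)\<^esub> bb1 l (k + \<delta>) y (dd k x)"
    if xy: "x \<in> carrier (B 0 k)" "y \<in> carrier (B 0 l)" for x y
  proof -
    have e: "k + (l + \<delta>) = k + l + \<delta>" "l + (k + \<delta>) = k + l + \<delta>" by simp_all
    have pos: "1 \<le> l + \<delta>" "1 \<le> k + l + \<delta>" using k l by simp_all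
    show ?thesis
      unfolding e
      by (rule BC.derivation_E[OF wt_module_module[OF k] wt_module_module[OF l] wt_module_module[OF kl]
            wt_module_module[OF kd] wt_module_module[OF pos(1)] wt_module_module[OF pos(2)]
            bra_wt_bilinear_0(1)[OF k l] dif_wt_linear_0[OF kl] dif_wt_linear_0[OF k] dif_wt_linear_0[OF l]
            bra_wt_bilinear_0(2)[OF k pos(1), unfolded e] bra_wt_bilinear_0(2)[OF l kd, unfolded e]
            W.derivation[OF k l] xy])
  qed
qed

definition one_map where "one_map i k x = pure_tensor R (wt_module L i k) N x \<one>\<^bsub>S\<^esub>"

lemma one_map_closed: "\<lbrakk>1 \<le> k; x \<in> wt L i k\<rbrakk> \<Longrightarrow> one_map i k x \<in> carrier (B i k)"
  unfolding one_map_def by (rule BC.pure_E(1)[OF wt_module_module]) simp_all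

lemma one_map_props:
  assumes k: "1 \<le> k"
  shows "one_map i k \<zero>\<^bsub>wt_module L i k\<^esub> = \<zero>\<^bsub>B i k\<^esub>"
    and "\<lbrakk>x \<in> wt L i k; y \<in> wt L i k\<rbrakk> \<Longrightarrow> one_map i k (x \<oplus>\<^bsub>wt_module L i k\<^esub> y) = one_map i k x \<oplus>\<^bsub>B i k\<^esub> one_map i k y"
    and "\<lbrakk>x \<in> wt L i k; y \<in> wt L i k\<rbrakk> \<Longrightarrow> one_map i k (x \<ominus>\<^bsub>wt_module L i k\<^esub> y) = one_map i k x \<ominus>\<^bsub>B i k\<^esub> one_map i k y"
    and "g \<in> A \<rightarrow> wt L i k \<Longrightarrow> one_map i k (finsum (wt_module L i k) g A) = finsum (B i k) (\<lambda>l. one_map i k (g l)) A"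
    and "x \<in> wt L i k \<Longrightarrow> one_map i k ([(n::nat)] \<cdot>\<^bsub>wt_module L i k\<^esub> x) = [n] \<cdot>\<^bsub>B i k\<^esub> one_map i k x"
proof -
  interpret W: Module.module R "wt_module L i k" by (rule wt_module_module[OF k])
  interpret B: Module.module S "B i k" by (rule B_module[OF k])
  have cl: "one_map i k \<in> carrier (wt_module L i k) \<rightarrow> carrier (B i k)"
    using one_map_closed[OF k] by simp
  have add: "one_map i k (x \<oplus>\<^bsub>wt_module L i k\<^esub> y) = one_map i k x \<oplus>\<^bsub>B i k\<^esub> one_map i k y"
    if "x \<in> carrier (wt_module L i k)" "y \<in> carrier (wt_module L i k)" for x y
    unfolding one_map_def by (rule BC.pure_E(2)[OF wt_module_module[OF k] that]) simp
  note props = additive_hom_props[OF cl W.M.abelian_group_axioms B.M.abelian_group_axioms add]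
  show "one_map i k \<zero>\<^bsub>wt_module L i k\<^esub> = \<zero>\<^bsub>B i k\<^esub>" by (rule props(1))
  show "\<lbrakk>x \<in> wt L i k; y \<in> wt L i k\<rbrakk> \<Longrightarrow> one_map i k (x \<oplus>\<^bsub>wt_module L i k\<^esub> y) = one_map i k x \<oplus>\<^bsub>B i k\<^esub> one_map i k y"
    by (rule add) simp_all
  show "\<lbrakk>x \<in> wt L i k; y \<in> wt L i k\<rbrakk> \<Longrightarrow> one_map i k (x \<ominus>\<^bsub>wt_module L i k\<^esub> y) = one_map i k x \<ominus>\<^bsub>B i k\<^esub> one_map i k y"
    by (rule props(3)) simp_all
  show "g \<in> A \<rightarrow> wt L i k \<Longrightarrow> one_map i k (finsum (wt_module L i k) g A) = finsum (B i k) (\<lambda>l. one_map i k (g l)) A"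
    by (rule props(4)) auto
  show "x \<in> wt L i k \<Longrightarrow> one_map i k ([n] \<cdot>\<^bsub>wt_module L i k\<^esub> x) = [n] \<cdot>\<^bsub>B i k\<^esub> one_map i k x"
    by (rule props(5)) simp_all
qed

text \<open>Every term of the residual commutes with \<open>x \<mapsto> x \<otimes> 1\<close>:
  brackets because 1 times 1 is 1 in \<open>S\<close>, the differential because it acts on the first
  factor, sums and multiples by additivity.\<close>

lemma residual_one_map:
  assumes u: "\<And>k. 1 \<le> k \<Longrightarrow> u k \<in> wt L 0 k" and f: "\<And>k. 1 \<le> k \<Longrightarrow> f k \<in> wt L (- 1) k" and k: "\<delta> < k"
    and u': "\<And>k. 1 \<le> k \<Longrightarrow> u' k = one_map 0 k (u k)" and f': "\<And>k. 1 \<le> k \<Longrightarrow> f' k = one_map (- 1) k (f k)"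
  shows "BW.residual u' f' k = one_map (- 1) k (W.residual u f k)"
proof -
  have k1: "1 \<le> k" "1 \<le> k - \<delta>" "k - \<delta> + \<delta> = k" "1 \<le> k - \<delta> + \<delta>" using k by auto
  interpret V: Module.module R "wt_module L (- 1) k" by (rule wt_module_module[OF k1(1)])
  interpret Bk: Module.module S "B (- 1) k" by (rule B_module[OF k1(1)])
  have b: "bra L 0 (- 1) (u l) (f (k - l)) \<in> wt L (- 1) k"
    "bb1 l (k - l) (u' l) (f' (k - l)) = one_map (- 1) k (bra L 0 (- 1) (u l) (f (k - l)))" if "l \<in> {1..<k}" for l
  proof -
    have l: "1 \<le> l" "1 \<le> k - l" "l + (k - l) = k" "1 \<le> l + (k - l)" using that by auto
    show "bra L 0 (- 1) (u l) (f (k - l)) \<in> wt L (- 1) k"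
      using bra_wt[OF l(1,2) u[OF l(1)] f[OF l(2)]] l(3) by simp
    have "bb1 l (k - l) (one_map 0 l (u l)) (one_map (- 1) (k - l) (f (k - l))) =
        one_map (- 1) (l + (k - l)) (bra L 0 (- 1) (u l) (f (k - l)))"
      unfolding one_map_def
      using bb1(4)[OF l(1,2,4,1,2), of "u l" "\<one>\<^bsub>S\<^esub>" "f (k - l)" "\<one>\<^bsub>S\<^esub>"] u[OF l(1)] f[OF l(2)] by simp
    then show "bb1 l (k - l) (u' l) (f' (k - l)) = one_map (- 1) k (bra L 0 (- 1) (u l) (f (k - l)))"
      by (simp only: l(3) u'[OF l(1)] f'[OF l(2)])
  qed
  have du: "dif L 0 (u (k - \<delta>)) \<in> wt L (- 1) k"
    using dif_wt[OF k1(2) u[OF k1(2)]] k1(3) by simp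
  have "dd (k - \<delta>) (one_map 0 (k - \<delta>) (u (k - \<delta>))) = one_map (- 1) (k - \<delta> + \<delta>) (dif L 0 (u (k - \<delta>)))"
    unfolding one_map_def
    using dd(3)[OF k1(2,4,2), of "u (k - \<delta>)" "\<one>\<^bsub>S\<^esub>"] by simp
  then have ddu: "dd (k - \<delta>) (u' (k - \<delta>)) = one_map (- 1) k (dif L 0 (u (k - \<delta>)))"
    by (simp only: k1(3) u'[OF k1(2)])
  define F where "F = finsum (wt_module L (- 1) k) (\<lambda>l. bra L 0 (- 1) (u l) (f (k - l))) {1..<k}"
  have F: "F \<in> wt L (- 1) k"
    unfolding F_def using V.M.finsum_closed[of "\<lambda>l. bra L 0 (- 1) (u l) (f (k - l))" "{1..<k}"] b(1) by auto
  have "one_map (- 1) k F = finsum (B (- 1) k) (\<lambda>l. one_map (- 1) k (bra L 0 (- 1) (u l) (f (k - l)))) {1..<k}"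
    unfolding F_def by (rule one_map_props(4)[OF k1(1)]) (use b(1) in auto)
  also have "\<dots> = finsum (B (- 1) k) (\<lambda>l. bb1 l (k - l) (u' l) (f' (k - l))) {1..<k}"
    by (rule Bk.M.finsum_cong') (use b one_map_closed[OF k1(1)] in auto)
  finally have F': "finsum (B (- 1) k) (\<lambda>l. bb1 l (k - l) (u' l) (f' (k - l))) {1..<k} = one_map (- 1) k F" ..
  have nf: "[(k - \<delta>)] \<cdot>\<^bsub>wt_module L (- 1) k\<^esub> f k \<in> wt L (- 1) k"
    using V.M.add.nat_pow_closed[of "f k" "k - \<delta>"] f[OF k1(1)] by simp
  have d: "[(k - \<delta>)] \<cdot>\<^bsub>wt_module L (- 1) k\<^esub> f k \<ominus>\<^bsub>wt_module L (- 1) k\<^esub> dif L 0 (u (k - \<delta>)) \<in> wt L (- 1) k"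
    using V.M.minus_closed[of "[(k - \<delta>)] \<cdot>\<^bsub>wt_module L (- 1) k\<^esub> f k" "dif L 0 (u (k - \<delta>))"] nf du by simp
  show ?thesis
    unfolding BW.residual_def W.residual_def F_def[symmetric] F' ddu f'[OF k1(1)]
    by (simp only: one_map_props(2)[OF k1(1) d F] one_map_props(3)[OF k1(1) nf du] one_map_props(5)[OF k1(1) f[OF k1(1)]])
qed

lemma tensor_one_component: "1 \<le> k \<Longrightarrow> tensor_one R S h L i x k = one_map i k (wproj L i k x)"
  by (simp add: tensor_one_def one_map_def)

lemma tensor_one_closed: "x \<in> carrier (gr L i) \<Longrightarrow> tensor_one R S h L i x \<in> carrier (gr LS i)"
  unfolding mem_gr_LS
  by (rule PiE_I, simp add: tensor_one_component one_map_closed wproj_wt) (simp add: tensor_one_def)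

theorem gauge_equiv_base_change_iff:
  assumes \<phi>: "\<phi> \<in> filt L \<delta> (- 1)"
  shows "gauge_equiv S LS (tensor_one R S h L (- 1) \<phi>) (tensor_one R S h L (- 1) (wproj L (- 1) \<delta> \<phi>)) \<longleftrightarrow>
    (\<exists>u. BW.solution (tensor_one R S h L (- 1) \<phi>) u)"
proof -
  have \<phi>c: "\<phi> \<in> carrier (gr L (- 1))" using \<phi> by (simp add: filt_def)
  have \<psi>c: "wproj L (- 1) \<delta> \<phi> \<in> carrier (gr L (- 1))" using \<phi>c \<delta>_pos by simp
  have low: "tensor_one R S h L (- 1) \<phi> k = \<zero>\<^bsub>B (- 1) k\<^esub>" if "1 \<le> k" "k < \<delta>" for k
    using filt_wproj[OF \<phi> that] that one_map_props(1)[OF that(1), of "- 1"] by (simp add: tensor_one_component)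
  have lead: "tensor_one R S h L (- 1) (wproj L (- 1) \<delta> \<phi>) k =
      (if k = \<delta> then tensor_one R S h L (- 1) \<phi> k else \<zero>\<^bsub>B (- 1) k\<^esub>)" if "1 \<le> k" for k
    using wproj_lead[OF \<phi>c that] that one_map_props(1)[OF that, of "- 1"] by (simp add: tensor_one_component)
  show ?thesis
    using BW.gauge_solution_iff[OF tensor_one_closed[OF \<phi>c] low tensor_one_closed[OF \<psi>c] lead]
      BW.solution_if_gauge_from_lead[OF tensor_one_closed[OF \<phi>c] low tensor_one_closed[OF \<psi>c] lead]
    unfolding gauge_equiv_def by blast
qed

text \<open>A solution over \<open>S\<close> need not come from \<open>R\<close>, so it is never
  descended as such. It only certifies, at each stage of the construction over \<open>R\<close>,
  that the next linear equation becomes solvable over \<open>S\<close>; that single equation between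
  two weight parts is what descends.\<close>

theorem solution_descends:
  assumes \<phi>: "\<phi> \<in> filt L \<delta> (- 1)" and ff: "faithfully_flat TYPE((nat \<Rightarrow> 'r \<times> 'g) set) R N"
  shows "(\<exists>u. W.solution \<phi> u) \<longleftrightarrow> (\<exists>u. BW.solution (tensor_one R S h L (- 1) \<phi>) u)"
proof -
  have \<phi>c: "\<phi> \<in> carrier (gr L (- 1))" using \<phi> by (simp add: filt_def)
  have f: "wproj L (- 1) k \<phi> \<in> wt L (- 1) k" if "1 \<le> k" for k by (rule wproj_wt[OF that \<phi>c])
  define t where "t = tensor_one R S h L (- 1) \<phi>"
  have t: "t \<in> carrier (gr LS (- 1))" unfolding t_def by (rule tensor_one_closed[OF \<phi>c])
  have tk: "t k = one_map (- 1) k (wproj L (- 1) k \<phi>)" if "1 \<le> k" for k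
    unfolding t_def by (rule tensor_one_component[OF that])
  have low: "t k = \<zero>\<^bsub>B (- 1) k\<^esub>" if "1 \<le> k" "k < \<delta>" for k
    using filt_wproj[OF \<phi> that] one_map_props(1)[OF that(1), of "- 1"] by (simp add: tk[OF that(1)])
  have res: "BW.residual (\<lambda>k. one_map 0 k (u k)) (\<lambda>k. t k) k = one_map (- 1) k (W.residual u (\<lambda>k. wproj L (- 1) k \<phi>) k)"
    if "\<And>k. 1 \<le> k \<Longrightarrow> u k \<in> wt L 0 k" "\<delta> < k" for u k
    by (rule residual_one_map[where u = u and f = "\<lambda>k. wproj L (- 1) k \<phi>", OF that(1) f that(2)]) (simp_all add: tk)
  show ?thesis
    unfolding t_def[symmetric]
  proof
    assume "\<exists>u. W.solution \<phi> u"
    then obtain u where u: "\<And>k. 1 \<le> k \<Longrightarrow> u k \<in> wt L 0 k" "\<And>k. \<delta> < k \<Longrightarrow> W.residual u (\<lambda>k. wproj L (- 1) k \<phi>) k = \<zero>\<^bsub>wt_module L (- 1) k\<^esub>"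
      by (auto simp: W.solution_def)
    have "BW.residual (\<lambda>k. one_map 0 k (u k)) (\<lambda>k. t k) k = \<zero>\<^bsub>B (- 1) k\<^esub>" if "\<delta> < k" for k
      using res[OF u(1) that] u(2)[OF that] one_map_props(1)[of k "- 1"] that by simp
    then have "BW.solution t (\<lambda>k. one_map 0 k (u k))"
      unfolding BW.solution_def using u(1) one_map_closed by auto
    then show "\<exists>u. BW.solution t u" by blast
  next
    assume "\<exists>u. BW.solution t u"
    then obtain U where U: "BW.solution t U" by blast
    show "\<exists>u. W.solution \<phi> u"
    proof (rule W.solution_stepwise[OF \<phi>c])
      show "wproj L (- 1) k \<phi> = \<zero>\<^bsub>wt_module L (- 1) k\<^esub>" if "1 \<le> k" "k < \<delta>" for k
        using filt_wproj[OF \<phi> that] by simp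
      fix n u assume n: "1 \<le> n" and "\<And>k. 1 \<le> k \<Longrightarrow> u k \<in> carrier (wt_module L 0 k)"
        and zero: "\<And>k. \<lbrakk>\<delta> < k; k < n + \<delta>\<rbrakk> \<Longrightarrow> W.residual u (\<lambda>k. wproj L (- 1) k \<phi>) k = \<zero>\<^bsub>wt_module L (- 1) k\<^esub>"
      then have u: "\<And>k. 1 \<le> k \<Longrightarrow> u k \<in> wt L 0 k" by simp
      define y where "y = W.residual u (\<lambda>k. wproj L (- 1) k \<phi>) (n + \<delta>)"
      define \<psi> where "\<psi> = wproj L (- 1) \<delta> \<phi>"
      have k: "1 \<le> n + \<delta>" "\<delta> < n + \<delta>" using n by auto
      have y: "y \<in> wt L (- 1) (n + \<delta>)"
        unfolding y_def by (rule e_residual(1)[where u = u and f = "\<lambda>k. wproj L (- 1) k \<phi>", OF u f k(2)])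
      have \<psi>: "\<psi> \<in> wt L (- 1) \<delta>" unfolding \<psi>_def by (rule f[OF \<delta>_pos])
      have "\<exists>v\<in>carrier (B 0 n). BW.residual (\<lambda>k. one_map 0 k (u k)) (\<lambda>k. t k) (n + \<delta>) =
          dd n v \<ominus>\<^bsub>B (- 1) (n + \<delta>)\<^esub> bb1 n \<delta> v (t \<delta>)"
      \<comment> \<open>The partial solution tensored with 1 is compared with the unrelated exact
        solution \<open>U\<close>.\<close>
      proof (rule BW.leading_residual_exact[OF t low U _ n])
        show "one_map 0 k (u k) \<in> carrier (B 0 k)" if "1 \<le> k" for k
          by (rule one_map_closed[OF that u[OF that]])
        show "BW.residual (\<lambda>k. one_map 0 k (u k)) (\<lambda>k. t k) k = \<zero>\<^bsub>B (- 1) k\<^esub>" if "\<delta> < k" "k < n + \<delta>" for k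
          using res[OF u that(1)] zero[OF that] one_map_props(1)[of k "- 1"] that by simp
      qed
      then obtain v where v: "v \<in> carrier (B 0 n)"
        "one_map (- 1) (n + \<delta>) y = dd n v \<ominus>\<^bsub>B (- 1) (n + \<delta>)\<^esub> bb1 n \<delta> v (one_map (- 1) \<delta> \<psi>)"
        using res[OF u k(2)] tk[OF \<delta>_pos] by (auto simp: y_def \<psi>_def)
      \<comment> \<open>The differential twisted by \<psi>, from weight \<open>n\<close> to weight n
        + \<delta>.\<close>
      define g where "g x = dif L 0 x \<ominus>\<^bsub>wt_module L (- 1) (n + \<delta>)\<^esub> bra L 0 (- 1) x \<psi>" for x
      interpret P: Module.module R "wt_module L (- 1) (n + \<delta>)" by (rule wt_module_module[OF k(1)])
      interpret EP: Module.module S "B (- 1) (n + \<delta>)" by (rule B_module[OF k(1)])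
      have d: "dif L 0 \<in> lin_maps R (wt_module L 0 n) (wt_module L (- 1) (n + \<delta>))"
        by (rule dif_wt_linear_0[OF n])
      have b: "(\<lambda>x. bra L 0 (- 1) x \<psi>) \<in> lin_maps R (wt_module L 0 n) (wt_module L (- 1) (n + \<delta>))"
        using bra_wt_bilinear_0(2)[OF n \<delta>_pos] \<psi> by (simp add: bilin_maps_def)
      have gx: "g x \<in> carrier (wt_module L (- 1) (n + \<delta>))" "g x \<oplus>\<^bsub>wt_module L (- 1) (n + \<delta>)\<^esub> bra L 0 (- 1) x \<psi> = dif L 0 x"
        "dif L 0 x \<in> carrier (wt_module L (- 1) (n + \<delta>))" "bra L 0 (- 1) x \<psi> \<in> carrier (wt_module L (- 1) (n + \<delta>))"
        if "x \<in> carrier (wt_module L 0 n)" for x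
      proof -
        have c: "dif L 0 x \<in> carrier (wt_module L (- 1) (n + \<delta>))" "bra L 0 (- 1) x \<psi> \<in> carrier (wt_module L (- 1) (n + \<delta>))"
          using d b that unfolding lin_maps_def by blast+
        then show "g x \<in> carrier (wt_module L (- 1) (n + \<delta>))" "g x \<oplus>\<^bsub>wt_module L (- 1) (n + \<delta>)\<^esub> bra L 0 (- 1) x \<psi> = dif L 0 x"
          unfolding g_def a_minus_def by (simp_all only: P.M.add.m_closed P.M.a_inv_closed P.M.a_assoc P.M.l_neg P.M.r_zero)
        show "dif L 0 x \<in> carrier (wt_module L (- 1) (n + \<delta>))" "bra L 0 (- 1) x \<psi> \<in> carrier (wt_module L (- 1) (n + \<delta>))"
          by (rule c)+
      qed
      have g: "g \<in> lin_maps R (wt_module L 0 n) (wt_module L (- 1) (n + \<delta>))"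
      proof -
        have "g (x \<oplus>\<^bsub>wt_module L 0 n\<^esub> x') = g x \<oplus>\<^bsub>wt_module L (- 1) (n + \<delta>)\<^esub> g x'"
          if x: "x \<in> carrier (wt_module L 0 n)" "x' \<in> carrier (wt_module L 0 n)" for x x'
        proof -
          have "dif L 0 (x \<oplus>\<^bsub>wt_module L 0 n\<^esub> x') = dif L 0 x \<oplus>\<^bsub>wt_module L (- 1) (n + \<delta>)\<^esub> dif L 0 x'"
            "bra L 0 (- 1) (x \<oplus>\<^bsub>wt_module L 0 n\<^esub> x') \<psi> = bra L 0 (- 1) x \<psi> \<oplus>\<^bsub>wt_module L (- 1) (n + \<delta>)\<^esub> bra L 0 (- 1) x' \<psi>"
            using d b x unfolding lin_maps_def by blast+
          then show ?thesis
            unfolding g_def a_minus_def using gx(3,4)[OF x(1)] gx(3,4)[OF x(2)]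
            by (simp only: P.M.minus_add P.M.a_ac P.M.add.m_closed P.M.a_inv_closed)
        qed
        moreover have "g (a \<odot>\<^bsub>wt_module L 0 n\<^esub> x) = a \<odot>\<^bsub>wt_module L (- 1) (n + \<delta>)\<^esub> g x"
          if x: "a \<in> carrier R" "x \<in> carrier (wt_module L 0 n)" for a x
        proof -
          have "dif L 0 (a \<odot>\<^bsub>wt_module L 0 n\<^esub> x) = a \<odot>\<^bsub>wt_module L (- 1) (n + \<delta>)\<^esub> dif L 0 x"
            "bra L 0 (- 1) (a \<odot>\<^bsub>wt_module L 0 n\<^esub> x) \<psi> = a \<odot>\<^bsub>wt_module L (- 1) (n + \<delta>)\<^esub> bra L 0 (- 1) x \<psi>"
            using d b x unfolding lin_maps_def by blast+
          then show ?thesis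
            unfolding g_def a_minus_def using gx(3,4)[OF x(2)] x(1)
            by (simp only: P.smult_r_minus P.smult_r_distr P.M.a_inv_closed)
        qed
        ultimately show ?thesis using gx(1) unfolding lin_maps_def by blast
      qed
      note gE = BC.lin_id_E[OF wt_module_module[OF n] wt_module_module[OF k(1)] g]
      note dE = dd[OF n k(1) n] and bE = bb1[OF n \<delta>_pos k(1) n \<delta>_pos]
      have \<psi>E: "one_map (- 1) \<delta> \<psi> \<in> carrier (B (- 1) \<delta>)" by (rule one_map_closed[OF \<delta>_pos \<psi>])
      \<comment> \<open>The twisted differential over \<open>S\<close> is the base change of
        \<open>g\<close>. The bracket with \<psi> is kept on the left so that the induction on
        tensors needs sums only.\<close>
      have sum: "tensor_map R (wt_module L (- 1) (n + \<delta>)) N g id w \<oplus>\<^bsub>B (- 1) (n + \<delta>)\<^esub> bb1 n \<delta> w (one_map (- 1) \<delta> \<psi>) = dd n w"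
        if "w \<in> carrier (B 0 n)" for w
        using wt_module_module[OF n] that
      proof (induction rule: BC.E_induct)
        case (pure x s)
        have "bb1 n \<delta> (pure_tensor R (wt_module L 0 n) N x s) (one_map (- 1) \<delta> \<psi>) =
            pure_tensor R (wt_module L (- 1) (n + \<delta>)) N (bra L 0 (- 1) x \<psi>) s"
          unfolding one_map_def using bE(4)[of x s \<psi> "\<one>\<^bsub>S\<^esub>"] pure \<psi> by simp
        moreover have "pure_tensor R (wt_module L (- 1) (n + \<delta>)) N (g x) s \<oplus>\<^bsub>B (- 1) (n + \<delta>)\<^esub>
            pure_tensor R (wt_module L (- 1) (n + \<delta>)) N (bra L 0 (- 1) x \<psi>) s =
            pure_tensor R (wt_module L (- 1) (n + \<delta>)) N (dif L 0 x) s"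
          using BC.pure_E(2)[OF wt_module_module[OF k(1)] gx(1)[OF pure(1)] gx(4)[OF pure(1)] pure(2)] gx(2)[OF pure(1)] by simp
        ultimately show ?case by (simp only: gE(3) dE(3))
      next
        case (add a b)
        then show ?case
          using \<psi>E gE(1)[OF add.hyps(1)] gE(1)[OF add.hyps(2)] bE(1)[OF add.hyps(1) \<psi>E] bE(1)[OF add.hyps(2) \<psi>E]
          by (simp only: gE(2) dE(2) bE(2) add.IH[symmetric] EP.M.a_ac EP.M.add.m_closed)
      qed
      have c: "tensor_map R (wt_module L (- 1) (n + \<delta>)) N g id v \<in> carrier (B (- 1) (n + \<delta>))"
        "bb1 n \<delta> v (one_map (- 1) \<delta> \<psi>) \<in> carrier (B (- 1) (n + \<delta>))"
        by (rule gE(1)[OF v(1)], rule bE(1)[OF v(1) \<psi>E])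
      have "tensor_map R (wt_module L (- 1) (n + \<delta>)) N g id v = one_map (- 1) (n + \<delta>) y"
        unfolding v(2) sum[OF v(1), symmetric] a_minus_def using c
        by (simp only: EP.M.a_assoc EP.M.r_neg EP.M.r_zero EP.M.a_inv_closed)
      then have "\<exists>x\<in>carrier (wt_module L 0 n). g x = y"
        unfolding one_map_def using y
        by (intro BC.solvable_over_base[OF ff wt_module_module[OF n] wt_module_module[OF k(1)] g _ v(1)]) simp_all
      then show "\<exists>v\<in>carrier (wt_module L 0 n). W.residual u (\<lambda>k. wproj L (- 1) k \<phi>) (n + \<delta>) =
          dif L 0 v \<ominus>\<^bsub>wt_module L (- 1) (n + \<delta>)\<^esub> bra L 0 (- 1) v (wproj L (- 1) \<delta> \<phi>)"
        unfolding g_def y_def \<psi>_def by metis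
    qed
  qed
qed

end

theorem theorem1p31:
  fixes R :: "'r ring" and \<delta> :: nat and L :: "('r, 'g) wdgla" and \<phi> :: 'g
  assumes "comm_Q_algebra R"
    and "1 \<le> \<delta>"
    and "weight_graded_dg_lie_algebra R \<delta> L"
    and "\<phi> \<in> MC_filt R L \<delta>"
  shows
    "(kaledin_class L \<delta> \<phi> = \<one>\<^bsub>homology (kaledin_complex L \<delta> \<phi>) (- 1)\<^esub> \<longleftrightarrow>
       (\<exists>l\<in>carrier (gr L 0). gauge R L l \<phi> = wproj L (- 1) \<delta> \<phi>))
     \<and>
     (\<forall>\<psi>. \<psi> \<in> MC R L \<and> \<psi> \<in> wt L (- 1) \<delta> \<and> trivial_group (homology (twist L \<psi>) (- 1)) \<longrightarrow>
       (\<forall>\<chi>\<in>MC_filt R L \<delta>. wproj L (- 1) \<delta> \<chi> = \<psi> \<longrightarrow> gauge_equiv R L \<chi> \<psi>))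
     \<and>
     (\<forall>(S :: 's ring) h. cring S \<and> h \<in> ring_hom R S \<and>
         faithfully_flat TYPE((nat \<Rightarrow> 'r \<times> 'g) set) R (restrict_scalars S h) \<longrightarrow>
       (gauge_equiv R L \<phi> (wproj L (- 1) \<delta> \<phi>) \<longleftrightarrow>
        gauge_equiv S (base_change R S h \<delta> L)
          (tensor_one R S h L (- 1) \<phi>) (tensor_one R S h L (- 1) (wproj L (- 1) \<delta> \<phi>))))"
proof -
  interpret weight_graded_Q R \<delta> L
    using assms by (simp add: weight_graded_Q_def weight_graded_Q_axioms_def)
  have \<phi>: "\<phi> \<in> filt L \<delta> (- 1)" using assms(4) by (simp add: MC_filt_def)
  show ?thesis
  proof (intro conjI allI impI ballI)
    show "kaledin_class L \<delta> \<phi> = \<one>\<^bsub>homology (kaledin_complex L \<delta> \<phi>) (- 1)\<^esub> \<longleftrightarrow>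
        (\<exists>l\<in>carrier (gr L 0). gauge R L l \<phi> = wproj L (- 1) \<delta> \<phi>)"
      by (rule kaledin_class_zero_iff_gauge[OF \<phi>])
  next
    fix \<psi> \<chi> assume "\<psi> \<in> MC R L \<and> \<psi> \<in> wt L (- 1) \<delta> \<and> trivial_group (homology (twist L \<psi>) (- 1))"
      "\<chi> \<in> MC_filt R L \<delta>" "wproj L (- 1) \<delta> \<chi> = \<psi>"
    then show "gauge_equiv R L \<chi> \<psi>" using rigid_if_trivial_homology[of \<chi>] by auto
  next
    fix S :: "'s ring" and h
    assume S: "cring S \<and> h \<in> ring_hom R S \<and> faithfully_flat TYPE((nat \<Rightarrow> 'r \<times> 'g) set) R (restrict_scalars S h)"
    interpret BC: weight_graded_base_change R \<delta> L S h
      using S by (simp add: weight_graded_base_change_def weight_graded_Q_axioms base_ring_change_def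
          base_ring_change_axioms_def is_cring)
    show "gauge_equiv R L \<phi> (wproj L (- 1) \<delta> \<phi>) \<longleftrightarrow>
        gauge_equiv S (base_change R S h \<delta> L)
          (tensor_one R S h L (- 1) \<phi>) (tensor_one R S h L (- 1) (wproj L (- 1) \<delta> \<phi>))"
      using S gauge_equiv_lead_iff[OF \<phi>] BC.gauge_equiv_base_change_iff[OF \<phi>] BC.solution_descends[OF \<phi>] by simp
  qed
qed

end
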